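(* Let $\Phi$ be a nuclear space over $\mathbb{R}$ and let $L=\{L_t\}_{t\ge0}$ be a $\Phi'_\beta$-valued Lévy process. Suppose that for every $T>0$ the family $\{L_t:t\in[0,T]\}$ of linear maps from $\Phi$ into $L^0(\Omega,\mathscr{F},\mathbb{P})$ given by $\phi\mapsto L_t[\phi]$ is equicontinuous. Then $L$ has a $\Phi'_\beta$-valued, regular, càdlàg version $\tilde L=\{\tilde L_t\}_{t\ge0}$ that is also a Lévy process. Moreover there exists a countably Hilbertian topology $\vartheta_L$ on $\Phi$ such that $\tilde L$ is a $(\widetilde{\Phi_{\vartheta_L}})'_\beta$-valued càdlàg process.
   Context: $\Phi'_\beta$ is the strong dual of $\Phi$, $f[\phi]$ the pairing. A semi-norm $p$ on $\Phi$ is Hilbertian if $p(\phi)^2=Q(\phi,\phi)$ for a symmetric non-negative bilinear form $Q$; $\Phi_p$ is then the Hilbert completion of $\Phi/\ker p$ and, for $p\le q$, $i_{p,q}:\Phi_q\to\Phi_p$ is the canonical map. A Hausdorff locally convex space is nuclear if its topology is generated by a family of Hilbertian semi-norms such that for each member $p$ there is a member $q\ge p$ with $i_{p,q}$ Hilbert-Schmidt. $(\Omega,\mathscr{F},\mathbb{P})$ is a complete probability space; $L^0(\Omega,\mathscr{F},\mathbb{P})$ (classes of real random variables) has the topology of convergence in probability. A (weaker) countably Hilbertian topology $\theta$ on $\Phi$ is one generated by an increasing sequence of continuous Hilbertian semi-norms on $\Phi$; $\Phi_\theta=(\Phi,\theta)$, $\Phi'_\theta$ is its dual, $\widetilde{\Phi_\theta}$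 its completion and $(\widetilde{\Phi_\theta})'_\beta$ the strong dual of the completion, canonically contained in $\Phi'_\beta$. A $\Phi'_\beta$-valued random variable $X$ is regular if $\mathbb{P}(X\in\Phi'_\theta)=1$ for some such $\theta$; a process is regular if it is so at each time. Càdlàg means that a.s. the paths are right-continuous with left limits. A Borel measure on $\Phi'_\beta$ is Radon if every Borel set $\Gamma$ contains, for each $\epsilon>0$, a compact set $K$ with measure of $\Gamma\setminus K$ less than $\epsilon$; $\mathfrak{M}^1_R(\Phi'_\beta)$ is the set of Radon probability measures. A $\Phi'_\beta$-valued process is a Lévy process if it starts at $0$ a.s., has independent and stationary increments, and the law $\mu_t$ at each time $t$ is Radon with $t\mapsto\mu_t\in\mathfrak{M}^1_R(\Phi'_\beta)$ weakly continuous at $0$. *)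

theory Defs
  imports "HOL-Analysis.Analysis" "HOL-Probability.Probability"
begin

section \<open>Topological vector spaces with explicit carrier\<close>

text \<open>
  The nuclear space \<open>\<Phi>\<close> is a type of class \<^class>\<open>real_vector\<close> together with a topology
  on it.  Its completion under a weaker topology is a set of equivalence classes, so the dual
  and its strong topology are defined for spaces with an explicit carrier.
\<close>

record 'v tvs =
  vecs :: "'v set"
  vzero :: 'v
  vadd :: "'v \<Rightarrow> 'v \<Rightarrow> 'v"
  vscale :: "real \<Rightarrow> 'v \<Rightarrow> 'v"
  vtop :: "'v topology"

definition tvs_of :: "'a::real_vector topology \<Rightarrow> 'a tvs" where
  "tvs_of T = \<lparr>vecs = UNIV, vzero = 0, vadd = (+), vscale = (*\<^sub>R), vtop = T\<rparr>"

text \<open>Functionals are \<^const>\<open>extensional\<close>, so that they are determined by their values on the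
  carrier.\<close>

definition dual :: "'v tvs \<Rightarrow> ('v \<Rightarrow> real) set" where
  "dual E = {f \<in> extensional (vecs E).
     (\<forall>x\<in>vecs E. \<forall>y\<in>vecs E. f (vadd E x y) = f x + f y) \<and>
     (\<forall>r. \<forall>x\<in>vecs E. f (vscale E r x) = r * f x) \<and>
     continuous_map (vtop E) euclideanreal f}"

definition bounded_in :: "'v tvs \<Rightarrow> 'v set \<Rightarrow> bool" where
  "bounded_in E B \<longleftrightarrow> B \<subseteq> vecs E \<and>
     (\<forall>U. openin (vtop E) U \<and> vzero E \<in> U \<longrightarrow>
        (\<exists>s>0. \<forall>r\<ge>s. B \<subseteq> vscale E r ` U))"

definition strong_dual :: "'v tvs \<Rightarrow> ('v \<Rightarrow> real) topology" where
  "strong_dual E = topology_generated_by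
     (insert (dual E)
       {{g \<in> dual E. (SUP x\<in>B. \<bar>g x - f x\<bar>) < r} | f B r.
          f \<in> dual E \<and> bounded_in E B \<and> B \<noteq> {} \<and> r > 0})"


section \<open>Hilbertian semi-norms and nuclear spaces\<close>

definition is_seminorm :: "('a::real_vector \<Rightarrow> real) \<Rightarrow> bool" where
  "is_seminorm p \<longleftrightarrow> (\<forall>x. 0 \<le> p x) \<and> (\<forall>r x. p (r *\<^sub>R x) = \<bar>r\<bar> * p x) \<and>
     (\<forall>x y. p (x + y) \<le> p x + p y)"

definition hilbertian :: "('a::real_vector \<Rightarrow> real) \<Rightarrow> bool" where
  "hilbertian p \<longleftrightarrow> is_seminorm p \<and>
     (\<exists>Q. bilinear Q \<and> (\<forall>x y. Q x y = Q y x) \<and> (\<forall>x. 0 \<le> Q x x) \<and> (\<forall>x. (p x)\<^sup>2 = Q x x))"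

text \<open>The symmetric bilinear form of a Hilbertian semi-norm is unique, by polarization.\<close>

definition hilbertian_form :: "('a::real_vector \<Rightarrow> real) \<Rightarrow> 'a \<Rightarrow> 'a \<Rightarrow> real" where
  "hilbertian_form p x y = ((p (x + y))\<^sup>2 - (p (x - y))\<^sup>2) / 4"

text \<open>The whole space is added to the generating sets, so that an empty family of semi-norms
  generates the indiscrete topology.\<close>

definition seminorm_topology :: "('a::real_vector \<Rightarrow> real) set \<Rightarrow> 'a topology" where
  "seminorm_topology P =
     topology_generated_by (insert UNIV {{y. p (y - x) < r} | p x r. p \<in> P \<and> r > 0})"

text \<open>
  The completion of \<open>(\<Phi>, \<theta>)\<close>, used only for pseudo-metrizable \<open>\<theta>\<close>, where Cauchy sequences
  suffice.  Two Cauchy sequences are identified if their difference tends to zero; this also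
  passes to the quotient by the closure of \<open>{0}\<close>, which for the topology of a single
  semi-norm \<open>p\<close> is \<open>ker p\<close>.
\<close>

definition cauchy_in :: "'a::real_vector topology \<Rightarrow> (nat \<Rightarrow> 'a) \<Rightarrow> bool" where
  "cauchy_in \<theta> X \<longleftrightarrow> (\<forall>U. openin \<theta> U \<and> 0 \<in> U \<longrightarrow> (\<exists>N. \<forall>m\<ge>N. \<forall>n\<ge>N. X m - X n \<in> U))"

definition cauchy_rel :: "'a::real_vector topology \<Rightarrow> ((nat \<Rightarrow> 'a) \<times> (nat \<Rightarrow> 'a)) set" where
  "cauchy_rel \<theta> = {(X, Y). cauchy_in \<theta> X \<and> cauchy_in \<theta> Y \<and>
     limitin \<theta> (\<lambda>n. X n - Y n) 0 sequentially}"

definition completion_set :: "'a::real_vector topology \<Rightarrow> (nat \<Rightarrow> 'a) set set" where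
  "completion_set \<theta> = {X. cauchy_in \<theta> X} // cauchy_rel \<theta>"

definition completion_embed :: "'a::real_vector topology \<Rightarrow> 'a \<Rightarrow> (nat \<Rightarrow> 'a) set" where
  "completion_embed \<theta> x = cauchy_rel \<theta> `` {\<lambda>_. x}"

definition representative :: "(nat \<Rightarrow> 'a) set \<Rightarrow> nat \<Rightarrow> 'a" where
  "representative c = (SOME X. X \<in> c)"

text \<open>\<open>extended_dist p c d\<close> is the value at \<open>d - c\<close> of the continuous extension of the
  semi-norm \<open>p\<close> to the completion.\<close>

definition extended_dist ::
    "('a::real_vector \<Rightarrow> real) \<Rightarrow> (nat \<Rightarrow> 'a) set \<Rightarrow> (nat \<Rightarrow> 'a) set \<Rightarrow> real" where
  "extended_dist p c d = lim (\<lambda>n. p (representative d n - representative c n))"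

definition tvs_completion :: "'a::real_vector topology \<Rightarrow> (nat \<Rightarrow> 'a) set tvs" where
  "tvs_completion \<theta> =
     \<lparr>vecs = completion_set \<theta>,
      vzero = completion_embed \<theta> 0,
      vadd = (\<lambda>c d. cauchy_rel \<theta> `` {\<lambda>n. X n + Y n | X Y. X \<in> c \<and> Y \<in> d}),
      vscale = (\<lambda>r c. cauchy_rel \<theta> `` {\<lambda>n. r *\<^sub>R X n | X. X \<in> c}),
      vtop = topology_generated_by
        (insert (completion_set \<theta>)
          {{d \<in> completion_set \<theta>. extended_dist p c d < r} | p c r.
             is_seminorm p \<and> continuous_map \<theta> euclideanreal p \<and> c \<in> completion_set \<theta> \<and> r > 0})\<rparr>"

text \<open>The Hilbert space \<open>\<Phi>\<^sub>p\<close>.\<close>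

definition hilbert_space :: "('a::real_vector \<Rightarrow> real) \<Rightarrow> (nat \<Rightarrow> 'a) set set" where
  "hilbert_space p = completion_set (seminorm_topology {p})"

definition hilbert_inner ::
    "('a::real_vector \<Rightarrow> real) \<Rightarrow> (nat \<Rightarrow> 'a) set \<Rightarrow> (nat \<Rightarrow> 'a) set \<Rightarrow> real" where
  "hilbert_inner p c d = lim (\<lambda>n. hilbertian_form p (representative c n) (representative d n))"

definition orthonormal_basis :: "('a::real_vector \<Rightarrow> real) \<Rightarrow> (nat \<Rightarrow> 'a) set set \<Rightarrow> bool" where
  "orthonormal_basis p B \<longleftrightarrow> B \<subseteq> hilbert_space p \<and>
     (\<forall>e\<in>B. \<forall>e'\<in>B. hilbert_inner p e e' = (if e = e' then 1 else 0)) \<and>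
     (\<forall>c\<in>hilbert_space p. (\<forall>e\<in>B. hilbert_inner p c e = 0) \<longrightarrow> hilbert_inner p c c = 0)"

text \<open>For \<open>p \<le> q\<close>, all members of a \<open>q\<close>-class lie in one \<open>p\<close>-class, which is the image of
  the \<open>q\<close>-class under the canonical map from \<open>\<Phi>\<^sub>q\<close> to \<open>\<Phi>\<^sub>p\<close>.\<close>

definition canonical_map :: "('a::real_vector \<Rightarrow> real) \<Rightarrow> (nat \<Rightarrow> 'a) set \<Rightarrow> (nat \<Rightarrow> 'a) set" where
  "canonical_map p c = cauchy_rel (seminorm_topology {p}) `` c"

definition hilbert_schmidt ::
    "('a::real_vector \<Rightarrow> real) \<Rightarrow> ('a \<Rightarrow> real) \<Rightarrow> ((nat \<Rightarrow> 'a) set \<Rightarrow> (nat \<Rightarrow> 'a) set) \<Rightarrow> bool" where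
  "hilbert_schmidt q p A \<longleftrightarrow>
     (\<exists>B. orthonormal_basis q B \<and> (\<lambda>e. hilbert_inner p (A e) (A e)) summable_on B)"

definition nuclear :: "'a::real_vector topology \<Rightarrow> bool" where
  "nuclear T \<longleftrightarrow> Hausdorff_space T \<and>
     (\<exists>P. (\<forall>p\<in>P. hilbertian p) \<and> T = seminorm_topology P \<and>
        (\<forall>p\<in>P. \<exists>q\<in>P. (\<forall>x. p x \<le> q x) \<and> hilbert_schmidt q p (canonical_map p)))"

definition countably_hilbertian :: "'a::real_vector topology \<Rightarrow> 'a topology \<Rightarrow> bool" where
  "countably_hilbertian T \<theta> \<longleftrightarrow>
     (\<exists>p :: nat \<Rightarrow> 'a \<Rightarrow> real.
        (\<forall>n. hilbertian (p n) \<and> continuous_map T euclideanreal (p n)) \<and>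
        (\<forall>n x. p n x \<le> p (Suc n) x) \<and>
        \<theta> = seminorm_topology (range p))"

text \<open>The canonical map from the dual of the completion of \<open>(\<Phi>, \<theta>)\<close> to the dual of \<open>\<Phi>\<close>.\<close>

definition restrict_functional ::
    "'a::real_vector topology \<Rightarrow> ((nat \<Rightarrow> 'a) set \<Rightarrow> real) \<Rightarrow> 'a \<Rightarrow> real" where
  "restrict_functional \<theta> f = (\<lambda>x. f (completion_embed \<theta> x))"


section \<open>Measures and random variables on a topological space\<close>

definition borel_of :: "'x topology \<Rightarrow> 'x measure" where
  "borel_of S = sigma (topspace S) {U. openin S U}"

definition radon_prob :: "'x topology \<Rightarrow> 'x measure set" where
  "radon_prob S = {\<mu>. prob_space \<mu> \<and> sets \<mu> = sets (borel_of S) \<and>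
     (\<forall>\<Gamma>\<in>sets \<mu>. \<forall>\<epsilon>>0. \<exists>K\<in>sets \<mu>. K \<subseteq> \<Gamma> \<and> compactin S K \<and> measure \<mu> (\<Gamma> - K) < \<epsilon>)}"

definition weak_topology :: "'x topology \<Rightarrow> 'x measure topology" where
  "weak_topology S = topology_generated_by
     (insert (radon_prob S)
       {{\<mu> \<in> radon_prob S. (\<integral>x. f x \<partial>\<mu>) \<in> U} | f U.
          continuous_map S euclideanreal f \<and> bounded (f ` topspace S) \<and> open U})"

definition is_process :: "'w measure \<Rightarrow> 'x topology \<Rightarrow> (real \<Rightarrow> 'w \<Rightarrow> 'x) \<Rightarrow> bool" where
  "is_process M S X \<longleftrightarrow> (\<forall>t\<ge>0. X t \<in> M \<rightarrow>\<^sub>M borel_of S)"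

definition cadlag_path :: "'x topology \<Rightarrow> (real \<Rightarrow> 'x) \<Rightarrow> bool" where
  "cadlag_path S x \<longleftrightarrow>
     (\<forall>t\<ge>0. limitin S x (x t) (at_right t)) \<and> (\<forall>t>0. \<exists>l. limitin S x l (at_left t))"

definition cadlag_process :: "'w measure \<Rightarrow> 'x topology \<Rightarrow> (real \<Rightarrow> 'w \<Rightarrow> 'x) \<Rightarrow> bool" where
  "cadlag_process M S X \<longleftrightarrow> is_process M S X \<and> (AE \<omega> in M. cadlag_path S (\<lambda>t. X t \<omega>))"

definition is_version :: "'w measure \<Rightarrow> (real \<Rightarrow> 'w \<Rightarrow> 'x) \<Rightarrow> (real \<Rightarrow> 'w \<Rightarrow> 'x) \<Rightarrow> bool" where
  "is_version M X Y \<longleftrightarrow> (\<forall>t\<ge>0. AE \<omega> in M. X t \<omega> = Y t \<omega>)"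


section \<open>The space of real random variables\<close>

definition L0_rel :: "'w measure \<Rightarrow> (('w \<Rightarrow> real) \<times> ('w \<Rightarrow> real)) set" where
  "L0_rel M = {(X, Y). X \<in> borel_measurable M \<and> Y \<in> borel_measurable M \<and> (AE \<omega> in M. X \<omega> = Y \<omega>)}"

definition L0_class :: "'w measure \<Rightarrow> ('w \<Rightarrow> real) \<Rightarrow> ('w \<Rightarrow> real) set" where
  "L0_class M X = L0_rel M `` {X}"

definition L0 :: "'w measure \<Rightarrow> ('w \<Rightarrow> real) set set" where
  "L0 M = borel_measurable M // L0_rel M"

text \<open>The topology of convergence in probability; the generating sets are open in it.\<close>

definition L0_topology :: "'w measure \<Rightarrow> ('w \<Rightarrow> real) set topology" where
  "L0_topology M = topology_generated_by
     (insert (L0 M)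
       {{L0_class M Y | Y. Y \<in> borel_measurable M \<and>
            measure M {\<omega> \<in> space M. \<bar>Y \<omega> - X \<omega>\<bar> \<ge> \<epsilon>} < \<delta>} | X \<epsilon> \<delta>.
          X \<in> borel_measurable M \<and> \<epsilon> > 0 \<and> \<delta> > 0})"

text \<open>Equicontinuity at zero, which for a family of linear maps is equicontinuity.\<close>

definition equicontinuous_L0 ::
    "'a::real_vector topology \<Rightarrow> 'w measure \<Rightarrow> ('a \<Rightarrow> ('w \<Rightarrow> real) set) set \<Rightarrow> bool" where
  "equicontinuous_L0 T M F \<longleftrightarrow>
     (\<forall>V. openin (L0_topology M) V \<and> L0_class M (\<lambda>_. 0) \<in> V \<longrightarrow>
        (\<exists>U. openin T U \<and> 0 \<in> U \<and> (\<forall>A\<in>F. A ` U \<subseteq> V)))"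


section \<open>Processes in the strong dual\<close>

definition regular_process ::
    "'w measure \<Rightarrow> 'a::real_vector topology \<Rightarrow> (real \<Rightarrow> 'w \<Rightarrow> 'a \<Rightarrow> real) \<Rightarrow> bool" where
  "regular_process M T X \<longleftrightarrow> is_process M (strong_dual (tvs_of T)) X \<and>
     (\<forall>t\<ge>0. \<exists>\<theta>. countably_hilbertian T \<theta> \<and> (AE \<omega> in M. X t \<omega> \<in> dual (tvs_of \<theta>)))"

definition levy_process ::
    "'w measure \<Rightarrow> 'a::real_vector topology \<Rightarrow> (real \<Rightarrow> 'w \<Rightarrow> 'a \<Rightarrow> real) \<Rightarrow> bool" where
  "levy_process M T X \<longleftrightarrow>
     (let S = strong_dual (tvs_of T);
          law = (\<lambda>Z. distr M (borel_of S) Z);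
          incr = (\<lambda>s t \<omega> \<phi>. X t \<omega> \<phi> - X s \<omega> \<phi>)
      in is_process M S X \<and>
         (AE \<omega> in M. X 0 \<omega> = (\<lambda>\<phi>. 0)) \<and>
         (\<forall>n (t :: nat \<Rightarrow> real). 0 \<le> t 0 \<and> (\<forall>i<n. t i < t (Suc i)) \<longrightarrow>
            prob_space.indep_vars M (\<lambda>i. borel_of S) (\<lambda>i. incr (t i) (t (Suc i))) {..<n}) \<and>
         (\<forall>s t. 0 \<le> s \<and> s \<le> t \<longrightarrow> law (incr s t) = law (X (t - s))) \<and>
         (\<forall>t\<ge>0. law (X t) \<in> radon_prob S) \<and>
         topcontinuous_at (top_of_set {0..}) (weak_topology S) (\<lambda>t. law (X t)) 0)"

end

theory Submission
  imports Defs
begin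

text \<open>
  Averaging over random signs shows that a random functional which is small in probability
  where a Hilbertian semi-norm \<open>p\<close> is small is bounded, with high probability, by a multiple of a
  semi-norm \<open>q\<close> such that \<open>i\<^bsub>p,q\<^esub>\<close> is Hilbert--Schmidt.  The bound holds on every finite
  set of vectors with constants that do not depend on this set; since the laws are Radon, it
  extends to all of \<open>\<Phi>\<close>.  Ottaviani's inequality for the independent and stationary increments
  makes it uniform over the dyadic times in a bounded interval.  By Borel--Cantelli, almost every
  path over the dyadic times is thus locally bounded by a multiple of some \<open>q\<^sub>n\<close>.

  For a single vector, independence of increments makes many oscillations of size \<open>\<epsilon>\<close> in a short
  interval exponentially unlikely, so that the real path has one-sided limits along the dyadic times.
  A further Hilbert--Schmidt embedding makes balls totally bounded, hence countably many vectors
  suffice to get these limits uniformly, i.e. in the dual norm.  The right limits form the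
  required version.
\<close>

section \<open>Random signs\<close>

text \<open>The obstacle is that \<Phi> need not be separable and its strong dual need not be second
  countable. A bound for all vectors is thus an uncountable intersection of events, and two random
  functionals that agree almost surely at each vector need not agree almost surely. The first
  difficulty is met by writing the complement of a dual ball as a union of open sets: for a Radon
  law, finitely many of them carry all but \<epsilon> of its mass, so estimates for finite families
  with uniform constants suffice. The second is met by confining both functionals to one dual ball,
  in which countably many vectors separate points. Borel measurability of the new process is
  inherited from \<open>L\<close> through completeness of \<open>M\<close>.

  The n-th ball misses some value of the path at dyadic times up to n with probability at most
  \<open>(1 / 2) ^ n\<close>, which is summable. The semi-norms of these countably many balls are
  fixed before time and sample point, so one countably Hilbertian topology serves all times.\<close>

lemma hilbertian_seminorm: "hilbertian p \<Longrightarrow> is_seminorm p"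
  by (simp add: hilbertian_def)

lemma is_seminormD:
  assumes "is_seminorm p"
  shows "0 \<le> p x" and "p (r *\<^sub>R x) = \<bar>r\<bar> * p x" and "p (x + y) \<le> p x + p y"
    and "p 0 = 0" and "p (- x) = p x" and "p (x - y) \<le> p x + p y" and "p (x - y) = p (y - x)"
proof -
  show 1: "0 \<le> p x" "p (r *\<^sub>R x) = \<bar>r\<bar> * p x" "p (x + y) \<le> p x + p y" for x y r
    using assms by (auto simp: is_seminorm_def)
  show "p 0 = 0" using 1(2)[of 0 0] by simp
  show neg: "p (- x) = p x" for x using 1(2)[of "-1" x] by simp
  show "p (x - y) \<le> p x + p y" using 1(3)[of x "- y"] neg by simp
  show "p (x - y) = p (y - x)" using neg[of "y - x"] by simp
qed

lemma hilbertian_form_eq: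
  assumes "bilinear Q" "\<And>x y. Q x y = Q y x" "\<And>x. (p x)\<^sup>2 = Q x x"
  shows "hilbertian_form p = Q"
  by (intro ext) (simp add: hilbertian_form_def assms(3) bilinear_ladd[OF assms(1)] bilinear_radd[OF assms(1)]
      bilinear_lsub[OF assms(1)] bilinear_rsub[OF assms(1)] assms(2)[of _ y for y])

lemma hilbertian_formD:
  assumes "hilbertian p"
  shows "bilinear (hilbertian_form p)" and "hilbertian_form p x y = hilbertian_form p y x"
    and "hilbertian_form p x x = (p x)\<^sup>2"
proof -
  obtain Q where Q: "bilinear Q" "\<And>x y. Q x y = Q y x" "\<And>x. (p x)\<^sup>2 = Q x x"
    using assms by (auto simp: hilbertian_def)
  show "bilinear (hilbertian_form p)" "hilbertian_form p x y = hilbertian_form p y x"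
    "hilbertian_form p x x = (p x)\<^sup>2"
    using Q by (simp_all add: hilbertian_form_eq[OF Q])
qed

lemma hilbertian_parallelogram:
  assumes "hilbertian p"
  shows "(p (x + y))\<^sup>2 + (p (x - y))\<^sup>2 = 2 * (p x)\<^sup>2 + 2 * (p y)\<^sup>2"
  using hilbertian_formD(1)[OF assms] 
  by (simp add: hilbertian_formD(3)[OF assms, symmetric] bilinear_ladd bilinear_radd bilinear_lsub bilinear_rsub)

text \<open>Subsets of \<open>{..<Suc m}\<close> are sorted by whether they contain
  \<open>m\<close>, that is, by the sign of the last term. This is the induction step of all
  averages over signs.\<close>

lemma sum_Pow_lessThan_Suc:
  fixes f :: "nat set \<Rightarrow> 'b::comm_monoid_add"
  shows "(\<Sum>B\<in>Pow {..<Suc m}. f B) = (\<Sum>B\<in>Pow {..<m}. f (insert m B) + f B)"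
proof -
  have "(\<Sum>B\<in>Pow {..<Suc m}. f B) = sum f (Pow {..<m}) + sum f (insert m ` Pow {..<m})"
    unfolding lessThan_Suc Pow_insert by (rule sum.union_disjoint) auto
  also have "sum f (insert m ` Pow {..<m}) = sum (f \<circ> insert m) (Pow {..<m})"
    by (rule sum.reindex) (auto simp: inj_on_def)
  finally show ?thesis by (simp add: sum.distrib add.commute)
qed

text \<open>A Rademacher sum: the subset \<open>B\<close> carries the plus signs. Averaging over
  \<open>Pow {..<m}\<close> takes the place of an expectation over random signs, so that no second
  probability space enters.\<close>

definition sign_sum :: "nat \<Rightarrow> (nat \<Rightarrow> 'a::real_vector) \<Rightarrow> nat set \<Rightarrow> 'a" where
  "sign_sum m x B = (\<Sum>j<m. (if j \<in> B then 1 else -1) *\<^sub>R x j)"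

lemma sign_sum_Suc:
  assumes "B \<in> Pow {..<m}"
  shows "sign_sum (Suc m) x (insert m B) = sign_sum m x B + x m"
    and "sign_sum (Suc m) x B = sign_sum m x B - x m"
proof -
  have "sign_sum m x (insert m B) = sign_sum m x B"
    unfolding sign_sum_def by (intro sum.cong) auto
  then show "sign_sum (Suc m) x (insert m B) = sign_sum m x B + x m"
    by (simp add: sign_sum_def)
  show "sign_sum (Suc m) x B = sign_sum m x B - x m"
    using assms by (auto simp: sign_sum_def)
qed

text \<open>When the sign of the last vector is averaged, the parallelogram law cancels the cross
  terms; this is where \<open>p\<close> must be Hilbertian.\<close>

lemma sign_sum_second_moment:
  assumes "hilbertian p"
  shows "(\<Sum>B\<in>Pow {..<m}. (p (sign_sum m x B))\<^sup>2) = 2 ^ m * (\<Sum>j<m. (p (x j))\<^sup>2)"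
proof (induction m)
  case 0
  then show ?case by (simp add: sign_sum_def is_seminormD[OF hilbertian_seminorm[OF assms]])
next
  case (Suc m)
  have "(\<Sum>B\<in>Pow {..<Suc m}. (p (sign_sum (Suc m) x B))\<^sup>2)
      = (\<Sum>B\<in>Pow {..<m}. 2 * (p (sign_sum m x B))\<^sup>2 + 2 * (p (x m))\<^sup>2)"
    unfolding sum_Pow_lessThan_Suc
    by (intro sum.cong refl) (simp add: sign_sum_Suc hilbertian_parallelogram[OF assms])
  also have "\<dots> = 2 * (\<Sum>B\<in>Pow {..<m}. (p (sign_sum m x B))\<^sup>2) + 2 ^ m * (2 * (p (x m))\<^sup>2)"
    by (simp add: sum.distrib sum_distrib_left card_Pow)
  finally show ?case by (simp add: Suc algebra_simps)
qed

lemma hilbertian_abs: "hilbertian (abs :: real \<Rightarrow> real)"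
proof -
  have "bilinear ((*) :: real \<Rightarrow> real \<Rightarrow> real)"
    by (auto simp: bilinear_def intro!: linearI simp: algebra_simps)
  then show ?thesis
    unfolding hilbertian_def is_seminorm_def
    by (intro conjI exI[of _ "(*)"]) (auto simp: abs_mult power2_eq_square)
qed

lemma sign_sum_second_moment_real:
  fixes a :: "nat \<Rightarrow> real"
  shows "(\<Sum>B\<in>Pow {..<m}. (sign_sum m a B)\<^sup>2) = 2 ^ m * (\<Sum>j<m. (a j)\<^sup>2)"
  using sign_sum_second_moment[OF hilbertian_abs, of m a] by simp

text \<open>A case of Khinchin's inequality. Adding a term with both signs produces a mixed term of
  second order in each factor, whose average is known exactly from the second moment; the factor 3
  is the one that this recursion reproduces.\<close>

lemma sign_sum_fourth_moment:
  fixes a :: "nat \<Rightarrow> real"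
  shows "(\<Sum>B\<in>Pow {..<m}. (sign_sum m a B) ^ 4) \<le> 2 ^ m * (3 * (\<Sum>j<m. (a j)\<^sup>2)\<^sup>2)"
proof (induction m)
  case 0
  then show ?case by (simp add: sign_sum_def)
next
  case (Suc m)
  define s where "s = (\<Sum>j<m. (a j)\<^sup>2)"
  have "(\<Sum>B\<in>Pow {..<Suc m}. (sign_sum (Suc m) a B) ^ 4)
      = (\<Sum>B\<in>Pow {..<m}. 2 * (sign_sum m a B) ^ 4 + 12 * (a m)\<^sup>2 * (sign_sum m a B)\<^sup>2 + 2 * (a m) ^ 4)"
    unfolding sum_Pow_lessThan_Suc
    by (intro sum.cong refl) (simp add: sign_sum_Suc power4_eq_xxxx power2_eq_square algebra_simps)
  also have "\<dots> = 2 * (\<Sum>B\<in>Pow {..<m}. (sign_sum m a B) ^ 4) + 12 * (a m)\<^sup>2 * (2 ^ m * s) + 2 ^ m * (2 * (a m) ^ 4)"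
    by (simp add: sum.distrib sum_distrib_left[symmetric] card_Pow s_def sign_sum_second_moment_real)
  also have "\<dots> \<le> 2 * (2 ^ m * (3 * s\<^sup>2)) + 12 * (a m)\<^sup>2 * (2 ^ m * s) + 2 ^ m * (2 * (a m) ^ 4)"
    using Suc by (simp add: s_def)
  also have "\<dots> = 2 ^ Suc m * (3 * s\<^sup>2 + 6 * (a m)\<^sup>2 * s + (a m) ^ 4)"
    by (simp add: algebra_simps)
  also have "\<dots> \<le> 2 ^ Suc m * (3 * (s + (a m)\<^sup>2)\<^sup>2)"
    proof (intro mult_left_mono)
    have "3 * s\<^sup>2 + 6 * (a m)\<^sup>2 * s + (a m) ^ 4 + 2 * ((a m)\<^sup>2)\<^sup>2 = 3 * (s + (a m)\<^sup>2)\<^sup>2"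
      by (simp add: power2_eq_square power4_eq_xxxx algebra_simps)
    then show "3 * s\<^sup>2 + 6 * (a m)\<^sup>2 * s + (a m) ^ 4 \<le> 3 * (s + (a m)\<^sup>2)\<^sup>2"
      using zero_le_power2[of "(a m)\<^sup>2"] by linarith
  qed simp
  finally show ?case by (simp add: s_def)
qed

text \<open>The Paley--Zygmund inequality; the Cauchy--Schwarz step is replaced by a pointwise
  inequality between \<open>z = (sign_sum m a B)\<^sup>2\<close>, \<open>z\<^sup>2\<close> and the indicator of \<open>4 * z \<ge> s\<close>.\<close>

lemma sign_sum_anticoncentration:
  fixes a :: "nat \<Rightarrow> real"
  assumes s: "(\<Sum>j<m. (a j)\<^sup>2) > 0"
  shows "3 / 16 * 2 ^ m \<le> (\<Sum>B\<in>Pow {..<m}. of_bool ((\<Sum>j<m. (a j)\<^sup>2) \<le> 4 * (sign_sum m a B)\<^sup>2) :: real)"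
proof -
  define s where "s = (\<Sum>j<m. (a j)\<^sup>2)"
  have sp: "s > 0" using s by (simp add: s_def)
  have pt: "8 * s * z \<le> 2 * s\<^sup>2 + z\<^sup>2 + 16 * s\<^sup>2 * of_bool (s \<le> 4 * z)" if "z \<ge> 0" for z :: real
  proof (cases "s \<le> 4 * z")
    case True
    have "0 \<le> (z - 4 * s)\<^sup>2" by simp
    then have "8 * s * z \<le> z\<^sup>2 + 16 * s\<^sup>2" by (simp add: power2_eq_square algebra_simps)
    then have "8 * s * z \<le> 2 * s\<^sup>2 + z\<^sup>2 + 16 * s\<^sup>2"
      using zero_le_power2[of s] by linarith
    then show ?thesis using True by simp
  next
    case False
    then have "s * (4 * z) \<le> s * s" using sp by (intro mult_left_mono) auto
    moreover have "0 \<le> z\<^sup>2" by simp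
    ultimately have "8 * s * z \<le> 2 * s\<^sup>2 + z\<^sup>2" unfolding power2_eq_square by argo
    then show ?thesis using False by simp
  qed
  \<comment> \<open>Averaged over the signs, \<open>z\<close> has mean \<open>s\<close> and
    \<open>z\<^sup>2\<close> has mean at most \<open>3 * s\<^sup>2\<close>. The pointwise inequality
    then gives \<open>8 * s\<^sup>2 \<le> 5 * s\<^sup>2 + 16 * s\<^sup>2 * P\<close> for the
    proportion \<open>P\<close> of signs with \<open>s \<le> 4 * z\<close>; this is the origin of
    3/16.\<close>
  have "(\<Sum>B\<in>Pow {..<m}. 8 * s * (sign_sum m a B)\<^sup>2)
     \<le> (\<Sum>B\<in>Pow {..<m}. 2 * s\<^sup>2 + (sign_sum m a B) ^ 4 + 16 * s\<^sup>2 * of_bool (s \<le> 4 * (sign_sum m a B)\<^sup>2))"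
    using pt[of "(sign_sum m a B)\<^sup>2" for B] by (intro sum_mono) simp
  also have "\<dots> = 2 ^ m * (2 * s\<^sup>2) + (\<Sum>B\<in>Pow {..<m}. (sign_sum m a B) ^ 4)
      + 16 * s\<^sup>2 * (\<Sum>B\<in>Pow {..<m}. of_bool (s \<le> 4 * (sign_sum m a B)\<^sup>2))"
    by (simp add: sum.distrib sum_distrib_left card_Pow)
  also have "(\<Sum>B\<in>Pow {..<m}. 8 * s * (sign_sum m a B)\<^sup>2) = 8 * s * (2 ^ m * s)"
    by (simp add: sum_distrib_left[symmetric] s_def sign_sum_second_moment_real)
  finally have "8 * s * (2 ^ m * s) \<le> 2 ^ m * (2 * s\<^sup>2) + 2 ^ m * (3 * s\<^sup>2)
      + 16 * s\<^sup>2 * (\<Sum>B\<in>Pow {..<m}. of_bool (s \<le> 4 * (sign_sum m a B)\<^sup>2))"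
    using sign_sum_fourth_moment[where m=m and a=a] by (simp add: s_def)
  then have "s\<^sup>2 * (3 * 2 ^ m) \<le> s\<^sup>2 * (16 * (\<Sum>B\<in>Pow {..<m}. of_bool (s \<le> 4 * (sign_sum m a B)\<^sup>2)))"
    by (simp add: power2_eq_square algebra_simps)
  then have "3 * 2 ^ m \<le> 16 * (\<Sum>B\<in>Pow {..<m}. of_bool (s \<le> 4 * (sign_sum m a B)\<^sup>2) :: real)"
    using sp by simp
  then show ?thesis by (simp add: s_def)
qed

lemma linear_sign_sum:
  assumes "linear f"
  shows "f (sign_sum m x B) = sign_sum m (\<lambda>j. f (x j)) B"
  unfolding sign_sum_def by (simp add: linear_sum[OF assms] linear_cmul[OF assms])

text \<open>Randomizing the signs turns the bound on single values of a random linear functional into a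
  bound on its Euclidean norm on the family \<open>x\<close> that does not depend on \<open>m\<close>.\<close>

lemma (in prob_space) random_functional_tail:
  fixes X :: "'a \<Rightarrow> 'v::real_vector \<Rightarrow> real"
  assumes lin: "\<And>\<omega>. \<omega> \<in> space M \<Longrightarrow> linear (X \<omega>)"
    and meas: "\<And>\<phi>. (\<lambda>\<omega>. X \<omega> \<phi>) \<in> borel_measurable M"
    and p: "hilbertian p"
    and small: "\<And>\<phi>. p \<phi> < r \<Longrightarrow> prob {\<omega> \<in> space M. 1 \<le> \<bar>X \<omega> \<phi>\<bar>} \<le> \<epsilon>"
    and pos: "0 < r" "0 < C" "0 \<le> \<epsilon>"
    and K: "(\<Sum>j<(m::nat). (p (x j))\<^sup>2) \<le> K"
  shows "prob {\<omega> \<in> space M. C \<le> L2_set (\<lambda>j. X \<omega> (x j)) {..<m}} \<le> 16 / 3 * (\<epsilon> + 4 * K / (r\<^sup>2 * C\<^sup>2))"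
proof -
  let ?W = "Pow {..<m}"
  define s where "s \<omega> = (\<Sum>j<m. (X \<omega> (x j))\<^sup>2)" for \<omega>
  define A where "A = {\<omega> \<in> space M. C \<le> L2_set (\<lambda>j. X \<omega> (x j)) {..<m}}"
  define E where "E B = {\<omega> \<in> space M. C / 2 \<le> \<bar>X \<omega> (sign_sum m x B)\<bar>}" for B
  note [measurable] = meas
  have [measurable]: "A \<in> events" "\<And>B. E B \<in> events"
    unfolding A_def E_def L2_set_def by measurable
  have [simp]: "integrable M (indicat_real S)" if "S \<in> events" for S
    using that by (intro integrable_const_bound[where B = 1]) (auto simp: indicator_def)
  \<comment> \<open>In the manner of Chebyshev's inequality: either the sign sum, rescaled by
    \<open>2 / C\<close>, falls into the region where \<open>small\<close> applies, or the added
    quadratic term is at least 1 and the bound is trivial.\<close>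
  have E_le: "prob (E B) \<le> \<epsilon> + 4 / (r\<^sup>2 * C\<^sup>2) * (p (sign_sum m x B))\<^sup>2" for B
  proof (cases "p (sign_sum m x B) < r * C / 2")
    case True
    let ?\<phi> = "(2 / C) *\<^sub>R sign_sum m x B"
    have "p ?\<phi> = 2 / C * p (sign_sum m x B)"
      using pos by (simp add: is_seminormD(2)[OF hilbertian_seminorm[OF p]])
    moreover have "2 / C * p (sign_sum m x B) < r" using True pos by (simp add: field_simps)
    ultimately have "p ?\<phi> < r" by simp
    moreover have "E B = {\<omega> \<in> space M. 1 \<le> \<bar>X \<omega> ?\<phi>\<bar>}"
      unfolding E_def using pos by (auto simp: linear_cmul[OF lin] abs_mult field_simps)
    moreover have "0 \<le> 4 / (r\<^sup>2 * C\<^sup>2) * (p (sign_sum m x B))\<^sup>2" by simp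
    ultimately show ?thesis using small[of ?\<phi>] by (metis add_increasing2)
  next
    case False
    then have "(r * C / 2)\<^sup>2 \<le> (p (sign_sum m x B))\<^sup>2" using pos by (intro power_mono) auto
    then have "1 \<le> 4 / (r\<^sup>2 * C\<^sup>2) * (p (sign_sum m x B))\<^sup>2"
      using pos by (simp add: field_simps power2_eq_square)
    then show ?thesis using prob_le_1[of "E B"] pos(3) by linarith
  qed
  \<comment> \<open>On \<open>A\<close>, anticoncentration for the numbers
    \<open>X \<omega> (x j)\<close> puts \<omega> into \<open>E B\<close> for at least 3/16 of the
    signs; the factor 1/2 in \<open>E B\<close> comes from the 4 in that lemma. Integration
    exchanges the average over signs with the expectation.\<close>
  have "3 / 16 * 2 ^ m * prob A = (\<integral>\<omega>. 3 / 16 * 2 ^ m * indicator A \<omega> \<partial>M)"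
    by simp
  also have "\<dots> \<le> (\<integral>\<omega>. (\<Sum>B\<in>?W. indicator (E B) \<omega>) \<partial>M)"
  proof (rule integral_mono)
    fix \<omega> assume \<omega>: "\<omega> \<in> space M"
    show "3 / 16 * 2 ^ m * indicator A \<omega> \<le> (\<Sum>B\<in>?W. indicator (E B) \<omega> :: real)"
    proof (cases "\<omega> \<in> A")
      case True
      have "C\<^sup>2 \<le> (sqrt (s \<omega>))\<^sup>2"
        using True pos by (intro power_mono) (auto simp: A_def L2_set_def s_def)
      then have s: "C\<^sup>2 \<le> s \<omega>" by (simp add: s_def sum_nonneg)
      then have "3 / 16 * 2 ^ m \<le> (\<Sum>B\<in>?W. of_bool (s \<omega> \<le> 4 * (sign_sum m (\<lambda>j. X \<omega> (x j)) B)\<^sup>2) :: real)"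
        unfolding s_def using pos by (intro sign_sum_anticoncentration) (smt (verit) zero_less_power)
      also have "\<dots> \<le> (\<Sum>B\<in>?W. indicator (E B) \<omega>)"
      proof (rule sum_mono)
        fix B
        have "C / 2 \<le> \<bar>X \<omega> (sign_sum m x B)\<bar>" if "s \<omega> \<le> 4 * (sign_sum m (\<lambda>j. X \<omega> (x j)) B)\<^sup>2"
        proof -
          have "C\<^sup>2 \<le> (2 * \<bar>X \<omega> (sign_sum m x B)\<bar>)\<^sup>2"
            using s that by (simp add: linear_sign_sum[OF lin[OF \<omega>]] power_mult_distrib)
          then have "C \<le> 2 * \<bar>X \<omega> (sign_sum m x B)\<bar>" by (rule power2_le_imp_le) simp
          then show ?thesis by simp
        qed
        then show "of_bool (s \<omega> \<le> 4 * (sign_sum m (\<lambda>j. X \<omega> (x j)) B)\<^sup>2) \<le> (indicator (E B) \<omega> :: real)"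
          using \<omega> by (auto simp: E_def indicator_def)
      qed
      finally show ?thesis using True by simp
    qed (simp add: sum_nonneg)
  qed (auto intro!: Bochner_Integration.integrable_sum integrable_mult_right)
  also have "\<dots> = (\<Sum>B\<in>?W. prob (E B))"
    by (subst Bochner_Integration.integral_sum) auto
  also have "\<dots> \<le> (\<Sum>B\<in>?W. \<epsilon> + 4 / (r\<^sup>2 * C\<^sup>2) * (p (sign_sum m x B))\<^sup>2)"
    by (intro sum_mono E_le)
  also have "\<dots> = 2 ^ m * (\<epsilon> + 4 / (r\<^sup>2 * C\<^sup>2) * (\<Sum>j<m. (p (x j))\<^sup>2))"
    unfolding sum.distrib sum_distrib_left[symmetric] sign_sum_second_moment[OF p]
    by (simp add: card_Pow algebra_simps)
  also have "\<dots> \<le> 2 ^ m * (\<epsilon> + 4 / (r\<^sup>2 * C\<^sup>2) * K)"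
    using K by (intro mult_left_mono add_left_mono) auto
  finally have "2 ^ m * (3 / 16 * prob A) \<le> 2 ^ m * (\<epsilon> + 4 / (r\<^sup>2 * C\<^sup>2) * K)"
    by (simp add: algebra_simps)
  then have "3 / 16 * prob A \<le> \<epsilon> + 4 / (r\<^sup>2 * C\<^sup>2) * K" by (simp only: mult_le_cancel_left) auto
  then show ?thesis unfolding A_def[symmetric] by (simp add: field_simps)
qed

section \<open>Hilbertian semi-norms and Hilbert--Schmidt bounds\<close>

lemma hilbertian_form_linear:
  assumes "hilbertian p"
  shows "linear (hilbertian_form p x)" "linear (\<lambda>x. hilbertian_form p x y)"
  using hilbertian_formD(1)[OF assms] by (auto simp: bilinear_def)

text \<open>Since \<open>p\<close> may vanish at nonzero vectors, minimizing the quadratic in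
  \<open>t\<close> fails when \<open>p x = 0\<close>. In this case the quadratic is affine in
  \<open>t\<close> and bounded below, which forces the form to vanish.\<close>

lemma hilbertian_form_Cauchy_Schwarz:
  assumes p: "hilbertian p"
  shows "\<bar>hilbertian_form p x y\<bar> \<le> p x * p y"
proof -
  note s = is_seminormD[OF hilbertian_seminorm[OF p]]
  note Q = hilbertian_formD[OF p]
  have quad: "0 \<le> (p x)\<^sup>2 * t\<^sup>2 - 2 * t * hilbertian_form p x y + (p y)\<^sup>2" for t
  proof -
    have "0 \<le> hilbertian_form p (t *\<^sub>R x - y) (t *\<^sub>R x - y)" by (simp add: Q(3))
    also have "\<dots> = (p x)\<^sup>2 * t\<^sup>2 - 2 * t * hilbertian_form p x y + (p y)\<^sup>2"
      unfolding bilinear_lsub[OF Q(1)] bilinear_rsub[OF Q(1)] bilinear_lmul[OF Q(1)] bilinear_rmul[OF Q(1)]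
      by (simp add: Q(3) Q(2)[of y x] power2_eq_square algebra_simps)
    finally show ?thesis .
  qed
  have "(hilbertian_form p x y)\<^sup>2 \<le> (p x * p y)\<^sup>2"
  proof (cases "p x = 0")
    case True
    have "hilbertian_form p x y = 0"
    proof (rule ccontr)
      assume ne: "hilbertian_form p x y \<noteq> 0"
      \<comment> \<open>With this \<open>t\<close> the quadratic takes the value -1.\<close>
      define t where "t = ((p y)\<^sup>2 + 1) / (2 * hilbertian_form p x y)"
      have "2 * t * hilbertian_form p x y = (p y)\<^sup>2 + 1" using ne by (simp add: t_def)
      then show False using quad[of t] True by simp
    qed
    then show ?thesis by simp
  next
    case False
    then have px: "(p x)\<^sup>2 > 0" by simp
    have "0 \<le> (p x)\<^sup>2 * ((p x)\<^sup>2 * (hilbertian_form p x y / (p x)\<^sup>2)\<^sup>2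
        - 2 * (hilbertian_form p x y / (p x)\<^sup>2) * hilbertian_form p x y + (p y)\<^sup>2)"
      by (intro mult_nonneg_nonneg quad) simp
    also have "\<dots> = (p x * p y)\<^sup>2 - (hilbertian_form p x y)\<^sup>2"
      using False by (simp add: field_simps power2_eq_square)
    finally show ?thesis by simp
  qed
  then have "\<bar>hilbertian_form p x y\<bar>\<^sup>2 \<le> (p x * p y)\<^sup>2" by simp
  then show ?thesis by (rule power2_le_imp_le) (simp add: s)
qed

lemma hilbertian_form_combination:
  assumes "hilbertian p"
  shows "hilbertian_form p v (\<Sum>j\<in>J. a j *\<^sub>R x j) = (\<Sum>j\<in>J. a j * hilbertian_form p v (x j))"
    and "hilbertian_form p (\<Sum>j\<in>J. a j *\<^sub>R x j) v = (\<Sum>j\<in>J. a j * hilbertian_form p (x j) v)"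
  by (simp_all add: linear_sum[OF hilbertian_form_linear(1)[OF assms]] linear_cmul[OF hilbertian_form_linear(1)[OF assms]]
      linear_sum[OF hilbertian_form_linear(2)[OF assms]] linear_cmul[OF hilbertian_form_linear(2)[OF assms]])

text \<open>The linear map that takes the unit vectors of Euclidean m-space to the
  \<open>x j\<close> has norm at most 1 with respect to \<open>q\<close>.\<close>

definition contractive :: "('a::real_vector \<Rightarrow> real) \<Rightarrow> nat \<Rightarrow> (nat \<Rightarrow> 'a) \<Rightarrow> bool" where
  "contractive q m x \<longleftrightarrow> (\<forall>a. (q (\<Sum>j<m. a j *\<^sub>R x j))\<^sup>2 \<le> (\<Sum>j<m. (a j)\<^sup>2))"

lemma contractive_mono:
  assumes "contractive q m x" "\<And>v. p v \<le> q v" "\<And>v. 0 \<le> p v"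
  shows "contractive p m x"
  using assms unfolding contractive_def by (meson order_trans power_mono)

text \<open>The square of the Hilbert--Schmidt norm of \<open>i\<^bsub>p,q\<^esub>\<close> is the least such \<open>K\<close>.  Testing against
  contractive instead of orthonormal families makes the notion monotone in \<open>q\<close>.\<close>

definition hs_bounded :: "('a::real_vector \<Rightarrow> real) \<Rightarrow> ('a \<Rightarrow> real) \<Rightarrow> bool" where
  "hs_bounded q p \<longleftrightarrow> (\<exists>K. \<forall>m x. contractive q m x \<longrightarrow> (\<Sum>j<m. (p (x j))\<^sup>2) \<le> K)"

definition semi_orthonormal :: "('a::real_vector \<Rightarrow> real) \<Rightarrow> nat \<Rightarrow> (nat \<Rightarrow> 'a) \<Rightarrow> bool" where
  "semi_orthonormal q m x \<longleftrightarrow>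
     (\<forall>i<m. \<forall>j<m. i \<noteq> j \<longrightarrow> hilbertian_form q (x i) (x j) = 0) \<and> (\<forall>i<m. q (x i) \<in> {0, 1})"

lemma semi_orthonormal_form:
  assumes "hilbertian q" "semi_orthonormal q m x" "i < m"
  shows "hilbertian_form q (\<Sum>j<m. a j *\<^sub>R x j) (x i) = a i * q (x i)"
proof -
  have "hilbertian_form q (\<Sum>j<m. a j *\<^sub>R x j) (x i) = (\<Sum>j<m. a j * hilbertian_form q (x j) (x i))"
    by (rule hilbertian_form_combination(2)[OF assms(1)])
  also have "\<dots> = (\<Sum>j<m. if j = i then a i * q (x i) else 0)"
    using assms by (intro sum.cong) (auto simp: semi_orthonormal_def hilbertian_formD(3)[OF assms(1)])
  finally show ?thesis using assms(3) by simp
qed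

lemma semi_orthonormal_norm:
  assumes "hilbertian q" "semi_orthonormal q m x"
  shows "(q (\<Sum>j<m. a j *\<^sub>R x j))\<^sup>2 = (\<Sum>j<m. (a j)\<^sup>2 * q (x j))"
proof -
  have "(q (\<Sum>j<m. a j *\<^sub>R x j))\<^sup>2 = hilbertian_form q (\<Sum>j<m. a j *\<^sub>R x j) (\<Sum>j<m. a j *\<^sub>R x j)"
    by (simp add: hilbertian_formD(3)[OF assms(1)])
  also have "\<dots> = (\<Sum>j<m. a j * (a j * q (x j)))"
    unfolding hilbertian_form_combination(1)[OF assms(1)]
    using semi_orthonormal_form[OF assms] by (intro sum.cong) auto
  finally show ?thesis by (simp add: power2_eq_square mult.assoc)
qed

lemma semi_orthonormal_contractive:
  assumes "hilbertian q" "semi_orthonormal q m x"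
  shows "contractive q m x"
proof -
  have "(a j)\<^sup>2 * q (x j) \<le> (a j)\<^sup>2" if "j < m" for a j
    using assms(2) that by (auto simp: semi_orthonormal_def)
  then show ?thesis
    unfolding contractive_def semi_orthonormal_norm[OF assms] by (auto intro: sum_mono)
qed

text \<open>If \<open>q (x j) = 0\<close>, Cauchy--Schwarz makes the coefficient vanish; null
  members therefore do not disturb projections.\<close>

lemma semi_orthonormal_coefficient:
  assumes "hilbertian q" "semi_orthonormal q m x" "j < m"
  shows "hilbertian_form q v (x j) * q (x j) = hilbertian_form q v (x j)"
  using assms hilbertian_form_Cauchy_Schwarz[OF assms(1), of v "x j"]
  by (auto simp: semi_orthonormal_def)

text \<open>Projection onto the span, with Pythagoras' theorem. Dropping the residual leaves
  Bessel's inequality.\<close>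

lemma semi_orthonormal_residual:
  fixes v :: "'a::real_vector"
  assumes q: "hilbertian q" and x: "semi_orthonormal q m x"
  defines "c \<equiv> \<lambda>j. hilbertian_form q v (x j)"
  defines "u \<equiv> v - (\<Sum>j<m. c j *\<^sub>R x j)"
  shows "i < m \<Longrightarrow> hilbertian_form q u (x i) = 0" and "(q v)\<^sup>2 = (q u)\<^sup>2 + (\<Sum>j<m. (c j)\<^sup>2)"
proof -
  let ?w = "\<Sum>j<m. c j *\<^sub>R x j"
  have c: "c j * q (x j) = c j" if "j < m" for j
    unfolding c_def by (rule semi_orthonormal_coefficient[OF q x that])
  show orth: "hilbertian_form q u (x i) = 0" if "i < m" for i
    unfolding u_def using semi_orthonormal_form[OF q x that, of c] c[OF that]
    by (simp add: linear_diff[OF hilbertian_form_linear(2)[OF q]] c_def)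
  have "hilbertian_form q u ?w = 0"
    using orth by (simp add: hilbertian_form_combination(1)[OF q])
  moreover have "v = u + ?w" by (simp add: u_def)
  ultimately have "(q v)\<^sup>2 = (q u)\<^sup>2 + (q ?w)\<^sup>2"
    using hilbertian_formD(1)[OF q] hilbertian_formD(2)[OF q, of ?w u]
    by (simp add: hilbertian_formD(3)[OF q, symmetric] bilinear_ladd bilinear_radd)
  also have "(q ?w)\<^sup>2 = (\<Sum>j<m. (c j)\<^sup>2)"
    unfolding semi_orthonormal_norm[OF q x] using c by (intro sum.cong) (simp_all add: power2_eq_square)
  finally show "(q v)\<^sup>2 = (q u)\<^sup>2 + (\<Sum>j<m. (c j)\<^sup>2)" .
qed

lemma semi_orthonormal_snoc:
  assumes q: "hilbertian q" and x: "semi_orthonormal q m x"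
    and u: "\<And>i. i < m \<Longrightarrow> hilbertian_form q u (x i) = 0" "q u \<in> {0, 1}"
  shows "semi_orthonormal q (Suc m) (x(m := u))"
  using x u hilbertian_formD(2)[OF q] unfolding semi_orthonormal_def by (auto simp: less_Suc_eq)

text \<open>Vectors of \<open>q\<close>-norm \<open>0\<close> enter the family with an arbitrarily large multiple, so that their
  coefficient is at most \<open>\<eta>\<close>.\<close>

lemma approximate_Gram_Schmidt:
  assumes q: "hilbertian q" and "finite F" and \<eta>: "\<eta> > 0"
  shows "\<exists>m x. semi_orthonormal q m x \<and>
    (\<forall>v\<in>F. \<exists>a. v = (\<Sum>j<m. a j *\<^sub>R x j) \<and> L2_set a {..<m} \<le> q v + \<eta>)"
  using \<open>finite F\<close>
proof (induction F rule: finite_induct)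
  case empty
  then show ?case by (auto simp: semi_orthonormal_def intro: exI[of _ 0])
next
  case (insert v F)
  note s = is_seminormD[OF hilbertian_seminorm[OF q]]
  obtain m x where x: "semi_orthonormal q m x"
    and F: "\<And>v. v \<in> F \<Longrightarrow> \<exists>a. v = (\<Sum>j<m. a j *\<^sub>R x j) \<and> L2_set a {..<m} \<le> q v + \<eta>"
    using insert.IH by blast
  define c where "c j = hilbertian_form q v (x j)" for j
  define u where "u = v - (\<Sum>j<m. c j *\<^sub>R x j)"
  define r where "r = (if q u = 0 then \<eta> else q u)"
  have r: "r > 0" using \<eta> s(1)[of u] by (auto simp: r_def)
  let ?x = "x(m := (1 / r) *\<^sub>R u)"
  have "semi_orthonormal q (Suc m) ?x"
  proof (rule semi_orthonormal_snoc[OF q x])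
    show "hilbertian_form q ((1 / r) *\<^sub>R u) (x i) = 0" if "i < m" for i
      using semi_orthonormal_residual(1)[OF q x that, of v]
      unfolding u_def c_def by (simp add: linear_cmul[OF hilbertian_form_linear(2)[OF q]])
    show "q ((1 / r) *\<^sub>R u) \<in> {0, 1}" using r by (auto simp: s(2) r_def)
  qed
  moreover have "\<exists>a. w = (\<Sum>j<Suc m. a j *\<^sub>R ?x j) \<and> L2_set a {..<Suc m} \<le> q w + \<eta>" if "w \<in> F" for w
  proof -
    obtain a where a: "w = (\<Sum>j<m. a j *\<^sub>R x j)" "L2_set a {..<m} \<le> q w + \<eta>" using F[OF \<open>w \<in> F\<close>] by blast
    show ?thesis
      using a by (intro exI[of _ "a(m := 0)"]) (simp add: L2_set_def)
  qed
  moreover have "\<exists>a. v = (\<Sum>j<Suc m. a j *\<^sub>R ?x j) \<and> L2_set a {..<Suc m} \<le> q v + \<eta>"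
  proof (intro exI conjI)
    show "v = (\<Sum>j<Suc m. (c(m := r)) j *\<^sub>R ?x j)" using r by (simp add: u_def)
    have "(\<Sum>j<m. (c j)\<^sup>2) + r\<^sup>2 \<le> (q v)\<^sup>2 + \<eta>\<^sup>2"
      using semi_orthonormal_residual(2)[OF q x, of v] by (auto simp: r_def u_def c_def)
    also have "\<dots> \<le> (q v + \<eta>)\<^sup>2" using s(1)[of v] \<eta> by (simp add: power2_eq_square algebra_simps)
    finally have "L2_set (c(m := r)) {..<Suc m} \<le> sqrt ((q v + \<eta>)\<^sup>2)"
      unfolding L2_set_def by (intro real_sqrt_le_mono) simp
    then show "L2_set (c(m := r)) {..<Suc m} \<le> q v + \<eta>" using s(1)[of v] \<eta> by simp
  qed
  ultimately show ?case by (intro exI[of _ "Suc m"] exI[of _ ?x] conjI) (assumption, blast)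
qed

text \<open>The family is chosen so that its sum of squares of \<open>q\<close> is within
  \<open>\<epsilon>\<^sup>2\<close> of the supremum over all families that are semi-orthonormal for
  \<open>r\<close>. A residual \<open>u\<close> with \<open>q u > \<epsilon> * r u\<close> could be
  normalized and appended, which would exceed the supremum. The coefficients are values of the form
  of \<open>r\<close>, hence bounded by \<open>r v\<close>.\<close>

lemma hs_bounded_totally_bounded:
  assumes r: "hilbertian r" and q: "hilbertian q" and le: "\<And>v. q v \<le> r v"
    and hs: "hs_bounded r q" and \<epsilon>: "\<epsilon> > 0"
  shows "\<exists>m x. \<forall>v. \<exists>a. (\<forall>j<m. \<bar>a j\<bar> \<le> r v) \<and> q (v - (\<Sum>j<(m::nat). a j *\<^sub>R x j)) \<le> \<epsilon> * r v"
proof -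
  note sr = is_seminormD[OF hilbertian_seminorm[OF r]] and sq = is_seminormD[OF hilbertian_seminorm[OF q]]
  obtain K where K: "\<And>m x. contractive r m x \<Longrightarrow> (\<Sum>j<m. (q (x j))\<^sup>2) \<le> K"
    using hs by (auto simp: hs_bounded_def)
  define S where "S = {\<Sum>j<m. (q (x j))\<^sup>2 | m x. semi_orthonormal r m x}"
  have bdd: "bdd_above S"
    unfolding S_def using K semi_orthonormal_contractive[OF r] by (intro bdd_aboveI[of _ K]) auto
  have "semi_orthonormal r 0 (\<lambda>_. 0)" by (simp add: semi_orthonormal_def)
  then have "S \<noteq> {}" unfolding S_def by blast
  then obtain m x where x: "semi_orthonormal r m x" and mx: "Sup S - \<epsilon>\<^sup>2 < (\<Sum>j<m. (q (x j))\<^sup>2)"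
    using less_cSupD[of S "Sup S - \<epsilon>\<^sup>2"] \<epsilon> by (auto simp: S_def)
  have "(\<forall>j<m. \<bar>hilbertian_form r v (x j)\<bar> \<le> r v) \<and>
      q (v - (\<Sum>j<m. hilbertian_form r v (x j) *\<^sub>R x j)) \<le> \<epsilon> * r v" for v
  proof
    have "\<bar>hilbertian_form r v (x j)\<bar> \<le> r v" if "j < m" for j
    proof -
      have "\<bar>hilbertian_form r v (x j)\<bar> \<le> r v * r (x j)" by (rule hilbertian_form_Cauchy_Schwarz[OF r])
      also have "\<dots> \<le> r v * 1" using x that sr(1)[of v] by (intro mult_left_mono) (auto simp: semi_orthonormal_def)
      finally show ?thesis by simp
    qed
    then show "\<forall>j<m. \<bar>hilbertian_form r v (x j)\<bar> \<le> r v" by blast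
    define u where "u = v - (\<Sum>j<m. hilbertian_form r v (x j) *\<^sub>R x j)"
    note res = semi_orthonormal_residual(1)[OF r x, where v = v, folded u_def]
      semi_orthonormal_residual(2)[OF r x, where v = v, folded u_def]
    have "(r u)\<^sup>2 \<le> (r v)\<^sup>2" using res(2) by (simp add: sum_nonneg)
    then have ruv: "r u \<le> r v" by (rule power2_le_imp_le) (rule sr(1))
    have "q u \<le> \<epsilon> * r u"
    proof (cases "r u = 0")
      case True
      then show ?thesis using le[of u] by simp
    next
      case False
      then have ru: "r u > 0" using sr(1)[of u] by simp
      have "semi_orthonormal r (Suc m) (x(m := (1 / r u) *\<^sub>R u))"
        using ru res(1) by (intro semi_orthonormal_snoc[OF r x])
          (auto simp: sr(2) linear_cmul[OF hilbertian_form_linear(2)[OF r]])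
      then have "(\<Sum>j<Suc m. (q ((x(m := (1 / r u) *\<^sub>R u)) j))\<^sup>2) \<in> S" unfolding S_def by blast
      then have "(\<Sum>j<Suc m. (q ((x(m := (1 / r u) *\<^sub>R u)) j))\<^sup>2) \<le> Sup S" by (rule cSup_upper[OF _ bdd])
      then have "(q u / r u)\<^sup>2 \<le> \<epsilon>\<^sup>2" using mx ru by (simp add: sq(2))
      then have "q u / r u \<le> \<epsilon>" by (rule power2_le_imp_le) (use \<epsilon> in simp)
      then show ?thesis using ru by (simp add: field_simps)
    qed
    also have "\<dots> \<le> \<epsilon> * r v" using \<epsilon> ruv by simp
    finally show "q u \<le> \<epsilon> * r v" .
  qed
  then have "\<exists>a. (\<forall>j<m. \<bar>a j\<bar> \<le> r v) \<and> q (v - (\<Sum>j<m. a j *\<^sub>R x j)) \<le> \<epsilon> * r v" for v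
    by (intro exI[of _ "\<lambda>j. hilbertian_form r v (x j)"])
  then show ?thesis by blast
qed

section \<open>Topologies generated by semi-norms\<close>

lemma topspace_seminorm_topology [simp]: "topspace (seminorm_topology P) = UNIV"
  by (auto simp: seminorm_topology_def topology_generated_by_topspace)

lemma openin_seminorm_ball:
  "p \<in> P \<Longrightarrow> r > 0 \<Longrightarrow> openin (seminorm_topology P) {y. p (y - x) < r}"
  unfolding seminorm_topology_def by (rule topology_generated_by_Basis) blast

text \<open>Generating balls may have any centre; the triangle inequality recentres them at
  \<open>x\<close>, and finite intersections take the minimum of the radii.\<close>

lemma openin_seminorm_topologyD:
  assumes P: "\<And>p. p \<in> P \<Longrightarrow> is_seminorm p" and "openin (seminorm_topology P) U" "x \<in> U"
  shows "\<exists>F r. finite F \<and> F \<subseteq> P \<and> r > 0 \<and> (\<forall>y. (\<forall>p\<in>F. p (y - x) < r) \<longrightarrow> y \<in> U)"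
proof -
  have "generate_topology_on (insert UNIV {{y. p (y - x) < r} | p x r. p \<in> P \<and> r > 0}) U"
    using assms(2) unfolding seminorm_topology_def openin_topology_generated_by_iff .
  then show ?thesis using assms(3)
  proof (induction rule: generate_topology_on.induct)
    case (Int a b)
    obtain F r where 1: "finite F" "F \<subseteq> P" "r > 0" "\<And>y. (\<forall>p\<in>F. p (y - x) < r) \<Longrightarrow> y \<in> a"
      using Int by blast
    obtain G s where 2: "finite G" "G \<subseteq> P" "s > 0" "\<And>y. (\<forall>p\<in>G. p (y - x) < s) \<Longrightarrow> y \<in> b"
      using Int by blast
    show ?case
      using 1 2 by (intro exI[of _ "F \<union> G"] exI[of _ "min r s"]) auto
  next
    case (UN K)
    then obtain k where k: "k \<in> K" "x \<in> k" by blast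
    obtain F r where "finite F" "F \<subseteq> P" "r > 0" "\<And>y. (\<forall>p\<in>F. p (y - x) < r) \<Longrightarrow> y \<in> k"
      using UN.IH[OF k] by blast
    then show ?case using k(1) by blast
  next
    case (Basis s)
    show ?case
    proof (cases "s = UNIV")
      case True
      then show ?thesis by (intro exI[of _ "{}"] exI[of _ 1]) auto
    next
      case False
      then obtain p z r where p: "s = {y. p (y - z) < r}" "p \<in> P" using Basis by blast
      have "y \<in> s" if "p (y - x) < r - p (x - z)" for y
        using is_seminormD(3)[OF P[OF p(2)], of "y - x" "x - z"] that p(1) by simp
      then show ?thesis
        using p Basis(2) by (intro exI[of _ "{p}"] exI[of _ "r - p (x - z)"]) auto
    qed
  qed auto
qed

lemma continuous_map_seminorm:
  assumes "p \<in> P" "is_seminorm p"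
  shows "continuous_map (seminorm_topology P) euclideanreal p"
proof -
  have "openin (seminorm_topology P) {x. p x \<in> U}" if U: "open U" for U
  proof (subst openin_subopen, intro ballI)
    fix x assume "x \<in> {x. p x \<in> U}"
    then obtain e where e: "e > 0" "\<And>t. \<bar>t - p x\<bar> < e \<Longrightarrow> t \<in> U"
      using U by (auto simp: open_dist dist_real_def)
    have "\<bar>p y - p x\<bar> \<le> p (y - x)" for y
      using is_seminormD(3)[OF assms(2), of "y - x" x] is_seminormD(3)[OF assms(2), of "x - y" y]
        is_seminormD(7)[OF assms(2), of x y] by auto
    then have "{y. p (y - x) < e} \<subseteq> {x. p x \<in> U}" using e(2) by (auto intro: le_less_trans)
    then show "\<exists>T. openin (seminorm_topology P) T \<and> x \<in> T \<and> T \<subseteq> {x. p x \<in> U}"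
      using openin_seminorm_ball[OF assms(1) e(1)] e(1) is_seminormD(4)[OF assms(2)]
      by (intro exI[of _ "{y. p (y - x) < e}"]) auto
  qed
  then show ?thesis by (simp add: continuous_map_def)
qed

lemma openin_seminorm_ball_0:
  assumes "continuous_map T euclideanreal p"
  shows "openin T {x \<in> topspace T. p x < r}"
  using openin_continuous_map_preimage[OF assms, of "{..<r}"] by simp

section \<open>Cauchy sequences for semi-norms and classes of the completion\<close>

definition seminorm_Cauchy :: "('a::real_vector \<Rightarrow> real) \<Rightarrow> (nat \<Rightarrow> 'a) \<Rightarrow> bool" where
  "seminorm_Cauchy p X \<longleftrightarrow> (\<forall>\<epsilon>>0. \<exists>N. \<forall>m\<ge>N. \<forall>n\<ge>N. p (X m - X n) < \<epsilon>)"

lemma cauchy_in_imp_seminorm_Cauchy: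
  assumes "cauchy_in \<theta> X" "continuous_map \<theta> euclideanreal p" "topspace \<theta> = UNIV" "is_seminorm p"
  shows "seminorm_Cauchy p X"
  unfolding seminorm_Cauchy_def
proof (intro allI impI)
  fix \<epsilon> :: real assume "\<epsilon> > 0"
  then show "\<exists>N. \<forall>m\<ge>N. \<forall>n\<ge>N. p (X m - X n) < \<epsilon>"
    using assms(1)[unfolded cauchy_in_def, rule_format, of "{x \<in> topspace \<theta>. p x < \<epsilon>}"]
      openin_seminorm_ball_0[OF assms(2), of \<epsilon>] is_seminormD(4)[OF assms(4)] assms(3) by auto
qed

lemma cauchy_in_seminorm_topology:
  assumes P: "\<And>p. p \<in> P \<Longrightarrow> is_seminorm p"
  shows "cauchy_in (seminorm_topology P) X \<longleftrightarrow> (\<forall>p\<in>P. seminorm_Cauchy p X)"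
proof (intro iffI ballI)
  fix p assume "cauchy_in (seminorm_topology P) X" "p \<in> P"
  then show "seminorm_Cauchy p X"
    by (intro cauchy_in_imp_seminorm_Cauchy[of "seminorm_topology P"] continuous_map_seminorm P) auto
next
  assume *: "\<forall>p\<in>P. seminorm_Cauchy p X"
  show "cauchy_in (seminorm_topology P) X"
    unfolding cauchy_in_def
  proof (intro allI impI)
    fix U assume "openin (seminorm_topology P) U \<and> 0 \<in> U"
    then obtain F r where F: "finite F" "F \<subseteq> P" "r > 0" "\<And>y. (\<forall>p\<in>F. p (y - 0) < r) \<Longrightarrow> y \<in> U"
      using openin_seminorm_topologyD[OF P, of P U 0] by blast
    have "\<forall>p\<in>F. \<exists>N. \<forall>m\<ge>N. \<forall>n\<ge>N. p (X m - X n) < r"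
      using * F(2,3) by (auto simp: seminorm_Cauchy_def)
    then obtain N where N: "\<And>p m n. p \<in> F \<Longrightarrow> m \<ge> N p \<Longrightarrow> n \<ge> N p \<Longrightarrow> p (X m - X n) < r" by metis
    have "X m - X n \<in> U" if "m \<ge> Max (insert 0 (N ` F))" "n \<ge> Max (insert 0 (N ` F))" for m n
    proof -
      have "N p \<le> Max (insert 0 (N ` F))" if "p \<in> F" for p using that F(1) by (intro Max_ge) auto
      then show ?thesis using that by (intro F(4)) (auto intro!: N intro: order_trans)
    qed
    then show "\<exists>N. \<forall>m\<ge>N. \<forall>n\<ge>N. X m - X n \<in> U" by blast
  qed
qed

lemma limitin_0_seminorm:
  assumes "limitin \<theta> Z 0 F" "continuous_map \<theta> euclideanreal p" "is_seminorm p"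
  shows "((\<lambda>n. p (Z n)) \<longlongrightarrow> 0) F"
  using continuous_map_limit[OF assms(2,1)] is_seminormD(4)[OF assms(3)] by (simp add: o_def)

lemma limitin_0_seminorm_topology:
  assumes P: "\<And>p. p \<in> P \<Longrightarrow> is_seminorm p"
  shows "limitin (seminorm_topology P) Z 0 F \<longleftrightarrow> (\<forall>p\<in>P. ((\<lambda>n. p (Z n)) \<longlongrightarrow> 0) F)"
proof (intro iffI ballI)
  fix p assume "limitin (seminorm_topology P) Z 0 F" "p \<in> P"
  then show "((\<lambda>n. p (Z n)) \<longlongrightarrow> 0) F"
    by (intro limitin_0_seminorm[of "seminorm_topology P"] continuous_map_seminorm P) auto
next
  assume *: "\<forall>p\<in>P. ((\<lambda>n. p (Z n)) \<longlongrightarrow> 0) F"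
  show "limitin (seminorm_topology P) Z 0 F"
    unfolding limitin_def
  proof (intro conjI allI impI)
    fix U assume "openin (seminorm_topology P) U \<and> 0 \<in> U"
    then obtain G r where G: "finite G" "G \<subseteq> P" "r > 0" "\<And>y. (\<forall>p\<in>G. p (y - 0) < r) \<Longrightarrow> y \<in> U"
      using openin_seminorm_topologyD[OF P, of P U 0] by blast
    have "\<forall>p\<in>G. eventually (\<lambda>n. p (Z n) < r) F"
      using * G(2,3) by (auto intro: order_tendstoD)
    then have "eventually (\<lambda>n. \<forall>p\<in>G. p (Z n) < r) F" using G(1) by (simp add: eventually_ball_finite)
    then show "eventually (\<lambda>n. Z n \<in> U) F" by eventually_elim (auto intro: G(4))
  qed simp
qed

lemma seminorm_Cauchy_bounded:
  assumes "is_seminorm p" "seminorm_Cauchy p X"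
  shows "\<exists>C>0. \<forall>n. p (X n) \<le> C"
proof -
  note s = is_seminormD[OF assms(1)]
  obtain N where N: "\<And>m n. m \<ge> N \<Longrightarrow> n \<ge> N \<Longrightarrow> p (X m - X n) < 1"
    using assms(2) unfolding seminorm_Cauchy_def by (meson zero_less_one)
  have "p (X n) \<le> 1 + (\<Sum>k\<le>N. p (X k))" for n
  proof (cases "n \<le> N")
    case True
    then show ?thesis using member_le_sum[of n "{..N}" "\<lambda>k. p (X k)"] s(1) by auto
  next
    case False
    have "p (X n) \<le> p (X n - X N) + p (X N)" using s(3)[of "X n - X N" "X N"] by simp
    moreover have "p (X N) \<le> (\<Sum>k\<le>N. p (X k))" using member_le_sum[of N "{..N}" "\<lambda>k. p (X k)"] s(1) by auto
    ultimately show ?thesis using N[of n N] False by simp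
  qed
  moreover have "1 + (\<Sum>k\<le>N. p (X k)) > 0" by (simp add: s(1) sum_nonneg add_pos_nonneg)
  ultimately show ?thesis by blast
qed

lemma seminorm_Cauchy_const: "is_seminorm p \<Longrightarrow> seminorm_Cauchy p (\<lambda>_. x)"
  by (simp add: seminorm_Cauchy_def is_seminormD)

lemma seminorm_Cauchy_add:
  assumes "is_seminorm p" "seminorm_Cauchy p X" "seminorm_Cauchy p Y"
  shows "seminorm_Cauchy p (\<lambda>n. X n + Y n)"
  unfolding seminorm_Cauchy_def
proof (intro allI impI)
  fix \<epsilon> :: real assume "\<epsilon> > 0"
  then obtain N N' where N: "\<And>m n. m \<ge> N \<Longrightarrow> n \<ge> N \<Longrightarrow> p (X m - X n) < \<epsilon> / 2"
    "\<And>m n. m \<ge> N' \<Longrightarrow> n \<ge> N' \<Longrightarrow> p (Y m - Y n) < \<epsilon> / 2"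
    using assms(2,3) unfolding seminorm_Cauchy_def by (meson half_gt_zero)
  have "p (X m + Y m - (X n + Y n)) < \<epsilon>" if "m \<ge> max N N'" "n \<ge> max N N'" for m n
    using is_seminormD(3)[OF assms(1), of "X m - X n" "Y m - Y n"] N(1)[of m n] N(2)[of m n] that
    by (simp add: algebra_simps)
  then show "\<exists>N. \<forall>m\<ge>N. \<forall>n\<ge>N. p (X m + Y m - (X n + Y n)) < \<epsilon>" by blast
qed

lemma seminorm_Cauchy_scale:
  assumes "is_seminorm p" "seminorm_Cauchy p X"
  shows "seminorm_Cauchy p (\<lambda>n. r *\<^sub>R X n)"
  unfolding seminorm_Cauchy_def
proof (intro allI impI)
  fix \<epsilon> :: real assume "\<epsilon> > 0"
  then obtain N where N: "\<And>m n. m \<ge> N \<Longrightarrow> n \<ge> N \<Longrightarrow> p (X m - X n) < \<epsilon> / (\<bar>r\<bar> + 1)"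
    using assms(2) unfolding seminorm_Cauchy_def by (meson abs_ge_zero add_nonneg_pos divide_pos_pos zero_less_one)
  have "p (r *\<^sub>R X m - r *\<^sub>R X n) < \<epsilon>" if "m \<ge> N" "n \<ge> N" for m n
  proof -
    have "p (r *\<^sub>R X m - r *\<^sub>R X n) = \<bar>r\<bar> * p (X m - X n)"
      by (simp add: is_seminormD(2)[OF assms(1)] flip: scaleR_diff_right)
    also have "\<dots> \<le> (\<bar>r\<bar> + 1) * p (X m - X n)"
      using is_seminormD(1)[OF assms(1)] by (intro mult_right_mono) auto
    also have "\<dots> < \<epsilon>" using N[OF that] by (simp add: field_simps)
    finally show ?thesis .
  qed
  then show "\<exists>N. \<forall>m\<ge>N. \<forall>n\<ge>N. p (r *\<^sub>R X m - r *\<^sub>R X n) < \<epsilon>" by blast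
qed

lemma seminorm_Cauchy_sum:
  assumes "is_seminorm p" "\<And>i. i \<in> I \<Longrightarrow> seminorm_Cauchy p (X i)"
  shows "seminorm_Cauchy p (\<lambda>n. \<Sum>i\<in>I. X i n)"
  using assms(2)
  by (induction I rule: infinite_finite_induct)
    (auto intro: seminorm_Cauchy_const[OF assms(1)] seminorm_Cauchy_add[OF assms(1)])

lemma bounded_linear_Cauchy:
  assumes "linear f" "\<And>x. \<bar>f x\<bar> \<le> C * p x" "is_seminorm p" "seminorm_Cauchy p X"
  shows "convergent (\<lambda>n. f (X n) :: real)"
proof -
  have "Cauchy (\<lambda>n. f (X n))"
    unfolding Cauchy_iff real_norm_def
  proof (intro allI impI)
    fix \<epsilon> :: real assume "\<epsilon> > 0"
    then obtain N where N: "\<And>m n. m \<ge> N \<Longrightarrow> n \<ge> N \<Longrightarrow> p (X m - X n) < \<epsilon> / (\<bar>C\<bar> + 1)"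
      using assms(4) unfolding seminorm_Cauchy_def by (meson abs_ge_zero add_nonneg_pos divide_pos_pos zero_less_one)
    have "\<bar>f (X m) - f (X n)\<bar> < \<epsilon>" if "m \<ge> N" "n \<ge> N" for m n
    proof -
      have "\<bar>f (X m) - f (X n)\<bar> \<le> C * p (X m - X n)"
        using assms(2)[of "X m - X n"] by (simp add: linear_diff[OF assms(1)])
      also have "\<dots> \<le> (\<bar>C\<bar> + 1) * p (X m - X n)"
        using is_seminormD(1)[OF assms(3)] by (intro mult_right_mono) auto
      also have "\<dots> < \<epsilon>" using N[OF that] by (simp add: field_simps)
      finally show ?thesis .
    qed
    then show "\<exists>N. \<forall>m\<ge>N. \<forall>n\<ge>N. \<bar>f (X m) - f (X n)\<bar> < \<epsilon>" by blast
  qed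
  then show ?thesis by (rule Cauchy_convergent)
qed

lemma seminorm_Cauchy_convergent:
  assumes "is_seminorm p" "seminorm_Cauchy p X"
  shows "convergent (\<lambda>n. p (X n))"
proof -
  have "\<bar>p x - p y\<bar> \<le> p (x - y)" for x y
    using is_seminormD(3)[OF assms(1), of "y - x" x] is_seminormD(3)[OF assms(1), of "x - y" y]
      is_seminormD(7)[OF assms(1), of x y] by auto
  then have "Cauchy (\<lambda>n. p (X n))"
    using assms(2) unfolding Cauchy_iff seminorm_Cauchy_def real_norm_def by (meson le_less_trans)
  then show ?thesis by (rule Cauchy_convergent)
qed

lemma hilbertian_form_Cauchy:
  assumes p: "hilbertian p" and X: "seminorm_Cauchy p X" and Y: "seminorm_Cauchy p Y"
  shows "convergent (\<lambda>n. hilbertian_form p (X n) (Y n))"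
proof -
  note s = hilbertian_seminorm[OF p]
  have "convergent (\<lambda>n. p (X n + Y n))" "convergent (\<lambda>n. p (X n - Y n))"
    using seminorm_Cauchy_convergent[OF s seminorm_Cauchy_add[OF s X Y]]
      seminorm_Cauchy_convergent[OF s seminorm_Cauchy_add[OF s X seminorm_Cauchy_scale[OF s Y, of "-1"]]]
    by simp_all
  then obtain a b where "(\<lambda>n. p (X n + Y n)) \<longlonglongrightarrow> a" "(\<lambda>n. p (X n - Y n)) \<longlonglongrightarrow> b"
    by (auto simp: convergent_def)
  then have "(\<lambda>n. hilbertian_form p (X n) (Y n)) \<longlonglongrightarrow> (a\<^sup>2 - b\<^sup>2) / 4"
    unfolding hilbertian_form_def by (intro tendsto_intros) auto
  then show ?thesis by (auto simp: convergent_def)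
qed

lemma cauchy_rel_seminorm_topology:
  assumes P: "\<And>p. p \<in> P \<Longrightarrow> is_seminorm p"
  shows "(X, Y) \<in> cauchy_rel (seminorm_topology P) \<longleftrightarrow>
    (\<forall>p\<in>P. seminorm_Cauchy p X \<and> seminorm_Cauchy p Y \<and> (\<lambda>n. p (X n - Y n)) \<longlonglongrightarrow> 0)"
  unfolding cauchy_rel_def
  by (auto simp: cauchy_in_seminorm_topology[OF P] limitin_0_seminorm_topology[OF P])

lemma completion_setE:
  assumes P: "\<And>p. p \<in> P \<Longrightarrow> is_seminorm p" and c: "c \<in> completion_set (seminorm_topology P)"
  shows "representative c \<in> c"
    and "X \<in> c \<Longrightarrow> p \<in> P \<Longrightarrow> seminorm_Cauchy p X"
    and "X \<in> c \<Longrightarrow> Y \<in> c \<Longrightarrow> p \<in> P \<Longrightarrow> (\<lambda>n. p (X n - Y n)) \<longlonglongrightarrow> 0"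
proof -
  let ?\<theta> = "seminorm_topology P"
  obtain Z where Z: "cauchy_in ?\<theta> Z" "c = cauchy_rel ?\<theta> `` {Z}"
    using c unfolding completion_set_def quotient_def by blast
  then have "Z \<in> c"
    by (auto simp: cauchy_rel_seminorm_topology[OF P] cauchy_in_seminorm_topology[OF P] is_seminormD(4)[OF P])
  then show "representative c \<in> c" unfolding representative_def by (rule someI[of "\<lambda>X. X \<in> c"])
  show "X \<in> c \<Longrightarrow> p \<in> P \<Longrightarrow> seminorm_Cauchy p X"
    by (auto simp: Z(2) cauchy_rel_seminorm_topology[OF P])
  show "(\<lambda>n. p (X n - Y n)) \<longlonglongrightarrow> 0" if "X \<in> c" "Y \<in> c" and p: "p \<in> P"
  proof -
    note s = is_seminormD[OF P[OF p]]
    have 1: "(\<lambda>n. p (Z n - X n)) \<longlonglongrightarrow> 0" "(\<lambda>n. p (Z n - Y n)) \<longlonglongrightarrow> 0"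
      using that by (auto simp: Z(2) cauchy_rel_seminorm_topology[OF P])
    have "p (X n - Y n) \<le> p (Z n - X n) + p (Z n - Y n)" for n
      using s(6)[of "Z n - Y n" "Z n - X n"] by simp
    then show ?thesis
      by (intro tendsto_sandwich[OF _ _ tendsto_const tendsto_add[OF 1, simplified]]) (auto simp: s(1))
  qed
qed

lemma completion_class:
  assumes P: "\<And>p. p \<in> P \<Longrightarrow> is_seminorm p" and X: "\<And>p. p \<in> P \<Longrightarrow> seminorm_Cauchy p X"
  shows "cauchy_rel (seminorm_topology P) `` {X} \<in> completion_set (seminorm_topology P)"
    and "X \<in> cauchy_rel (seminorm_topology P) `` {X}"
proof -
  show "cauchy_rel (seminorm_topology P) `` {X} \<in> completion_set (seminorm_topology P)"
    unfolding completion_set_def using X by (intro quotientI) (simp add: cauchy_in_seminorm_topology[OF P])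
  show "X \<in> cauchy_rel (seminorm_topology P) `` {X}"
    using X by (simp add: cauchy_rel_seminorm_topology[OF P] is_seminormD(4)[OF P])
qed

section \<open>Hilbert--Schmidt maps in terms of finite families\<close>

lemma infsum_of_sum:
  fixes f :: "'i \<Rightarrow> 'b \<Rightarrow> real"
  assumes "\<And>i. i \<in> I \<Longrightarrow> f i summable_on B"
  shows "infsum (\<lambda>b. \<Sum>i\<in>I. f i b) B = (\<Sum>i\<in>I. infsum (f i) B) \<and> (\<lambda>b. \<Sum>i\<in>I. f i b) summable_on B"
  using assms by (induction I rule: infinite_finite_induct) (auto simp: infsum_add intro: summable_on_add)

lemma cauchy_rel_singleton:
  assumes "is_seminorm p"
  shows "(X, Y) \<in> cauchy_rel (seminorm_topology {p}) \<longleftrightarrow>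
    seminorm_Cauchy p X \<and> seminorm_Cauchy p Y \<and> (\<lambda>n. p (X n - Y n)) \<longlonglongrightarrow> 0"
  using assms by (subst cauchy_rel_seminorm_topology) auto

text \<open>Basis elements are classes of Cauchy sequences. Their representatives turn
  orthonormality into limits of the form on \<Phi> itself.\<close>

lemma orthonormal_basisD:
  assumes q: "hilbertian q" and B: "orthonormal_basis q B"
  shows "b \<in> B \<Longrightarrow> seminorm_Cauchy q (representative b)"
    and "b \<in> B \<Longrightarrow> b' \<in> B \<Longrightarrow>
      (\<lambda>k. hilbertian_form q (representative b k) (representative b' k)) \<longlonglongrightarrow> (if b = b' then 1 else 0)"
proof -
  note s = hilbertian_seminorm[OF q]
  have C: "seminorm_Cauchy q (representative b)" if "b \<in> B" for b
  proof -
    have "b \<in> completion_set (seminorm_topology {q})"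
      using B that by (auto simp: orthonormal_basis_def hilbert_space_def)
    then show ?thesis using completion_setE(1)[of "{q}" b] completion_setE(2)[of "{q}" b "representative b" q] s by auto
  qed
  then show "b \<in> B \<Longrightarrow> seminorm_Cauchy q (representative b)" .
  assume b: "b \<in> B" "b' \<in> B"
  have "(\<lambda>k. hilbertian_form q (representative b k) (representative b' k)) \<longlonglongrightarrow> hilbert_inner q b b'"
    unfolding hilbert_inner_def using hilbertian_form_Cauchy[OF q C C] b by (simp add: convergent_LIMSEQ_iff)
  then show "(\<lambda>k. hilbertian_form q (representative b k) (representative b' k)) \<longlonglongrightarrow> (if b = b' then 1 else 0)"
    using B b by (auto simp: orthonormal_basis_def)
qed

text \<open>Totality of a basis is stated for elements of the completion. The chosen representative
  of the class of \<open>x\<close> differs from \<open>x\<close> by a null sequence for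
  \<open>q\<close>, and by Cauchy--Schwarz this does not change the limits of inner
  products.\<close>

lemma orthonormal_basis_complete:
  assumes q: "hilbertian q" and B: "orthonormal_basis q B"
    and x: "seminorm_Cauchy q x"
    and orth: "\<And>b. b \<in> B \<Longrightarrow> (\<lambda>n. hilbertian_form q (x n) (representative b n)) \<longlonglongrightarrow> 0"
  shows "(\<lambda>n. q (x n)) \<longlonglongrightarrow> 0"
proof -
  note s = is_seminormD[OF hilbertian_seminorm[OF q]]
  let ?c = "cauchy_rel (seminorm_topology {q}) `` {x}"
  have P: "is_seminorm p" if "p \<in> {q}" for p using that hilbertian_seminorm[OF q] by simp
  have c: "?c \<in> completion_set (seminorm_topology {q})" "x \<in> ?c"
    using x completion_class[of "{q}" x] hilbertian_seminorm[OF q] by auto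
  have rep: "seminorm_Cauchy q (representative ?c)" "(\<lambda>n. q (representative ?c n - x n)) \<longlonglongrightarrow> 0"
    using completion_setE[OF P c(1)] c(2) by auto
  have "hilbert_inner q ?c b = 0" if b: "b \<in> B" for b
  proof -
    note bC = orthonormal_basisD(1)[OF q B b]
    obtain C where C: "\<And>n. q (representative b n) \<le> C"
      using seminorm_Cauchy_bounded[OF hilbertian_seminorm[OF q] bC] by blast
    have "(\<lambda>n. hilbertian_form q (representative ?c n - x n) (representative b n)) \<longlonglongrightarrow> 0"
    proof (rule Lim_null_comparison)
      show "eventually (\<lambda>n. norm (hilbertian_form q (representative ?c n - x n) (representative b n))
          \<le> q (representative ?c n - x n) * C) sequentially"
        using order_trans[OF hilbertian_form_Cauchy_Schwarz[OF q] mult_left_mono[OF C s(1)]]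
        by (simp add: always_eventually)
      show "(\<lambda>n. q (representative ?c n - x n) * C) \<longlonglongrightarrow> 0" using tendsto_mult_right[OF rep(2), of C] by simp
    qed
    from tendsto_add[OF this orth[OF b]]
    have "(\<lambda>n. hilbertian_form q (representative ?c n) (representative b n)) \<longlonglongrightarrow> 0"
      by (simp add: linear_diff[OF hilbertian_form_linear(2)[OF q]])
    then show ?thesis unfolding hilbert_inner_def by (rule limI)
  qed
  then have "hilbert_inner q ?c ?c = 0"
    using B c(1) unfolding orthonormal_basis_def hilbert_space_def by blast
  moreover have "(\<lambda>n. hilbertian_form q (representative ?c n) (representative ?c n)) \<longlonglongrightarrow> hilbert_inner q ?c ?c"
    unfolding hilbert_inner_def using hilbertian_form_Cauchy[OF q rep(1) rep(1)] by (simp add: convergent_LIMSEQ_iff)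
  ultimately have "(\<lambda>n. sqrt ((q (representative ?c n))\<^sup>2)) \<longlonglongrightarrow> sqrt 0"
    by (intro tendsto_real_sqrt) (simp add: hilbertian_formD(3)[OF q])
  then have "(\<lambda>n. q (representative ?c n)) \<longlonglongrightarrow> 0" by (simp add: s(1))
  from tendsto_add[OF rep(2) this] have lim: "(\<lambda>n. q (representative ?c n - x n) + q (representative ?c n)) \<longlonglongrightarrow> 0"
    by simp
  have "q (x n) \<le> q (representative ?c n - x n) + q (representative ?c n)" for n
    using s(6)[of "representative ?c n" "representative ?c n - x n"] by simp
  then show ?thesis by (intro tendsto_sandwich[OF _ _ tendsto_const lim]) (auto simp: s(1))
qed

text \<open>The expansion of \<open>v\<close> in the basis \<open>B\<close> of \<open>\<Phi>\<^sub>q\<close>: its remainders are approximated by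
  vectors \<open>x n\<close> of \<open>\<Phi>\<close>, which form a Cauchy sequence orthogonal in the limit to \<open>B\<close>.\<close>

lemma orthonormal_basis_expansion:
  assumes q: "hilbertian q" and B: "orthonormal_basis q B" and \<epsilon>: "\<epsilon> > 0"
  obtains F c where "finite F" "F \<subseteq> B" "(\<Sum>b\<in>F. (c b)\<^sup>2) \<le> (q v)\<^sup>2"
    "eventually (\<lambda>k. q (v - (\<Sum>b\<in>F. c b *\<^sub>R representative b k)) < \<epsilon>) sequentially"
proof -
  note sn = hilbertian_seminorm[OF q]
  note s = is_seminormD[OF sn]
  note form = hilbertian_formD[OF q]
  define \<beta> where "\<beta> b = representative b" for b :: "(nat \<Rightarrow> 'a) set"
  have \<beta>: "seminorm_Cauchy q (\<beta> b)" if "b \<in> B" for b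
    using orthonormal_basisD(1)[OF q B that] by (simp add: \<beta>_def)
  have on: "(\<lambda>k. hilbertian_form q (\<beta> b k) (\<beta> b' k)) \<longlonglongrightarrow> (if b = b' then 1 else 0)" if "b \<in> B" "b' \<in> B" for b b'
    using orthonormal_basisD(2)[OF q B that] by (simp add: \<beta>_def)
  define c where "c b = lim (\<lambda>k. hilbertian_form q v (\<beta> b k))" for b
  have c: "(\<lambda>k. hilbertian_form q v (\<beta> b k)) \<longlonglongrightarrow> c b" if "b \<in> B" for b
    unfolding c_def using hilbertian_form_Cauchy[OF q seminorm_Cauchy_const[OF sn] \<beta>[OF that]]
    by (simp add: convergent_LIMSEQ_iff)
  have combo: "(\<lambda>k. hilbertian_form q (\<Sum>b\<in>F. a b *\<^sub>R \<beta> b k) (\<beta> b' k)) \<longlonglongrightarrow> (if b' \<in> F then a b' else 0)"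
    if F: "finite F" "F \<subseteq> B" and b': "b' \<in> B" for F a b'
  proof -
    have "(\<lambda>k. \<Sum>b\<in>F. a b * hilbertian_form q (\<beta> b k) (\<beta> b' k)) \<longlonglongrightarrow> (\<Sum>b\<in>F. a b * (if b = b' then 1 else 0))"
      using F b' by (intro tendsto_sum tendsto_mult_left on) auto
    also have "(\<Sum>b\<in>F. a b * (if b = b' then 1 else 0)) = (if b' \<in> F then a b' else 0)"
      using F(1) by (simp add: if_distrib cong: if_cong)
    finally show ?thesis by (simp add: hilbertian_form_combination(2)[OF q])
  qed
  have combo_norm: "(\<lambda>k. (q (\<Sum>b\<in>F. a b *\<^sub>R \<beta> b k))\<^sup>2) \<longlonglongrightarrow> (\<Sum>b\<in>F. (a b)\<^sup>2)"
    if F: "finite F" "F \<subseteq> B" for F a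
  proof -
    have "(\<lambda>k. \<Sum>b\<in>F. a b * hilbertian_form q (\<Sum>b\<in>F. a b *\<^sub>R \<beta> b k) (\<beta> b k)) \<longlonglongrightarrow>
        (\<Sum>b\<in>F. a b * (if b \<in> F then a b else 0))"
      using F by (intro tendsto_sum tendsto_mult_left combo) auto
    moreover have "(q (\<Sum>b\<in>F. a b *\<^sub>R \<beta> b k))\<^sup>2
        = (\<Sum>b\<in>F. a b * hilbertian_form q (\<Sum>b\<in>F. a b *\<^sub>R \<beta> b k) (\<beta> b k))" for k
      unfolding form(3)[symmetric] by (rule hilbertian_form_combination(1)[OF q])
    ultimately show ?thesis by (simp add: power2_eq_square)
  qed
  define u where "u F k = v - (\<Sum>b\<in>F. c b *\<^sub>R \<beta> b k)" for F k
  have u_Cauchy: "seminorm_Cauchy q (u F)" if "F \<subseteq> B" for F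
    unfolding u_def diff_conv_add_uminus sum_negf[symmetric] scaleR_minus_left[symmetric]
    using that \<beta> by (intro seminorm_Cauchy_add seminorm_Cauchy_const seminorm_Cauchy_sum seminorm_Cauchy_scale sn) auto
  have Bessel: "(\<Sum>b\<in>F. (c b)\<^sup>2) \<le> (q v)\<^sup>2" if F: "finite F" "F \<subseteq> B" for F
  proof -
    have eq: "(q (u F k))\<^sup>2 = (q v)\<^sup>2 - 2 * (\<Sum>b\<in>F. c b * hilbertian_form q v (\<beta> b k)) + (q (\<Sum>b\<in>F. c b *\<^sub>R \<beta> b k))\<^sup>2" for k
      unfolding form(3)[symmetric] u_def bilinear_lsub[OF form(1)] bilinear_rsub[OF form(1)]
      by (simp add: form(2)[of "\<Sum>b\<in>F. c b *\<^sub>R \<beta> b k" v] hilbertian_form_combination(1)[OF q, of v])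
    have "(\<lambda>k. (q (u F k))\<^sup>2) \<longlonglongrightarrow> (q v)\<^sup>2 - 2 * (\<Sum>b\<in>F. c b * c b) + (\<Sum>b\<in>F. (c b)\<^sup>2)"
      unfolding eq using F c by (intro tendsto_intros combo_norm) auto
    from LIMSEQ_le_const[OF this, of 0] show ?thesis by (simp add: power2_eq_square)
  qed
  \<comment> \<open>Finite sets whose coefficient sums approach the supremum take the place of a
    summation over a possibly uncountable basis.\<close>
  define S where "S = {\<Sum>b\<in>F. (c b)\<^sup>2 | F. finite F \<and> F \<subseteq> B}"
  have bdd: "bdd_above S" unfolding S_def using Bessel by (intro bdd_aboveI[of _ "(q v)\<^sup>2"]) auto
  have le_Sup: "(\<Sum>b\<in>F. (c b)\<^sup>2) \<le> Sup S" if "finite F" "F \<subseteq> B" for F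
    using that by (intro cSup_upper bdd) (auto simp: S_def)
  have "S \<noteq> {}" unfolding S_def by blast
  have "\<exists>F. finite F \<and> F \<subseteq> B \<and> Sup S - 1 / Suc n < (\<Sum>b\<in>F. (c b)\<^sup>2)" for n
    using less_cSupD[OF \<open>S \<noteq> {}\<close>, of "Sup S - 1 / Suc n"] by (auto simp: S_def)
  then obtain F where F: "\<And>n. finite (F n)" "\<And>n. F n \<subseteq> B" "\<And>n. Sup S - 1 / Suc n < (\<Sum>b\<in>F n. (c b)\<^sup>2)"
    by metis
  have u_diff: "eventually (\<lambda>k. (q (u (F n) k - u (F m) k))\<^sup>2 < 1 / Suc n + 1 / Suc m) sequentially" for n m
  proof -
    \<comment> \<open>\<open>d\<close> is \<open>c\<close> on \<open>F m - F n\<close>,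
      \<open>- c\<close> on \<open>F n - F m\<close> and 0 on the intersection: two remainders
      differ only over the symmetric difference, where near-maximality of both sums makes the
      squares small.\<close>
    define d where "d b = c b * (of_bool (b \<in> F m) - of_bool (b \<in> F n))" for b
    let ?U = "F n \<union> F m"
    have sub: "(\<Sum>b\<in>?U. g b * of_bool (b \<in> F i)) = (\<Sum>b\<in>F i. g b)" if "i = n \<or> i = m" for g :: "_ \<Rightarrow> real" and i
      using that F(1) by (intro sum.mono_neutral_cong_right) auto
    have sub': "(\<Sum>b\<in>?U. of_bool (b \<in> F i) *\<^sub>R g b) = (\<Sum>b\<in>F i. g b)" if "i = n \<or> i = m" for g :: "_ \<Rightarrow> 'a" and i
      using that F(1) by (intro sum.mono_neutral_cong_right) auto
    have "u (F n) k - u (F m) k = (\<Sum>b\<in>?U. d b *\<^sub>R \<beta> b k)" for k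
    proof -
      have "u (F n) k - u (F m) k = (\<Sum>b\<in>F m. c b *\<^sub>R \<beta> b k) - (\<Sum>b\<in>F n. c b *\<^sub>R \<beta> b k)" by (simp add: u_def)
      also have "\<dots> = (\<Sum>b\<in>?U. of_bool (b \<in> F m) *\<^sub>R (c b *\<^sub>R \<beta> b k)) - (\<Sum>b\<in>?U. of_bool (b \<in> F n) *\<^sub>R (c b *\<^sub>R \<beta> b k))"
        by (simp add: sub' del: scaleR_scaleR)
      also have "\<dots> = (\<Sum>b\<in>?U. d b *\<^sub>R \<beta> b k)"
        by (simp add: d_def sum_subtractf[symmetric] algebra_simps)
      finally show ?thesis .
    qed
    then have "(\<lambda>k. (q (u (F n) k - u (F m) k))\<^sup>2) \<longlonglongrightarrow> (\<Sum>b\<in>?U. (d b)\<^sup>2)"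
      using combo_norm[of ?U d] F(1,2) by simp
    moreover have "(\<Sum>b\<in>?U. (d b)\<^sup>2) < 1 / Suc n + 1 / Suc m"
    proof -
      have "(\<Sum>b\<in>?U. (d b)\<^sup>2) = (\<Sum>b\<in>?U. 2 * (c b)\<^sup>2 - (c b)\<^sup>2 * of_bool (b \<in> F n) - (c b)\<^sup>2 * of_bool (b \<in> F m))"
        by (intro sum.cong) (auto simp: d_def)
      also have "\<dots> = 2 * (\<Sum>b\<in>?U. (c b)\<^sup>2) - (\<Sum>b\<in>F n. (c b)\<^sup>2) - (\<Sum>b\<in>F m. (c b)\<^sup>2)"
        unfolding sum_subtractf sum_distrib_left[symmetric] by (simp only: sub simp_thms)
      also have "\<dots> < 2 * Sup S - (Sup S - 1 / Suc n) - (Sup S - 1 / Suc m)"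
        using le_Sup[of ?U] F(1,2) F(3)[of n] F(3)[of m] by (smt (verit) Un_least finite_UnI)
      finally show ?thesis by simp
    qed
    ultimately show ?thesis by (rule order_tendstoD)
  qed
  \<comment> \<open>For fixed \<open>n\<close> the remainder is itself a Cauchy sequence in \<Phi>;
    freezing it at a late index \<open>K n\<close> yields a single vector of \<Phi>.\<close>
  have "\<exists>k. \<forall>l\<ge>k. q (u (F n) l - u (F n) k) < 1 / Suc n" for n
    using u_Cauchy[OF F(2)[of n]] unfolding seminorm_Cauchy_def
    by (meson divide_pos_pos of_nat_0_less_iff order_refl zero_less_Suc zero_less_one)
  then obtain K where K: "\<And>n l. l \<ge> K n \<Longrightarrow> q (u (F n) l - u (F n) (K n)) < 1 / Suc n" by metis
  define x where "x n = u (F n) (K n)" for n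
  have xu: "eventually (\<lambda>k. q (u (F n) k - x n) < 1 / Suc n) sequentially" for n
    unfolding x_def eventually_sequentially using K by blast
  have inv0: "(\<lambda>n. 1 / real (Suc n)) \<longlonglongrightarrow> 0" using LIMSEQ_inverse_real_of_nat by (simp add: inverse_eq_divide)
  have x_Cauchy: "seminorm_Cauchy q x"
    unfolding seminorm_Cauchy_def
  proof (intro allI impI)
    fix e :: real assume e: "e > 0"
    have "eventually (\<lambda>n. 1 / real (Suc n) < min (e / 3) ((e / 3)\<^sup>2 / 2)) sequentially"
      using e by (intro order_tendstoD(2)[OF inv0]) auto
    then obtain N where N: "\<And>n. n \<ge> N \<Longrightarrow> 1 / real (Suc n) < min (e / 3) ((e / 3)\<^sup>2 / 2)"
      by (auto simp: eventually_sequentially)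
    have "q (x m - x n) < e" if mn: "m \<ge> N" "n \<ge> N" for m n
    proof -
      obtain k where k: "q (u (F m) k - x m) < 1 / Suc m" "q (u (F n) k - x n) < 1 / Suc n"
        "(q (u (F m) k - u (F n) k))\<^sup>2 < 1 / Suc m + 1 / Suc n"
        using eventually_happens[OF eventually_conj[OF xu[of m] eventually_conj[OF xu[of n] u_diff[of m n]]]]
        by auto
      have "(q (u (F m) k - u (F n) k))\<^sup>2 < (e / 3)\<^sup>2" using k(3) N[OF mn(1)] N[OF mn(2)] by linarith
      then have "q (u (F m) k - u (F n) k) < e / 3" by (rule power2_less_imp_less) (use e in simp)
      moreover have "q (x m - x n) \<le> q (u (F m) k - x m) + q (u (F m) k - u (F n) k) + q (u (F n) k - x n)"
        using s(3)[of "(x m - u (F m) k) + (u (F m) k - u (F n) k)" "u (F n) k - x n"]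
          s(3)[of "x m - u (F m) k" "u (F m) k - u (F n) k"] s(7)[of "x m" "u (F m) k"] by simp
      ultimately show ?thesis using k(1,2) N[OF mn(1)] N[OF mn(2)] by linarith
    qed
    then show "\<exists>N. \<forall>m\<ge>N. \<forall>n\<ge>N. q (x m - x n) < e" by blast
  qed
  have "(\<lambda>n. hilbertian_form q (x n) (representative b n)) \<longlonglongrightarrow> 0" if b: "b \<in> B" for b
  proof -
    obtain C where C: "C > 0" "\<And>n. q (\<beta> b n) \<le> C" using seminorm_Cauchy_bounded[OF sn \<beta>[OF b]] by blast
    obtain D where D: "D > 0" "\<And>n. q (x n) \<le> D" using seminorm_Cauchy_bounded[OF sn x_Cauchy] by blast
    \<comment> \<open>\<open>e n\<close> is the limiting coefficient at \<open>b\<close> of the n-th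
      remainder. If \<open>b\<close> is not in \<open>F n\<close>, adding it would raise the sum by
      the square of \<open>c b\<close>, so near-maximality bounds this square by
      \<open>1 / Suc n\<close>.\<close>
    define e where "e n = (if b \<in> F n then 0 else c b)" for n
    have e_le: "(e n)\<^sup>2 \<le> 1 / Suc n" for n
    proof (cases "b \<in> F n")
      case False
      then have "(\<Sum>b\<in>insert b (F n). (c b)\<^sup>2) = (c b)\<^sup>2 + (\<Sum>b\<in>F n. (c b)\<^sup>2)" using F(1) by simp
      then show ?thesis using le_Sup[of "insert b (F n)"] F(1,2) F(3)[of n] b False by (simp add: e_def)
    qed (simp add: e_def)
    have lim_e: "(\<lambda>k. hilbertian_form q (u (F n) k) (\<beta> b k)) \<longlonglongrightarrow> e n" for n
    proof -
      have "(\<lambda>k. hilbertian_form q v (\<beta> b k) - hilbertian_form q (\<Sum>b\<in>F n. c b *\<^sub>R \<beta> b k) (\<beta> b k))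
          \<longlonglongrightarrow> c b - (if b \<in> F n then c b else 0)"
        using F b by (intro tendsto_diff c combo) auto
      then show ?thesis by (simp add: u_def e_def linear_diff[OF hilbertian_form_linear(2)[OF q]] if_distrib cong: if_cong)
    qed
    have bound: "\<bar>hilbertian_form q (x n) (\<beta> b l)\<bar> \<le> sqrt (1 / Suc n) + 1 / Suc n + 1 / Suc n * C + D * r"
      if l: "\<And>k. k \<ge> l \<Longrightarrow> q (\<beta> b k - \<beta> b l) < r" for n l r
    proof -
      have "eventually (\<lambda>k. \<bar>hilbertian_form q (u (F n) k) (\<beta> b k) - e n\<bar> < 1 / Suc n) sequentially"
        using tendstoD[OF lim_e[of n], of "1 / Suc n"] by (simp add: dist_real_def)
      then obtain k where k: "k \<ge> l" "\<bar>hilbertian_form q (u (F n) k) (\<beta> b k) - e n\<bar> < 1 / Suc n"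
        "q (u (F n) k - x n) < 1 / Suc n"
        using eventually_happens[OF eventually_conj[OF eventually_ge_at_top[of l] eventually_conj[OF _ xu[of n]]]]
        by auto
      have "hilbertian_form q (x n) (\<beta> b l) = hilbertian_form q (u (F n) k) (\<beta> b k)
          - hilbertian_form q (u (F n) k - x n) (\<beta> b k) - hilbertian_form q (x n) (\<beta> b k - \<beta> b l)"
        by (simp add: linear_diff[OF hilbertian_form_linear(1)[OF q]] linear_diff[OF hilbertian_form_linear(2)[OF q]])
      moreover have "\<bar>hilbertian_form q (u (F n) k - x n) (\<beta> b k)\<bar> \<le> 1 / Suc n * C"
        using k(3) C s(1) by (intro order_trans[OF hilbertian_form_Cauchy_Schwarz[OF q]] mult_mono) auto
      moreover have "\<bar>hilbertian_form q (x n) (\<beta> b k - \<beta> b l)\<bar> \<le> D * r"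
        using l[OF k(1)] D s(1) by (intro order_trans[OF hilbertian_form_Cauchy_Schwarz[OF q]] mult_mono) auto
      moreover have "\<bar>e n\<bar> \<le> sqrt (1 / Suc n)"
        using real_sqrt_le_mono[OF e_le[of n]] by simp
      ultimately show ?thesis using k(2) by linarith
    qed
    show ?thesis
    proof (rule LIMSEQ_I)
      fix \<delta> :: real assume \<delta>: "\<delta> > 0"
      obtain N where N: "\<And>m n. m \<ge> N \<Longrightarrow> n \<ge> N \<Longrightarrow> q (\<beta> b m - \<beta> b n) < \<delta> / (2 * D)"
        using \<beta>[OF b] \<delta> D(1) unfolding seminorm_Cauchy_def by (meson divide_pos_pos mult_pos_pos zero_less_numeral)
      have "(\<lambda>n. sqrt (1 / real (Suc n)) + 1 / Suc n + 1 / Suc n * C) \<longlonglongrightarrow> sqrt 0 + 0 + 0 * C"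
        by (intro tendsto_intros inv0)
      then have "eventually (\<lambda>n. sqrt (1 / real (Suc n)) + 1 / Suc n + 1 / Suc n * C < \<delta> / 2) sequentially"
        using \<delta> by (intro order_tendstoD(2)[of _ "sqrt 0 + 0 + 0 * C"]) auto
      then obtain N' where N': "\<And>n. n \<ge> N' \<Longrightarrow> sqrt (1 / real (Suc n)) + 1 / Suc n + 1 / Suc n * C < \<delta> / 2"
        by (auto simp: eventually_sequentially)
      have "norm (hilbertian_form q (x n) (representative b n) - 0) < \<delta>" if n: "n \<ge> max N N'" for n
      proof -
        have "\<bar>hilbertian_form q (x n) (\<beta> b n)\<bar> \<le> sqrt (1 / Suc n) + 1 / Suc n + 1 / Suc n * C + D * (\<delta> / (2 * D))"
          using n by (intro bound N) auto
        also have "D * (\<delta> / (2 * D)) = \<delta> / 2" using D by simp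
        finally have "\<bar>hilbertian_form q (x n) (\<beta> b n)\<bar> < \<delta>" using N'[of n] n by linarith
        then show ?thesis by (simp add: \<beta>_def)
      qed
      then show "\<exists>no. \<forall>n\<ge>no. norm (hilbertian_form q (x n) (representative b n) - 0) < \<delta>" by blast
    qed
  qed
  from orthonormal_basis_complete[OF q B x_Cauchy this]
  have "eventually (\<lambda>n. q (x n) < \<epsilon> / 2) sequentially" using \<epsilon> by (intro order_tendstoD(2)) auto
  moreover have "eventually (\<lambda>n. 1 / real (Suc n) < \<epsilon> / 2) sequentially"
    using \<epsilon> by (intro order_tendstoD(2)[OF inv0]) auto
  ultimately obtain n where n: "q (x n) < \<epsilon> / 2" "1 / real (Suc n) < \<epsilon> / 2"
    using eventually_happens[OF eventually_conj] by (smt (verit) trivial_limit_sequentially)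
  have "eventually (\<lambda>k. q (u (F n) k) < \<epsilon>) sequentially"
    using xu[of n]
  proof eventually_elim
    case (elim k)
    then show ?case using s(3)[of "u (F n) k - x n" "x n"] n by simp
  qed
  then show thesis using that[OF F(1)[of n] F(2) Bessel[OF F(1) F(2)]] by (simp add: u_def \<beta>_def)
qed

text \<open>One half of Parseval's identity for functionals: \<open>v\<close> is expanded in the
  basis, and Cauchy--Schwarz is applied to its coefficients and the values of \<open>f\<close>. The
  bound with \<open>C\<close> only controls the remainder, so \<open>C\<close> disappears from the
  result.\<close>

lemma functional_bound_from_basis:
  assumes q: "hilbertian q" and B: "orthonormal_basis q B"
    and f: "linear f" "\<And>x. \<bar>f x\<bar> \<le> C * q x"
    and S: "\<And>F. finite F \<Longrightarrow> F \<subseteq> B \<Longrightarrow> (\<Sum>b\<in>F. (lim (\<lambda>k. f (representative b k)))\<^sup>2) \<le> S"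
  shows "\<bar>f v\<bar> \<le> q v * sqrt S"
proof (rule field_le_epsilon)
  fix e :: real assume e: "e > 0"
  note sn = hilbertian_seminorm[OF q]
  define \<epsilon> where "\<epsilon> = e / (\<bar>C\<bar> + 1)"
  have \<epsilon>: "\<epsilon> > 0" using e by (simp add: \<epsilon>_def)
  obtain F c where F: "finite F" "F \<subseteq> B" and c: "(\<Sum>b\<in>F. (c b)\<^sup>2) \<le> (q v)\<^sup>2"
    and ev: "eventually (\<lambda>k. q (v - (\<Sum>b\<in>F. c b *\<^sub>R representative b k)) < \<epsilon>) sequentially"
    using orthonormal_basis_expansion[OF q B \<epsilon>] .
  let ?g = "\<lambda>b. lim (\<lambda>k. f (representative b k))"
  have g: "(\<lambda>k. f (representative b k)) \<longlonglongrightarrow> ?g b" if "b \<in> B" for b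
    using bounded_linear_Cauchy[OF f sn orthonormal_basisD(1)[OF q B that]] by (simp add: convergent_LIMSEQ_iff)
  have "(\<lambda>k. \<bar>\<Sum>b\<in>F. c b * f (representative b k)\<bar> + \<bar>C\<bar> * \<epsilon>) \<longlonglongrightarrow> \<bar>\<Sum>b\<in>F. c b * ?g b\<bar> + \<bar>C\<bar> * \<epsilon>"
    using F g by (intro tendsto_intros) auto
  moreover have "eventually (\<lambda>k. \<bar>f v\<bar> \<le> \<bar>\<Sum>b\<in>F. c b * f (representative b k)\<bar> + \<bar>C\<bar> * \<epsilon>) sequentially"
    using ev
  proof eventually_elim
    case (elim k)
    let ?w = "\<Sum>b\<in>F. c b *\<^sub>R representative b k"
    have "\<bar>f (v - ?w)\<bar> \<le> \<bar>C\<bar> * \<epsilon>"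
    proof -
      have "\<bar>f (v - ?w)\<bar> \<le> C * q (v - ?w)" by (rule f(2))
      also have "\<dots> \<le> \<bar>C\<bar> * q (v - ?w)" using is_seminormD(1)[OF sn] by (intro mult_right_mono) auto
      also have "\<dots> \<le> \<bar>C\<bar> * \<epsilon>" using elim by (intro mult_left_mono) auto
      finally show ?thesis .
    qed
    moreover have "f (v - ?w) = f v - (\<Sum>b\<in>F. c b * f (representative b k))"
      by (simp add: linear_diff[OF f(1)] linear_sum[OF f(1)] linear_cmul[OF f(1)])
    ultimately show ?case by linarith
  qed
  ultimately have "\<bar>f v\<bar> \<le> \<bar>\<Sum>b\<in>F. c b * ?g b\<bar> + \<bar>C\<bar> * \<epsilon>"
    by (rule tendsto_lowerbound) simp
  also have "\<bar>\<Sum>b\<in>F. c b * ?g b\<bar> \<le> L2_set c F * L2_set ?g F"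
    by (rule order_trans[OF sum_abs], simp only: abs_mult, rule L2_set_mult_ineq)
  also have "\<dots> \<le> q v * sqrt S"
  proof (intro mult_mono)
    show "L2_set c F \<le> q v"
      using real_sqrt_le_mono[OF c] is_seminormD(1)[OF sn] by (simp add: L2_set_def)
    show "L2_set ?g F \<le> sqrt S" unfolding L2_set_def by (intro real_sqrt_le_mono S F)
  qed (auto simp: is_seminormD(1)[OF sn] L2_set_nonneg)
  also have "\<bar>C\<bar> * \<epsilon> \<le> e" using e by (simp add: \<epsilon>_def field_simps)
  finally show "\<bar>f v\<bar> \<le> q v * sqrt S + e" by simp
qed

text \<open>A one-sided form of the fact that the Hilbert--Schmidt norm does not depend on the
  basis. The vectors \<open>x j\<close> lie in the span of a finite family \<open>y\<close> that is
  semi-orthonormal for \<open>p\<close>. For each coordinate functional of \<open>y\<close>, the sum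
  of its squares over the contractive family is bounded by the sum over the basis. Summing over the
  coordinates, Bessel's inequality turns the latter into squares of \<open>p\<close> over the
  basis.\<close>

lemma hilbert_schmidt_imp_hs_bounded:
  assumes p: "hilbertian p" and q: "hilbertian q" and le: "\<And>x. p x \<le> q x"
    and hs: "hilbert_schmidt q p (canonical_map p)"
  shows "hs_bounded q p"
proof -
  note sp = is_seminormD[OF hilbertian_seminorm[OF p]] and sq = is_seminormD[OF hilbertian_seminorm[OF q]]
  obtain B where B: "orthonormal_basis q B"
    and sm: "(\<lambda>e. hilbert_inner p (canonical_map p e) (canonical_map p e)) summable_on B"
    using hs unfolding hilbert_schmidt_def by blast
  let ?h = "\<lambda>e. hilbert_inner p (canonical_map p e) (canonical_map p e)"
  have \<beta>p: "seminorm_Cauchy p (representative b)" if "b \<in> B" for b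
    using orthonormal_basisD(1)[OF q B that] le unfolding seminorm_Cauchy_def by (meson le_less_trans)
  \<comment> \<open>The representatives of \<open>b\<close> and of \<open>canonical_map p b\<close>
    are chosen independently; a member \<open>X\<close> of \<open>b\<close> links them up to null
    sequences for \<open>p\<close>.\<close>
  have h: "(\<lambda>k. (p (representative b k))\<^sup>2) \<longlonglongrightarrow> ?h b" if b: "b \<in> B" for b
  proof -
    let ?c = "canonical_map p b"
    have P: "is_seminorm r" if "r \<in> {p}" for r using that hilbertian_seminorm[OF p] by simp
    have Q: "is_seminorm r" if "r \<in> {q}" for r using that hilbertian_seminorm[OF q] by simp
    have bq: "b \<in> completion_set (seminorm_topology {q})"
      using B b by (auto simp: orthonormal_basis_def hilbert_space_def)
    have "representative b \<in> ?c"
      unfolding canonical_map_def using completion_setE(1)[OF Q bq] \<beta>p[OF b]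
      by (intro ImageI[of "representative b"]) (auto simp: cauchy_rel_singleton hilbertian_seminorm[OF p] sp(4))
    then have "representative ?c \<in> ?c" unfolding representative_def by (rule someI[of "\<lambda>X. X \<in> ?c"])
    then obtain X where X: "X \<in> b" "(X, representative ?c) \<in> cauchy_rel (seminorm_topology {p})"
      unfolding canonical_map_def by blast
    then have XR: "seminorm_Cauchy p (representative ?c)" "(\<lambda>n. p (X n - representative ?c n)) \<longlonglongrightarrow> 0"
      by (auto simp: cauchy_rel_singleton hilbertian_seminorm[OF p])
    have "(\<lambda>n. q (X n - representative b n)) \<longlonglongrightarrow> 0"
      using completion_setE(3)[OF Q bq X(1) completion_setE(1)[OF Q bq]] by simp
    from tendsto_sandwich[OF _ _ tendsto_const this]
    have Xb: "(\<lambda>n. p (X n - representative b n)) \<longlonglongrightarrow> 0" by (simp add: sp(1) le)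
    have "\<bar>p (representative b n) - p (representative ?c n)\<bar> \<le> p (X n - representative ?c n) + p (X n - representative b n)" for n
      using sp(3)[of "representative b n" "X n - representative b n"] sp(3)[of "representative ?c n" "X n - representative ?c n"]
        sp(6)[of "X n" "X n - representative ?c n"] sp(6)[of "X n" "X n - representative b n"] by auto
    then have "(\<lambda>n. \<bar>p (representative b n) - p (representative ?c n)\<bar>) \<longlonglongrightarrow> 0"
      by (intro tendsto_sandwich[OF _ _ tendsto_const tendsto_add[OF XR(2) Xb, simplified]]) auto
    then have d: "(\<lambda>n. p (representative b n) - p (representative ?c n)) \<longlonglongrightarrow> 0" by (simp add: tendsto_rabs_zero_iff)
    obtain l where l: "(\<lambda>n. p (representative ?c n)) \<longlonglongrightarrow> l"
      using seminorm_Cauchy_convergent[OF hilbertian_seminorm[OF p] XR(1)] by (auto simp: convergent_def)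
    have "?h b = l\<^sup>2"
      unfolding hilbert_inner_def hilbertian_formD(3)[OF p] by (intro limI tendsto_power l)
    moreover have "(\<lambda>n. p (representative b n)) \<longlonglongrightarrow> l" using tendsto_add[OF d l] by simp
    ultimately show ?thesis by (auto intro: tendsto_power)
  qed
  have h_nonneg: "0 \<le> ?h b" if "b \<in> B" for b
    using LIMSEQ_le_const[OF h[OF that], of 0] by auto
  have "(\<Sum>j<m. (p (x j))\<^sup>2) \<le> infsum ?h B" if x: "contractive q m x" for m x
  proof -
    obtain n y where y: "semi_orthonormal p n y" and span: "\<And>j. j < m \<Longrightarrow> \<exists>a. x j = (\<Sum>i<n. a i *\<^sub>R y i)"
      using approximate_Gram_Schmidt[OF p, of "x ` {..<m}" 1] by fastforce
    define f where "f i v = hilbertian_form p v (y i)" for i v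
    have f: "linear (f i)" for i unfolding f_def by (rule hilbertian_form_linear(2)[OF p])
    have f_le: "\<bar>f i v\<bar> \<le> 1 * q v" if "i < n" for i v
    proof -
      have "\<bar>f i v\<bar> \<le> p v * p (y i)" unfolding f_def by (rule hilbertian_form_Cauchy_Schwarz[OF p])
      also have "\<dots> \<le> q v * 1"
        using y that le[of v] sp(1) sq(1) by (intro mult_mono) (auto simp: semi_orthonormal_def)
      finally show ?thesis by simp
    qed
    let ?g = "\<lambda>i b. lim (\<lambda>k. f i (representative b k))"
    have g: "(\<lambda>k. f i (representative b k)) \<longlonglongrightarrow> ?g i b" if "b \<in> B" "i < n" for i b
      using bounded_linear_Cauchy[OF f f_le hilbertian_seminorm[OF q] orthonormal_basisD(1)[OF q B]] that
      by (simp add: convergent_LIMSEQ_iff)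
    have Bessel: "(\<Sum>i<n. (?g i b)\<^sup>2) \<le> ?h b" if b: "b \<in> B" for b
    proof (rule LIMSEQ_le)
      show "(\<lambda>k. \<Sum>i<n. (f i (representative b k))\<^sup>2) \<longlonglongrightarrow> (\<Sum>i<n. (?g i b)\<^sup>2)"
        using g b by (intro tendsto_intros) auto
      show "(\<lambda>k. (p (representative b k))\<^sup>2) \<longlonglongrightarrow> ?h b" by (rule h[OF b])
      have "(\<Sum>i<n. (f i v)\<^sup>2) \<le> (p v)\<^sup>2" for v
        using semi_orthonormal_residual(2)[OF p y, of v] by (simp add: f_def)
      then show "\<exists>N. \<forall>k\<ge>N. (\<Sum>i<n. (f i (representative b k))\<^sup>2) \<le> (p (representative b k))\<^sup>2" by blast
    qed
    have g_sm: "(\<lambda>b. (?g i b)\<^sup>2) summable_on B" if "i < n" for i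
    proof (rule summable_on_comparison_test[OF sm])
      fix b assume b: "b \<in> B"
      have "(?g i b)\<^sup>2 \<le> (\<Sum>i<n. (?g i b)\<^sup>2)" using that by (intro member_le_sum) auto
      then show "(?g i b)\<^sup>2 \<le> ?h b" using Bessel[OF b] by simp
    qed auto
    have key: "(\<Sum>j<m. (f i (x j))\<^sup>2) \<le> infsum (\<lambda>b. (?g i b)\<^sup>2) B" if i: "i < n" for i
    proof -
      let ?S = "infsum (\<lambda>b. (?g i b)\<^sup>2) B"
      define t where "t = (\<Sum>j<m. (f i (x j))\<^sup>2)"
      \<comment> \<open>A test vector for duality: \<open>f i v = t\<close>, and contractivity with
        the coefficients \<open>f i (x j)\<close> gives \<open>(q v)\<^sup>2 \<le> t\<close>, so
        that the bound on the functional becomes \<open>t \<le> sqrt t * sqrt ?S\<close>.\<close>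
      define v where "v = (\<Sum>j<m. f i (x j) *\<^sub>R x j)"
      have t0: "0 \<le> t" by (simp add: t_def sum_nonneg)
      have "(\<Sum>b\<in>F. (?g i b)\<^sup>2) \<le> ?S" if "finite F" "F \<subseteq> B" for F
        using that g_sm[OF i] by (intro finite_sum_le_infsum) auto
      then have "\<bar>f i v\<bar> \<le> q v * sqrt ?S"
        by (rule functional_bound_from_basis[OF q B f f_le[OF i]])
      moreover have "f i v = t"
        by (simp add: v_def t_def linear_sum[OF f] linear_cmul[OF f] power2_eq_square)
      moreover have "(q v)\<^sup>2 \<le> t" 
        using x[unfolded contractive_def, THEN spec, of "\<lambda>j. f i (x j)"] by (simp add: v_def t_def)
      then have "q v \<le> sqrt t" using real_le_rsqrt by blast
      moreover have S0: "0 \<le> ?S" by (intro infsum_nonneg) auto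
      ultimately have "t \<le> sqrt t * sqrt ?S" 
        by (smt (verit) mult_right_mono real_sqrt_ge_zero)
      then have "t\<^sup>2 \<le> t * ?S"
        using power_mono[of t "sqrt t * sqrt ?S" 2] t0 S0 by (simp add: power_mult_distrib)
      then show ?thesis using t0 S0 unfolding t_def[symmetric]
        by (cases "t = 0") (auto simp: power2_eq_square)
    qed
    have "(\<Sum>j<m. (p (x j))\<^sup>2) = (\<Sum>j<m. \<Sum>i<n. (f i (x j))\<^sup>2)"
    proof (intro sum.cong refl)
      fix j assume "j \<in> {..<m}"
      then obtain a where a: "x j = (\<Sum>i<n. a i *\<^sub>R y i)" using span by blast
      have "(p (x j))\<^sup>2 = (\<Sum>i<n. (a i)\<^sup>2 * p (y i))" unfolding a by (rule semi_orthonormal_norm[OF p y])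
      also have "\<dots> = (\<Sum>i<n. (f i (x j))\<^sup>2)"
      proof (intro sum.cong refl)
        fix i assume i: "i \<in> {..<n}"
        have "f i (x j) = a i * p (y i)"
          unfolding f_def a using semi_orthonormal_form[OF p y] i by simp
        moreover have "p (y i) = 0 \<or> p (y i) = 1" using y i by (auto simp: semi_orthonormal_def)
        ultimately show "(a i)\<^sup>2 * p (y i) = (f i (x j))\<^sup>2" by auto
      qed
      finally show "(p (x j))\<^sup>2 = (\<Sum>i<n. (f i (x j))\<^sup>2)" .
    qed
    also have "\<dots> = (\<Sum>i<n. \<Sum>j<m. (f i (x j))\<^sup>2)" by (rule sum.swap)
    also have "\<dots> \<le> (\<Sum>i<n. infsum (\<lambda>b. (?g i b)\<^sup>2) B)" by (intro sum_mono key) auto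
    also have "\<dots> = infsum (\<lambda>b. \<Sum>i<n. (?g i b)\<^sup>2) B" using g_sm by (subst infsum_of_sum) auto
    also have "\<dots> \<le> infsum ?h B"
      using g_sm sm Bessel infsum_of_sum[of "{..<n}" "\<lambda>i b. (?g i b)\<^sup>2" B] by (intro infsum_mono) auto
    finally show ?thesis .
  qed
  then show ?thesis unfolding hs_bounded_def by blast
qed

section \<open>Strong duals\<close>

lemma topspace_strong_dual [simp]: "topspace (strong_dual E) = dual E"
  by (auto simp: strong_dual_def topology_generated_by_topspace)

lemma openin_strong_dual_basic:
  "f \<in> dual E \<Longrightarrow> bounded_in E B \<Longrightarrow> B \<noteq> {} \<Longrightarrow> r > 0 \<Longrightarrow>
    openin (strong_dual E) {g \<in> dual E. (SUP x\<in>B. \<bar>g x - f x\<bar>) < r}"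
  unfolding strong_dual_def by (rule topology_generated_by_Basis) blast

text \<open>What \<Phi> and its completion have in common here; convergence in the strong dual can
  then be treated once for both.\<close>

definition tvs_base :: "'v tvs \<Rightarrow> bool" where
  "tvs_base E \<longleftrightarrow> topspace (vtop E) = vecs E \<and> vzero E \<in> vecs E \<and> (\<forall>f\<in>dual E. f (vzero E) = 0)"

text \<open>With such a weight, an estimate by \<open>\<epsilon> * \<rho> x\<close> at all points is
  uniform on each bounded set, which is closeness in the strong dual. For \<Phi> the weight is a
  continuous semi-norm, for the completion its extension.\<close>

definition bounded_on_bounded :: "'v tvs \<Rightarrow> ('v \<Rightarrow> real) \<Rightarrow> bool" where
  "bounded_on_bounded E \<rho> \<longleftrightarrow> (\<forall>B. bounded_in E B \<longrightarrow> (\<exists>b. \<forall>x\<in>B. \<rho> x \<le> b))"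

lemma bounded_on_boundedI:
  assumes E: "topspace (vtop E) = vecs E" "vzero E \<in> vecs E"
    and open_unit: "openin (vtop E) {x \<in> vecs E. \<rho> x < 1}" and "\<rho> (vzero E) < 1"
    and scale: "\<And>r x. x \<in> vecs E \<Longrightarrow> r > 0 \<Longrightarrow> \<rho> (vscale E r x) = r * \<rho> x"
  shows "bounded_on_bounded E \<rho>"
  unfolding bounded_on_bounded_def
proof (intro allI impI)
  fix B assume "bounded_in E B"
  then obtain s where s: "s > 0" "B \<subseteq> vscale E s ` {x \<in> vecs E. \<rho> x < 1}"
    using assms unfolding bounded_in_def by (smt (verit) mem_Collect_eq)
  have "\<rho> x \<le> s" if "x \<in> B" for x
  proof -
    obtain y where "x = vscale E s y" "y \<in> vecs E" "\<rho> y < 1" using s \<open>x \<in> B\<close> by blast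
    then show ?thesis using s(1) scale[of y s] by simp
  qed
  then show "\<exists>b. \<forall>x\<in>B. \<rho> x \<le> b" by blast
qed

lemma dual_bounded_on_bounded:
  assumes E: "tvs_base E" and f: "f \<in> dual E"
  shows "bounded_on_bounded E (\<lambda>x. \<bar>f x\<bar>)"
proof (rule bounded_on_boundedI)
  have "openin (vtop E) {x \<in> topspace (vtop E). f x \<in> {-1<..<1}}"
    using f by (intro openin_continuous_map_preimage) (auto simp: dual_def)
  moreover have "{x \<in> topspace (vtop E). f x \<in> {-1<..<1}} = {x \<in> vecs E. \<bar>f x\<bar> < 1}"
    using E by (auto simp: tvs_base_def)
  ultimately show "openin (vtop E) {x \<in> vecs E. \<bar>f x\<bar> < 1}" by simp
qed (use E f in \<open>auto simp: tvs_base_def dual_def abs_mult\<close>)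

text \<open>The centre \<open>h\<close> of a generating set may differ from \<open>f\<close>; half
  of the gap \<open>r - t\<close> left by \<open>f\<close> is spent on the distance from
  \<open>g\<close> to \<open>f\<close>.\<close>

lemma strong_dual_nbhd:
  assumes E: "tvs_base E" and U: "openin (strong_dual E) U" "f \<in> U"
    and \<rho>: "bounded_on_bounded E \<rho>"
  shows "\<exists>\<epsilon>>0. \<forall>g\<in>dual E. (\<forall>x\<in>vecs E. \<bar>g x - f x\<bar> \<le> \<epsilon> * \<rho> x) \<longrightarrow> g \<in> U"
proof -
  have fd: "f \<in> dual E" using openin_subset[OF U(1)] U(2) by auto
  have "generate_topology_on (insert (dual E)
       {{g \<in> dual E. (SUP x\<in>B. \<bar>g x - f x\<bar>) < r} | f B r. f \<in> dual E \<and> bounded_in E B \<and> B \<noteq> {} \<and> r > 0}) U"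
    using U(1) unfolding strong_dual_def openin_topology_generated_by_iff .
  then show ?thesis using U(2)
  proof (induction rule: generate_topology_on.induct)
    case (Int a b)
    obtain d e where 1: "d > 0" "\<forall>g\<in>dual E. (\<forall>x\<in>vecs E. \<bar>g x - f x\<bar> \<le> d * \<rho> x) \<longrightarrow> g \<in> a"
      and 2: "e > 0" "\<forall>g\<in>dual E. (\<forall>x\<in>vecs E. \<bar>g x - f x\<bar> \<le> e * \<rho> x) \<longrightarrow> g \<in> b"
      using Int by blast
    have "\<bar>t\<bar> \<le> d * r \<and> \<bar>t\<bar> \<le> e * r" if "\<bar>t\<bar> \<le> min d e * r" for t r :: real
    proof -
      \<comment> \<open>The sign of \<open>\<rho>\<close> is unknown; the estimate itself forces its
        value \<open>r\<close> to be nonnegative.\<close>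
      have "0 \<le> min d e * r" using that by linarith
      then have "0 \<le> r" using 1(1) 2(1) by (simp add: zero_le_mult_iff min_def split: if_splits)
      then have "min d e * r \<le> d * r" "min d e * r \<le> e * r" by (auto intro: mult_right_mono)
      then show ?thesis using that by linarith
    qed
    then have "g \<in> a \<inter> b" if "g \<in> dual E" "\<forall>x\<in>vecs E. \<bar>g x - f x\<bar> \<le> min d e * \<rho> x" for g
      using 1(2) 2(2) that by blast
    then show ?case using 1(1) 2(1) by (intro exI[of _ "min d e"]) auto
  next
    case (UN K)
    then obtain k where k: "k \<in> K" "f \<in> k" by blast
    show ?case using UN.IH[OF k] k(1) by blast
  next
    case (Basis s)
    show ?case
    proof (cases "s = dual E")
      case True
      then show ?thesis by (intro exI[of _ 1]) auto
    next
      case False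
      then obtain h B r where s: "s = {g \<in> dual E. (SUP x\<in>B. \<bar>g x - h x\<bar>) < r}"
        and h: "h \<in> dual E" and B: "bounded_in E B" "B \<noteq> {}" and r: "r > 0" using Basis(1) by blast
      define t where "t = (SUP x\<in>B. \<bar>f x - h x\<bar>)"
      have t: "t < r" using Basis(2) s by (simp add: t_def)
      obtain b where b: "\<And>x. x \<in> B \<Longrightarrow> \<rho> x \<le> b" using \<rho> B(1) unfolding bounded_on_bounded_def by blast
      obtain c d where cd: "\<And>x. x \<in> B \<Longrightarrow> \<bar>f x\<bar> \<le> c" "\<And>x. x \<in> B \<Longrightarrow> \<bar>h x\<bar> \<le> d"
        using dual_bounded_on_bounded[OF E fd] dual_bounded_on_bounded[OF E h] B(1)
        unfolding bounded_on_bounded_def by meson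
      have fh: "\<bar>f x - h x\<bar> \<le> t" if "x \<in> B" for x
        unfolding t_def
      proof (rule cSUP_upper[OF that])
        show "bdd_above ((\<lambda>x. \<bar>f x - h x\<bar>) ` B)"
          using cd by (intro bdd_aboveI2[of _ _ "c + d"]) (smt (verit))
      qed
      define e where "e = (r - t) / (2 * (\<bar>b\<bar> + 1))"
      have e: "e > 0" using t by (simp add: e_def)
      have eb: "e * \<bar>b\<bar> \<le> (r - t) / 2"
      proof -
        have "e * \<bar>b\<bar> \<le> e * (\<bar>b\<bar> + 1)" using e by (intro mult_left_mono) auto
        also have "\<dots> = (r - t) / 2" by (simp add: e_def field_simps)
        finally show ?thesis .
      qed
      have "g \<in> s" if g: "g \<in> dual E" "\<And>x. x \<in> vecs E \<Longrightarrow> \<bar>g x - f x\<bar> \<le> e * \<rho> x" for g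
      proof -
        have "(SUP x\<in>B. \<bar>g x - h x\<bar>) \<le> (r - t) / 2 + t"
        proof (rule cSUP_least[OF B(2)])
          fix x assume x: "x \<in> B"
          have "\<bar>g x - f x\<bar> \<le> e * \<rho> x" using g(2) x B(1) by (auto simp: bounded_in_def)
          also have "\<dots> \<le> e * \<bar>b\<bar>" using b[OF x] e by (intro mult_left_mono) auto
          finally show "\<bar>g x - h x\<bar> \<le> (r - t) / 2 + t" using fh[OF x] eb by linarith
        qed
        also have "\<dots> < r" using t by (simp add: field_simps)
        finally show ?thesis using g(1) s by simp
      qed
      then show ?thesis using e by blast
    qed
  qed auto
qed

lemma limitin_strong_dual:
  assumes "tvs_base E" "bounded_on_bounded E \<rho>" "f \<in> dual E" "eventually (\<lambda>u. g u \<in> dual E) F"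
    and "\<And>\<epsilon>. \<epsilon> > 0 \<Longrightarrow> eventually (\<lambda>u. \<forall>x\<in>vecs E. \<bar>g u x - f x\<bar> \<le> \<epsilon> * \<rho> x) F"
  shows "limitin (strong_dual E) g f F"
  unfolding limitin_def
proof (intro conjI allI impI)
  fix U assume "openin (strong_dual E) U \<and> f \<in> U"
  then obtain \<epsilon> where "\<epsilon> > 0" and \<epsilon>: "\<And>g. g \<in> dual E \<Longrightarrow> (\<forall>x\<in>vecs E. \<bar>g x - f x\<bar> \<le> \<epsilon> * \<rho> x) \<Longrightarrow> g \<in> U"
    using strong_dual_nbhd[OF assms(1) _ _ assms(2)] by meson
  show "eventually (\<lambda>u. g u \<in> U) F"
    using assms(4) assms(5)[OF \<open>\<epsilon> > 0\<close>] by eventually_elim (rule \<epsilon>)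
qed (simp add: assms(3))

text \<open>\<open>q\<close> need not belong to \<open>P\<close>, so the ball is not a generating
  set; a neighbourhood of 0 given by finitely many members of \<open>P\<close> is translated to each
  point \<open>z\<close> of the ball.\<close>

lemma openin_continuous_seminorm_ball:
  assumes P: "\<And>p. p \<in> P \<Longrightarrow> is_seminorm p" and q: "continuous_map (seminorm_topology P) euclideanreal q" "is_seminorm q"
  shows "openin (seminorm_topology P) {y. q (y - x) < r}"
proof (subst openin_subopen, intro ballI)
  fix z assume "z \<in> {y. q (y - x) < r}"
  then have z: "q (z - x) < r" by simp
  let ?s = "r - q (z - x)"
  have "openin (seminorm_topology P) {y. q y < ?s}" using openin_seminorm_ball_0[OF q(1), of ?s] by simp
  moreover have "0 \<in> {y. q y < ?s}" using z by (simp add: is_seminormD(4)[OF q(2)])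
  ultimately obtain F e where F: "finite F" "F \<subseteq> P" "e > 0"
    "\<And>y. (\<forall>p\<in>F. p (y - 0) < e) \<Longrightarrow> y \<in> {y. q y < ?s}"
    using openin_seminorm_topologyD[OF P, of P _ 0] by meson
  have "openin (seminorm_topology P) (\<Inter>p\<in>F. {y. p (y - z) < e})" if "F \<noteq> {}"
    using F that by (intro openin_INT2 openin_seminorm_ball) auto
  then have "openin (seminorm_topology P) (\<Inter>p\<in>F. {y. p (y - z) < e})"
    by (cases "F = {}") (auto simp: openin_topspace[of "seminorm_topology P", simplified])
  moreover have "z \<in> (\<Inter>p\<in>F. {y. p (y - z) < e})" 
    using F(2,3) by (simp, metis subsetD is_seminormD(4) P)
  moreover have "(\<Inter>p\<in>F. {y. p (y - z) < e}) \<subseteq> {y. q (y - x) < r}"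
  proof
    fix y assume "y \<in> (\<Inter>p\<in>F. {y. p (y - z) < e})"
    then have "q (y - z) < ?s" using F(4)[of "y - z"] by auto
    then show "y \<in> {y. q (y - x) < r}" using is_seminormD(3)[OF q(2), of "y - z" "z - x"] by simp
  qed
  ultimately show "\<exists>U. openin (seminorm_topology P) U \<and> z \<in> U \<and> U \<subseteq> {y. q (y - x) < r}" by blast
qed

lemma dual_tvs_of: "f \<in> dual (tvs_of T) \<longleftrightarrow> linear f \<and> continuous_map T euclideanreal f"
  by (auto simp: dual_def tvs_of_def linear_iff)

lemma bounded_linear_in_dual:
  assumes P: "\<And>p. p \<in> P \<Longrightarrow> is_seminorm p" and q: "continuous_map (seminorm_topology P) euclideanreal q" "is_seminorm q"
    and f: "linear f" "\<And>x. \<bar>f x\<bar> \<le> C * q x"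
  shows "f \<in> dual (tvs_of (seminorm_topology P))"
proof -
  have "openin (seminorm_topology P) {x. f x \<in> U}" if U: "open U" for U
  proof (subst openin_subopen, intro ballI)
    fix x assume "x \<in> {x. f x \<in> U}"
    then obtain e where e: "e > 0" "\<And>t. \<bar>t - f x\<bar> < e \<Longrightarrow> t \<in> U"
      using U by (auto simp: open_dist dist_real_def)
    have "y \<in> {x. f x \<in> U}" if "q (y - x) < e / (\<bar>C\<bar> + 1)" for y
    proof -
      have "\<bar>f y - f x\<bar> \<le> C * q (y - x)" using f(2)[of "y - x"] by (simp add: linear_diff[OF f(1)])
      also have "\<dots> \<le> (\<bar>C\<bar> + 1) * q (y - x)" using is_seminormD(1)[OF q(2)] by (intro mult_right_mono) auto
      also have "\<dots> < e" using that by (simp add: field_simps)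
      finally show ?thesis using e(2) by simp
    qed
    moreover have "openin (seminorm_topology P) {y. q (y - x) < e / (\<bar>C\<bar> + 1)}"
      by (rule openin_continuous_seminorm_ball[OF P q])
    ultimately show "\<exists>W. openin (seminorm_topology P) W \<and> x \<in> W \<and> W \<subseteq> {x. f x \<in> U}"
      using e(1) by (intro exI[of _ "{y. q (y - x) < e / (\<bar>C\<bar> + 1)}"]) (auto simp: is_seminormD(4)[OF q(2)])
  qed
  then show ?thesis using f(1) by (simp add: dual_tvs_of continuous_map_def)
qed

lemma tvs_base_tvs_of: "topspace T = UNIV \<Longrightarrow> tvs_base (tvs_of T)"
  by (auto simp: tvs_base_def dual_tvs_of linear_0) (simp_all add: tvs_of_def linear_0)

lemma seminorm_bounded_on_bounded:
  assumes "topspace T = UNIV" "continuous_map T euclideanreal q" "is_seminorm q"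
  shows "bounded_on_bounded (tvs_of T) q"
  using openin_seminorm_ball_0[OF assms(2), of 1] assms(1)
  by (intro bounded_on_boundedI) (auto simp: tvs_of_def is_seminormD[OF assms(3)])

lemma bounded_in_singleton:
  assumes P: "\<And>p. p \<in> P \<Longrightarrow> is_seminorm p"
  shows "bounded_in (tvs_of (seminorm_topology P)) {\<phi>}"
  unfolding bounded_in_def tvs_of_def
proof (intro conjI allI impI; simp)
  fix U assume "openin (seminorm_topology P) U \<and> 0 \<in> U"
  then obtain F e where F: "finite F" "F \<subseteq> P" "e > 0" "\<And>y. (\<forall>p\<in>F. p (y - 0) < e) \<Longrightarrow> y \<in> U"
    using openin_seminorm_topologyD[OF P, of P U 0] by meson
  define s where "s = (\<Sum>p\<in>F. p \<phi>) / e + 1"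
  have nn: "0 \<le> p \<phi>" if "p \<in> F" for p using is_seminormD(1)[OF P] F(2) that by auto
  have s: "s > 0" using nn F(3) by (auto simp: s_def intro!: add_nonneg_pos divide_nonneg_pos sum_nonneg)
  have "\<phi> \<in> (*\<^sub>R) r ` U" if r: "r \<ge> s" for r
  proof -
    have rp: "r > 0" using s r by linarith
    have "(1 / r) *\<^sub>R \<phi> \<in> U"
    proof (intro F(4) ballI)
      fix p assume p: "p \<in> F"
      have "p \<phi> \<le> (\<Sum>p\<in>F. p \<phi>)" using p nn F(1) by (intro member_le_sum) auto
      also have "\<dots> < s * e" using F(3) by (simp add: s_def field_simps)
      also have "\<dots> \<le> r * e" using r F(3) by simp
      finally show "p ((1 / r) *\<^sub>R \<phi> - 0) < e"
        using rp P[of p] p F(2) by (auto simp: is_seminormD(2) field_simps)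
    qed
    then show ?thesis using rp by (intro image_eqI[of _ _ "(1 / r) *\<^sub>R \<phi>"]) auto
  qed
  then show "\<exists>s>0. \<forall>r\<ge>s. \<phi> \<in> (*\<^sub>R) r ` U" using s by blast
qed

text \<open>One-point sets are bounded, so the strong topology is finer than that of pointwise
  convergence.\<close>

lemma continuous_map_evaluation:
  assumes P: "\<And>p. p \<in> P \<Longrightarrow> is_seminorm p"
  shows "continuous_map (strong_dual (tvs_of (seminorm_topology P))) euclideanreal (\<lambda>f. f \<phi>)"
proof -
  let ?E = "tvs_of (seminorm_topology P)"
  have "openin (strong_dual ?E) {f \<in> dual ?E. f \<phi> \<in> U}" if U: "open U" for U
  proof (subst openin_subopen, intro ballI)
    fix f assume f: "f \<in> {f \<in> dual ?E. f \<phi> \<in> U}"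
    then obtain e where e: "e > 0" "\<And>t. \<bar>t - f \<phi>\<bar> < e \<Longrightarrow> t \<in> U"
      using U by (auto simp: open_dist dist_real_def)
    have "openin (strong_dual ?E) {g \<in> dual ?E. (SUP x\<in>{\<phi>}. \<bar>g x - f x\<bar>) < e}"
      using f e by (intro openin_strong_dual_basic bounded_in_singleton P) auto
    then show "\<exists>W. openin (strong_dual ?E) W \<and> f \<in> W \<and> W \<subseteq> {f \<in> dual ?E. f \<phi> \<in> U}"
      using f e by (intro exI[of _ "{g \<in> dual ?E. (SUP x\<in>{\<phi>}. \<bar>g x - f x\<bar>) < e}"]) auto
  qed
  then show ?thesis by (simp add: continuous_map_def)
qed

section \<open>Duals of completions\<close>

lemma zero_scaled_members:
  assumes P: "\<And>p. p \<in> P \<Longrightarrow> is_seminorm p" and c: "c \<in> completion_set (seminorm_topology P)"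
  shows "{\<lambda>n. 0 *\<^sub>R X n | X. X \<in> c} = {\<lambda>_. 0}"
  using completion_setE(1)[OF P c] by auto

definition extended_seminorm :: "('a::real_vector \<Rightarrow> real) \<Rightarrow> (nat \<Rightarrow> 'a) set \<Rightarrow> real" where
  "extended_seminorm p c = lim (\<lambda>n. p (representative c n))"

definition extended_functional :: "'a::real_vector topology \<Rightarrow> ('a \<Rightarrow> real) \<Rightarrow> (nat \<Rightarrow> 'a) set \<Rightarrow> real" where
  "extended_functional \<theta> f = (\<lambda>c\<in>completion_set \<theta>. lim (\<lambda>n. f (representative c n)))"

locale seminorm_family =
  fixes P :: "('a::real_vector \<Rightarrow> real) set"
  assumes P: "\<And>p. p \<in> P \<Longrightarrow> is_seminorm p"
begin

abbreviation "\<theta> \<equiv> seminorm_topology P"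
abbreviation "E \<equiv> tvs_completion \<theta>"
abbreviation "cls X \<equiv> cauchy_rel \<theta> `` {X}"

lemma vecs_E: "vecs E = completion_set \<theta>" by (simp add: tvs_completion_def)

lemma topspace_E: "topspace (vtop E) = completion_set \<theta>"
  by (auto simp: tvs_completion_def topology_generated_by_topspace)

lemma Cauchy_completion:
  assumes "\<And>p. p \<in> P \<Longrightarrow> seminorm_Cauchy p X" "continuous_map \<theta> euclideanreal q" "is_seminorm q"
  shows "seminorm_Cauchy q X"
  using assms by (intro cauchy_in_imp_seminorm_Cauchy[of \<theta>]) (auto simp: cauchy_in_seminorm_topology[OF P])

lemma member_Cauchy:
  assumes "c \<in> completion_set \<theta>" "X \<in> c" "continuous_map \<theta> euclideanreal q" "is_seminorm q"
  shows "seminorm_Cauchy q X"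
  by (rule Cauchy_completion[OF completion_setE(2)[OF P assms(1,2)] assms(3,4)])

lemma null_seq:
  assumes "\<And>p. p \<in> P \<Longrightarrow> (\<lambda>n. p (Z n)) \<longlonglongrightarrow> 0" "continuous_map \<theta> euclideanreal q" "is_seminorm q"
  shows "(\<lambda>n. q (Z n)) \<longlonglongrightarrow> 0"
  using assms by (intro limitin_0_seminorm[of \<theta>]) (auto simp: limitin_0_seminorm_topology[OF P])

lemma member_diff:
  assumes "c \<in> completion_set \<theta>" "X \<in> c" "Y \<in> c" "continuous_map \<theta> euclideanreal q" "is_seminorm q"
  shows "(\<lambda>n. q (X n - Y n)) \<longlonglongrightarrow> 0"
  by (rule null_seq[OF completion_setE(3)[OF P assms(1-3)] assms(4,5)])

lemma class_in_completion:
  assumes "\<And>p. p \<in> P \<Longrightarrow> seminorm_Cauchy p X"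
  shows "cls X \<in> completion_set \<theta>" "X \<in> cls X"
  using completion_class[OF P assms] by auto

context
  fixes q assumes q: "continuous_map \<theta> euclideanreal q" "is_seminorm q"
begin

lemma seminorm_of_member:
  assumes "c \<in> completion_set \<theta>" "X \<in> c"
  shows "(\<lambda>n. q (X n)) \<longlonglongrightarrow> extended_seminorm q c"
proof -
  have rep: "representative c \<in> c" by (rule completion_setE(1)[OF P assms(1)])
  have 1: "(\<lambda>n. q (representative c n)) \<longlonglongrightarrow> extended_seminorm q c"
    unfolding extended_seminorm_def
    using seminorm_Cauchy_convergent[OF q(2) member_Cauchy[OF assms(1) rep q]] by (simp add: convergent_LIMSEQ_iff)
  have "\<bar>q (X n) - q (representative c n)\<bar> \<le> q (X n - representative c n)" for n
    using is_seminormD(3)[OF q(2), of "X n - representative c n" "representative c n"]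
      is_seminormD(3)[OF q(2), of "representative c n - X n" "X n"]
      is_seminormD(7)[OF q(2), of "X n" "representative c n"] by auto
  then have "(\<lambda>n. \<bar>q (X n) - q (representative c n)\<bar>) \<longlonglongrightarrow> 0"
    by (intro tendsto_sandwich[OF _ _ tendsto_const member_diff[OF assms rep q]]) auto
  then have "(\<lambda>n. q (X n) - q (representative c n)) \<longlonglongrightarrow> 0" by (simp add: tendsto_rabs_zero_iff)
  from tendsto_add[OF this 1] show ?thesis by simp
qed

lemma functional_of_member:
  assumes f: "linear f" "\<And>x. \<bar>f x\<bar> \<le> C * q x" and c: "c \<in> completion_set \<theta>" "X \<in> c"
  shows "(\<lambda>n. f (X n)) \<longlonglongrightarrow> extended_functional \<theta> f c"
proof -
  have rep: "representative c \<in> c" by (rule completion_setE(1)[OF P c(1)])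
  have 1: "(\<lambda>n. f (representative c n)) \<longlonglongrightarrow> extended_functional \<theta> f c"
    using bounded_linear_Cauchy[OF f q(2) member_Cauchy[OF c(1) rep q]] c(1)
    by (simp add: convergent_LIMSEQ_iff extended_functional_def)
  have "(\<lambda>n. f (X n - representative c n)) \<longlonglongrightarrow> 0"
  proof (rule Lim_null_comparison)
    show "\<forall>\<^sub>F n in sequentially. norm (f (X n - representative c n)) \<le> C * q (X n - representative c n)"
      unfolding real_norm_def by (intro always_eventually allI f(2))
    show "(\<lambda>n. C * q (X n - representative c n)) \<longlonglongrightarrow> 0"
      using tendsto_mult_left[OF member_diff[OF c rep q], of C] by simp
  qed
  then have "(\<lambda>n. f (X n) - f (representative c n)) \<longlonglongrightarrow> 0" by (simp add: linear_diff[OF f(1)])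
  from tendsto_add[OF this 1] show ?thesis by simp
qed

end

text \<open>\<open>vadd\<close> collects the classes of all sums of members. These classes coincide,
  so their union is a single class of the completion.\<close>

lemma add_member:
  assumes "c \<in> completion_set \<theta>" "d \<in> completion_set \<theta>"
  obtains X Y where "X \<in> c" "Y \<in> d" "vadd E c d \<in> completion_set \<theta>" "(\<lambda>n. X n + Y n) \<in> vadd E c d"
proof -
  let ?X = "representative c" and ?Y = "representative d"
  have XY: "?X \<in> c" "?Y \<in> d"
    using completion_setE(1)[OF P assms(1)] completion_setE(1)[OF P assms(2)] by simp_all
  have C: "seminorm_Cauchy p (\<lambda>n. X n + Y n)" if "X \<in> c" "Y \<in> d" "p \<in> P" for X Y p
    using that by (intro seminorm_Cauchy_add P completion_setE(2)[OF P assms(1)] completion_setE(2)[OF P assms(2)])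
  have "vadd E c d = cauchy_rel \<theta> `` {\<lambda>n. X n + Y n | X Y. X \<in> c \<and> Y \<in> d}" by (simp add: tvs_completion_def)
  also have "\<dots> = cls (\<lambda>n. ?X n + ?Y n)"
  proof
    show "cls (\<lambda>n. ?X n + ?Y n) \<subseteq> cauchy_rel \<theta> `` {\<lambda>n. X n + Y n | X Y. X \<in> c \<and> Y \<in> d}" using XY by blast
    show "cauchy_rel \<theta> `` {\<lambda>n. X n + Y n | X Y. X \<in> c \<and> Y \<in> d} \<subseteq> cls (\<lambda>n. ?X n + ?Y n)"
    proof
      fix W assume "W \<in> cauchy_rel \<theta> `` {\<lambda>n. X n + Y n | X Y. X \<in> c \<and> Y \<in> d}"
      then obtain X Y where W: "X \<in> c" "Y \<in> d" "(\<lambda>n. X n + Y n, W) \<in> cauchy_rel \<theta>" by blast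
      have "(\<lambda>n. p (?X n + ?Y n - W n)) \<longlonglongrightarrow> 0" if p: "p \<in> P" for p
      proof -
        note s = is_seminormD[OF P[OF p]]
        have 1: "(\<lambda>n. p (?X n - X n)) \<longlonglongrightarrow> 0" "(\<lambda>n. p (?Y n - Y n)) \<longlonglongrightarrow> 0" "(\<lambda>n. p (X n + Y n - W n)) \<longlonglongrightarrow> 0"
          using completion_setE(3)[OF P assms(1) XY(1) W(1) p] completion_setE(3)[OF P assms(2) XY(2) W(2) p] W(3) p
          by (auto simp: cauchy_rel_seminorm_topology[OF P])
        have "p (?X n + ?Y n - W n) \<le> (p (?X n - X n) + p (?Y n - Y n)) + p (X n + Y n - W n)" for n
          using s(3)[of "(?X n - X n) + (?Y n - Y n)" "X n + Y n - W n"] s(3)[of "?X n - X n" "?Y n - Y n"]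
          by (simp add: algebra_simps)
        then show ?thesis
          by (intro tendsto_sandwich[OF _ _ tendsto_const tendsto_add[OF tendsto_add[OF 1(1,2)] 1(3), simplified]])
            (auto simp: s(1))
      qed
      then show "W \<in> cls (\<lambda>n. ?X n + ?Y n)"
        using W(3) C[OF XY] by (auto simp: cauchy_rel_seminorm_topology[OF P])
    qed
  qed
  finally have eq: "vadd E c d = cls (\<lambda>n. ?X n + ?Y n)" .
  show thesis using class_in_completion[OF C[OF XY]] by (intro that[OF XY]) (simp_all only: eq)
qed

lemma scale_member:
  assumes "c \<in> completion_set \<theta>"
  obtains X where "X \<in> c" "vscale E r c \<in> completion_set \<theta>" "(\<lambda>n. r *\<^sub>R X n) \<in> vscale E r c"
proof -
  let ?X = "representative c"
  have X: "?X \<in> c" by (rule completion_setE(1)[OF P assms])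
  have C: "seminorm_Cauchy p (\<lambda>n. r *\<^sub>R X n)" if "X \<in> c" "p \<in> P" for X p
    using that by (intro seminorm_Cauchy_scale P completion_setE(2)[OF P assms])
  have "vscale E r c = cauchy_rel \<theta> `` {\<lambda>n. r *\<^sub>R X n | X. X \<in> c}" by (simp add: tvs_completion_def)
  also have "\<dots> = cls (\<lambda>n. r *\<^sub>R ?X n)"
  proof
    show "cls (\<lambda>n. r *\<^sub>R ?X n) \<subseteq> cauchy_rel \<theta> `` {\<lambda>n. r *\<^sub>R X n | X. X \<in> c}" using X by blast
    show "cauchy_rel \<theta> `` {\<lambda>n. r *\<^sub>R X n | X. X \<in> c} \<subseteq> cls (\<lambda>n. r *\<^sub>R ?X n)"
    proof
      fix W assume "W \<in> cauchy_rel \<theta> `` {\<lambda>n. r *\<^sub>R X n | X. X \<in> c}"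
      then obtain X where W: "X \<in> c" "(\<lambda>n. r *\<^sub>R X n, W) \<in> cauchy_rel \<theta>" by blast
      have "(\<lambda>n. p (r *\<^sub>R ?X n - W n)) \<longlonglongrightarrow> 0" if p: "p \<in> P" for p
      proof -
        note s = is_seminormD[OF P[OF p]]
        have 1: "(\<lambda>n. \<bar>r\<bar> * p (?X n - X n)) \<longlonglongrightarrow> \<bar>r\<bar> * 0"
          by (intro tendsto_mult_left completion_setE(3)[OF P assms X W(1) p])
        have 2: "(\<lambda>n. p (r *\<^sub>R X n - W n)) \<longlonglongrightarrow> 0"
          using W(2) p by (auto simp: cauchy_rel_seminorm_topology[OF P])
        have "p (r *\<^sub>R ?X n - W n) \<le> \<bar>r\<bar> * p (?X n - X n) + p (r *\<^sub>R X n - W n)" for n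
          using s(3)[of "r *\<^sub>R (?X n - X n)" "r *\<^sub>R X n - W n"] s(2)[of r "?X n - X n"]
          by (simp add: algebra_simps)
        then show ?thesis
          by (intro tendsto_sandwich[OF _ _ tendsto_const tendsto_add[OF 1 2, simplified]]) (auto simp: s(1))
      qed
      then show "W \<in> cls (\<lambda>n. r *\<^sub>R ?X n)"
        using W(2) C[OF X] by (auto simp: cauchy_rel_seminorm_topology[OF P])
    qed
  qed
  finally have eq: "vscale E r c = cls (\<lambda>n. r *\<^sub>R ?X n)" .
  show thesis using class_in_completion[OF C[OF X]] by (intro that[OF X]) (simp_all only: eq)
qed

lemma embed_member: "completion_embed \<theta> x \<in> completion_set \<theta>" "(\<lambda>_. x) \<in> completion_embed \<theta> x"
proof -
  have C: "seminorm_Cauchy p (\<lambda>_. x)" if "p \<in> P" for p using that by (intro seminorm_Cauchy_const P)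
  show "completion_embed \<theta> x \<in> completion_set \<theta>"
    unfolding completion_embed_def by (rule class_in_completion(1)) (rule C)
  show "(\<lambda>_. x) \<in> completion_embed \<theta> x"
    unfolding completion_embed_def by (rule class_in_completion(2)) (rule C)
qed

lemma vzero_E: "vzero E = completion_embed \<theta> 0"
  by (simp add: tvs_completion_def)

lemma tvs_base_E: "tvs_base E"
  unfolding tvs_base_def topspace_E vecs_E vzero_E
proof (intro conjI ballI)
  show "completion_embed \<theta> 0 \<in> completion_set \<theta>" by (rule embed_member)
  fix f assume f: "f \<in> dual E"
  let ?z = "completion_embed \<theta> 0"
  have "vscale E 0 ?z = ?z"
    using zero_scaled_members[OF P embed_member(1)[of 0]]
    by (simp add: tvs_completion_def completion_embed_def)
  moreover have "f (vscale E 0 ?z) = 0 * f ?z"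
    using f embed_member(1)[of 0] by (simp add: dual_def vecs_E)
  ultimately show "f ?z = 0" by simp
qed simp

text \<open>The topology of the completion is generated by balls of \<open>extended_dist\<close>.
  The representative of the zero class is merely a null sequence for \<open>q\<close>, but this is
  enough to identify the ball around that class with the unit set of the extended semi-norm.\<close>

lemma extended_seminorm_bounded:
  assumes q: "continuous_map \<theta> euclideanreal q" "is_seminorm q"
  shows "bounded_on_bounded E (extended_seminorm q)"
proof (rule bounded_on_boundedI)
  let ?z = "completion_embed \<theta> 0"
  have dist0: "extended_dist q ?z c = extended_seminorm q c" if c: "c \<in> completion_set \<theta>" for c
  proof -
    have rep: "representative c \<in> c" "representative ?z \<in> ?z"
      using completion_setE(1)[OF P c] completion_setE(1)[OF P embed_member(1)] by simp_all
    have z: "(\<lambda>n. q (representative ?z n)) \<longlonglongrightarrow> 0"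
      using member_diff[OF embed_member(1) rep(2) embed_member(2) q] by simp
    have rc: "(\<lambda>n. q (representative c n)) \<longlonglongrightarrow> extended_seminorm q c"
      by (rule seminorm_of_member[OF q c rep(1)])
    have "(\<lambda>n. q (representative c n - representative ?z n)) \<longlonglongrightarrow> extended_seminorm q c"
    proof (rule tendsto_sandwich)
      show "(\<lambda>n. q (representative c n) - q (representative ?z n)) \<longlonglongrightarrow> extended_seminorm q c"
        using tendsto_diff[OF rc z] by simp
      show "(\<lambda>n. q (representative c n) + q (representative ?z n)) \<longlonglongrightarrow> extended_seminorm q c"
        using tendsto_add[OF rc z] by simp
      show "\<forall>\<^sub>F n in sequentially. q (representative c n) - q (representative ?z n) \<le> q (representative c n - representative ?z n)"
        using is_seminormD(3)[OF q(2), of "x - y" y for x y] by (intro always_eventually allI) (simp add: algebra_simps)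
      show "\<forall>\<^sub>F n in sequentially. q (representative c n - representative ?z n) \<le> q (representative c n) + q (representative ?z n)"
        using is_seminormD(6)[OF q(2)] by (intro always_eventually allI)
    qed
    then show ?thesis unfolding extended_dist_def by (rule limI)
  qed
  show "openin (vtop E) {x \<in> vecs E. extended_seminorm q x < 1}"
  proof -
    have "{x \<in> vecs E. extended_seminorm q x < 1} = {d \<in> completion_set \<theta>. extended_dist q ?z d < 1}"
      by (auto simp: vecs_E dist0)
    also have "openin (vtop E) \<dots>"
      unfolding tvs_completion_def using q embed_member(1)
      by (simp, intro topology_generated_by_Basis) (auto intro!: exI[of _ q] exI[of _ ?z] exI[of _ 1])
    finally show ?thesis .
  qed
  show "extended_seminorm q (vzero E) < 1"
  proof -
    have "q 0 = extended_seminorm q ?z"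
      using tendsto_const seminorm_of_member[OF q embed_member] by (rule LIMSEQ_unique)
    then show ?thesis by (simp add: vzero_E is_seminormD(4)[OF q(2)])
  qed
  show "extended_seminorm q (vscale E r x) = r * extended_seminorm q x" if "x \<in> vecs E" "r > 0" for r x
  proof -
    have x: "x \<in> completion_set \<theta>" using that(1) by (simp add: vecs_E)
    obtain X where X: "X \<in> x" "vscale E r x \<in> completion_set \<theta>" "(\<lambda>n. r *\<^sub>R X n) \<in> vscale E r x"
      using scale_member[OF x] .
    have "(\<lambda>n. q (r *\<^sub>R X n)) \<longlonglongrightarrow> r * extended_seminorm q x"
      unfolding is_seminormD(2)[OF q(2)] using that(2) tendsto_mult_left[OF seminorm_of_member[OF q x X(1)], of r] by simp
    with seminorm_of_member[OF q X(2,3)] show ?thesis by (rule LIMSEQ_unique)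
  qed
qed (use tvs_base_E in \<open>auto simp: tvs_base_def\<close>)

context
  fixes q assumes q: "continuous_map \<theta> euclideanreal q" "is_seminorm q"
begin

lemma extended_functional_diff_le:
  assumes f: "linear f" "\<And>x. \<bar>f x\<bar> \<le> C * q x" and g: "linear g" "\<And>x. \<bar>g x\<bar> \<le> C' * q x"
    and le: "\<And>x. \<bar>g x - f x\<bar> \<le> \<epsilon> * r x" and r: "continuous_map \<theta> euclideanreal r" "is_seminorm r"
    and c: "c \<in> completion_set \<theta>"
  shows "\<bar>extended_functional \<theta> g c - extended_functional \<theta> f c\<bar> \<le> \<epsilon> * extended_seminorm r c"
proof (rule LIMSEQ_le)
  have rep: "representative c \<in> c" by (rule completion_setE(1)[OF P c])
  show "(\<lambda>n. \<bar>g (representative c n) - f (representative c n)\<bar>) \<longlonglongrightarrow>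
      \<bar>extended_functional \<theta> g c - extended_functional \<theta> f c\<bar>"
    by (intro tendsto_intros functional_of_member[OF q f c rep] functional_of_member[OF q g c rep])
  show "(\<lambda>n. \<epsilon> * r (representative c n)) \<longlonglongrightarrow> \<epsilon> * extended_seminorm r c"
    by (intro tendsto_mult_left seminorm_of_member[OF r c rep])
qed (use le in blast)

lemma extended_functional_in_dual:
  assumes f: "linear f" "\<And>x. \<bar>f x\<bar> \<le> C * q x"
  shows "extended_functional \<theta> f \<in> dual E"
  unfolding dual_def vecs_E
proof (intro CollectI conjI ballI allI)
  let ?J = "extended_functional \<theta> f"
  show "?J \<in> extensional (completion_set \<theta>)" by (simp add: extended_functional_def)
  show "?J (vadd E c d) = ?J c + ?J d" if c: "c \<in> completion_set \<theta>" "d \<in> completion_set \<theta>" for c d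
  proof -
    obtain X Y where XY: "X \<in> c" "Y \<in> d" "vadd E c d \<in> completion_set \<theta>" "(\<lambda>n. X n + Y n) \<in> vadd E c d"
      using add_member[OF c] .
    have "(\<lambda>n. f (X n + Y n)) \<longlonglongrightarrow> ?J c + ?J d"
      unfolding linear_add[OF f(1)] by (intro tendsto_add functional_of_member[OF q f c(1) XY(1)] functional_of_member[OF q f c(2) XY(2)])
    with functional_of_member[OF q f XY(3,4)] show ?thesis by (rule LIMSEQ_unique)
  qed
  show "?J (vscale E r c) = r * ?J c" if c: "c \<in> completion_set \<theta>" for r c
  proof -
    obtain X where X: "X \<in> c" "vscale E r c \<in> completion_set \<theta>" "(\<lambda>n. r *\<^sub>R X n) \<in> vscale E r c"
      using scale_member[OF c] .
    have "(\<lambda>n. f (r *\<^sub>R X n)) \<longlonglongrightarrow> r * ?J c"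
      unfolding linear_cmul[OF f(1)] using tendsto_mult_left[OF functional_of_member[OF q f c X(1)], of r] by simp
    with functional_of_member[OF q f X(2,3)] show ?thesis by (rule LIMSEQ_unique)
  qed
  show "continuous_map (vtop E) euclideanreal ?J"
  proof -
    have "openin (vtop E) {c \<in> completion_set \<theta>. ?J c \<in> U}" if U: "open U" for U
    proof (subst openin_subopen, intro ballI)
      fix c assume "c \<in> {c \<in> completion_set \<theta>. ?J c \<in> U}"
      then obtain e where c: "c \<in> completion_set \<theta>" and e: "e > 0" "\<And>t. \<bar>t - ?J c\<bar> < e \<Longrightarrow> t \<in> U"
        using U by (auto simp: open_dist dist_real_def)
      let ?W = "{d \<in> completion_set \<theta>. extended_dist q c d < e / (\<bar>C\<bar> + 1)}"
      have rc: "representative c \<in> c" by (rule completion_setE(1)[OF P c])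
      have "openin (vtop E) ?W"
        unfolding tvs_completion_def using q c e(1)
        by (simp, intro topology_generated_by_Basis) (auto intro!: exI[of _ q] exI[of _ c] exI[of _ "e / (\<bar>C\<bar> + 1)"])
      moreover have "c \<in> ?W"
        using c e(1) by (simp add: extended_dist_def is_seminormD(4)[OF q(2)])
      moreover have "?J d \<in> U" if d: "d \<in> completion_set \<theta>" and dist: "extended_dist q c d < e / (\<bar>C\<bar> + 1)" for d
      proof (rule e(2))
        have rd: "representative d \<in> d" by (rule completion_setE(1)[OF P d])
        have "seminorm_Cauchy q (\<lambda>n. representative d n + (-1) *\<^sub>R representative c n)"
          by (intro seminorm_Cauchy_add seminorm_Cauchy_scale q(2) member_Cauchy[OF d rd q] member_Cauchy[OF c rc q])
        then have lim: "(\<lambda>n. q (representative d n - representative c n)) \<longlonglongrightarrow> extended_dist q c d"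
          unfolding extended_dist_def using seminorm_Cauchy_convergent[OF q(2)] by (simp add: convergent_LIMSEQ_iff)
        have "\<bar>?J d - ?J c\<bar> \<le> (\<bar>C\<bar> + 1) * extended_dist q c d"
        proof (rule LIMSEQ_le)
          show "(\<lambda>n. \<bar>f (representative d n) - f (representative c n)\<bar>) \<longlonglongrightarrow> \<bar>?J d - ?J c\<bar>"
            by (intro tendsto_intros functional_of_member[OF q f d rd] functional_of_member[OF q f c rc])
          show "(\<lambda>n. (\<bar>C\<bar> + 1) * q (representative d n - representative c n)) \<longlonglongrightarrow> (\<bar>C\<bar> + 1) * extended_dist q c d"
            by (intro tendsto_mult_left lim)
          have "\<bar>f x - f y\<bar> \<le> (\<bar>C\<bar> + 1) * q (x - y)" for x y
          proof -
            have "\<bar>f x - f y\<bar> \<le> C * q (x - y)" using f(2)[of "x - y"] by (simp add: linear_diff[OF f(1)])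
            also have "\<dots> \<le> (\<bar>C\<bar> + 1) * q (x - y)" using is_seminormD(1)[OF q(2)] by (intro mult_right_mono) auto
            finally show ?thesis .
          qed
          then show "\<exists>N. \<forall>n\<ge>N. \<bar>f (representative d n) - f (representative c n)\<bar> \<le> (\<bar>C\<bar> + 1) * q (representative d n - representative c n)"
            by blast
        qed
        also have "\<dots> < e" using dist by (simp add: field_simps)
        finally show "\<bar>?J d - ?J c\<bar> < e" .
      qed
      ultimately show "\<exists>W. openin (vtop E) W \<and> c \<in> W \<and> W \<subseteq> {c \<in> completion_set \<theta>. ?J c \<in> U}"
        by (intro exI[of _ ?W]) auto
    qed
    then show ?thesis by (simp add: continuous_map_def topspace_E)
  qed
qed

lemma restrict_extended_functional:
  assumes f: "linear f" "\<And>x. \<bar>f x\<bar> \<le> C * q x"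
  shows "restrict_functional \<theta> (extended_functional \<theta> f) = f"
proof
  fix x
  have "f x = extended_functional \<theta> f (completion_embed \<theta> x)"
    using tendsto_const functional_of_member[OF q f embed_member] by (rule LIMSEQ_unique)
  then show "restrict_functional \<theta> (extended_functional \<theta> f) x = f x"
    by (simp add: restrict_functional_def)
qed

end

end

section \<open>Nuclear families of semi-norms\<close>

text \<open>The bilinear forms add up. This is why semi-norms are combined in the Euclidean way:
  their sum or maximum need not be Hilbertian.\<close>

lemma hilbertian_L2_set:
  assumes F: "\<And>p. p \<in> F \<Longrightarrow> hilbertian p"
  shows "hilbertian (\<lambda>x. L2_set (\<lambda>p. p x) F)"
  unfolding hilbertian_def
proof
  note s = is_seminormD[OF hilbertian_seminorm[OF F]]
  show "is_seminorm (\<lambda>x. L2_set (\<lambda>p. p x) F)"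
    unfolding is_seminorm_def
  proof (intro conjI allI)
    fix x y :: 'a and r :: real
    show "0 \<le> L2_set (\<lambda>p. p x) F" by (rule L2_set_nonneg)
    have "L2_set (\<lambda>p. p (r *\<^sub>R x)) F = L2_set (\<lambda>p. \<bar>r\<bar> * p x) F" using s(2) by (intro L2_set_cong) auto
    then show "L2_set (\<lambda>p. p (r *\<^sub>R x)) F = \<bar>r\<bar> * L2_set (\<lambda>p. p x) F" by (simp add: L2_set_right_distrib)
    have "L2_set (\<lambda>p. p (x + y)) F \<le> L2_set (\<lambda>p. p x + p y) F" using s(1,3) by (intro L2_set_mono) auto
    also have "\<dots> \<le> L2_set (\<lambda>p. p x) F + L2_set (\<lambda>p. p y) F" by (rule L2_set_triangle_ineq)
    finally show "L2_set (\<lambda>p. p (x + y)) F \<le> L2_set (\<lambda>p. p x) F + L2_set (\<lambda>p. p y) F" .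
  qed
  let ?Q = "\<lambda>x y. \<Sum>p\<in>F. hilbertian_form p x y"
  show "\<exists>Q. bilinear Q \<and> (\<forall>x y. Q x y = Q y x) \<and> (\<forall>x. 0 \<le> Q x x) \<and> (\<forall>x. (L2_set (\<lambda>p. p x) F)\<^sup>2 = Q x x)"
  proof (intro exI[of _ ?Q] conjI allI)
    show "bilinear ?Q"
      unfolding bilinear_def using hilbertian_form_linear[OF F]
      by (auto intro!: linear_compose_sum)
    show "?Q x y = ?Q y x" for x y using hilbertian_formD(2)[OF F] by (intro sum.cong) auto
    show "0 \<le> ?Q x x" for x using hilbertian_formD(3)[OF F] by (intro sum_nonneg) auto
    show "(L2_set (\<lambda>p. p x) F)\<^sup>2 = ?Q x x" for x
      using hilbertian_formD(3)[OF F] by (simp add: L2_set_def sum_nonneg)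
  qed
qed

locale nuclear_family =
  fixes P :: "('a::real_vector \<Rightarrow> real) set"
  assumes hilb: "\<And>p. p \<in> P \<Longrightarrow> hilbertian p"
    and hs: "\<And>p. p \<in> P \<Longrightarrow> \<exists>q\<in>P. (\<forall>x. p x \<le> q x) \<and> hs_bounded q p"
begin

abbreviation T :: "'a topology" where "T \<equiv> seminorm_topology P"

lemma P_seminorm: "p \<in> P \<Longrightarrow> is_seminorm p"
  by (intro hilbertian_seminorm hilb)

text \<open>A neighbourhood of 0 involves finitely many members of \<open>P\<close>, which need not
  have a common upper bound in \<open>P\<close>; this merges them into one continuous Hilbertian
  semi-norm.\<close>

definition Psum :: "('a \<Rightarrow> real) set \<Rightarrow> 'a \<Rightarrow> real" where
  "Psum F x = L2_set (\<lambda>p. p x) F"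

lemma Psum_hilbertian: "F \<subseteq> P \<Longrightarrow> hilbertian (Psum F)"
  unfolding Psum_def using hilb by (intro hilbertian_L2_set) auto

lemma Psum_seminorm: "F \<subseteq> P \<Longrightarrow> is_seminorm (Psum F)"
  by (intro hilbertian_seminorm Psum_hilbertian)

lemma Psum_nonneg: "0 \<le> Psum F x"
  by (simp add: Psum_def L2_set_nonneg)

lemma Psum_mono: "F \<subseteq> G \<Longrightarrow> finite G \<Longrightarrow> Psum F x \<le> Psum G x"
  unfolding Psum_def L2_set_def by (intro real_sqrt_le_mono sum_mono2) auto

lemma le_Psum:
  assumes "p \<in> F" "finite F" "F \<subseteq> P"
  shows "p x \<le> Psum F x"
proof -
  have "p x \<le> L2_set (\<lambda>p. p x) F"
    using assms by (intro member_le_L2_set)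
  then show ?thesis by (simp add: Psum_def)
qed

lemma Psum_continuous:
  assumes "F \<subseteq> P" "finite F"
  shows "continuous_map T euclideanreal (Psum F)"
proof -
  have "continuous_map T euclideanreal (\<lambda>x. \<Sum>p\<in>F. (p x)\<^sup>2)"
    using assms P_seminorm
    by (intro continuous_map_sum continuous_map_real_pow continuous_map_seminorm) auto
  then have "continuous_map T euclideanreal (sqrt \<circ> (\<lambda>x. \<Sum>p\<in>F. (p x)\<^sup>2))"
    by (rule continuous_map_compose) (simp add: continuous_on_real_sqrt continuous_on_id)
  moreover have "sqrt \<circ> (\<lambda>x. \<Sum>p\<in>F. (p x)\<^sup>2) = Psum F"
    by (auto simp: Psum_def L2_set_def)
  ultimately show ?thesis by simp
qed

text \<open>One Hilbert--Schmidt majorant is added for each member of \<open>F\<close>.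
  Contractivity for \<open>Psum G\<close> passes to each of them, so their constants add up.
  \<open>F\<close> is kept inside \<open>G\<close> to make the semi-norms increase.\<close>

lemma exists_hs_Psum:
  assumes F: "finite F" "F \<subseteq> P"
  obtains G where "finite G" "F \<subseteq> G" "G \<subseteq> P" "hs_bounded (Psum G) (Psum F)"
proof -
  have "\<forall>p\<in>F. \<exists>q. q \<in> P \<and> hs_bounded q p" using hs F(2) by blast
  then obtain g where g: "\<And>p. p \<in> F \<Longrightarrow> g p \<in> P" "\<And>p. p \<in> F \<Longrightarrow> hs_bounded (g p) p" by metis
  have "\<forall>p\<in>F. \<exists>K. \<forall>m x. contractive (g p) m x \<longrightarrow> (\<Sum>j<m. (p (x j))\<^sup>2) \<le> K"
    using g(2) by (simp add: hs_bounded_def)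
  then obtain K where K: "\<And>p m x. p \<in> F \<Longrightarrow> contractive (g p) m x \<Longrightarrow> (\<Sum>j<m. (p (x j))\<^sup>2) \<le> K p" by metis
  let ?G = "F \<union> g ` F"
  have G: "finite ?G" "?G \<subseteq> P" using F g(1) by auto
  have "(\<Sum>j<m. (Psum F (x j))\<^sup>2) \<le> (\<Sum>p\<in>F. K p)" if x: "contractive (Psum ?G) m x" for m x
  proof -
    have "(\<Sum>j<m. (Psum F (x j))\<^sup>2) = (\<Sum>j<m. \<Sum>p\<in>F. (p (x j))\<^sup>2)"
      by (simp add: Psum_def L2_set_def sum_nonneg)
    also have "\<dots> = (\<Sum>p\<in>F. \<Sum>j<m. (p (x j))\<^sup>2)" by (rule sum.swap)
    also have "\<dots> \<le> (\<Sum>p\<in>F. K p)"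
    proof (rule sum_mono)
      fix p assume p: "p \<in> F"
      have "contractive (g p) m x"
        using G p by (intro contractive_mono[OF x] le_Psum is_seminormD(1)[OF P_seminorm] g(1)) auto
      then show "(\<Sum>j<m. (p (x j))\<^sup>2) \<le> K p" by (rule K[OF p])
    qed
    finally show ?thesis .
  qed
  then have "hs_bounded (Psum ?G) (Psum F)" unfolding hs_bounded_def by blast
  then show thesis using that[of ?G] G by blast
qed

lemma T_nbhd:
  assumes "openin T U" "0 \<in> U"
  obtains F r where "finite F" "F \<subseteq> P" "r > 0" "\<And>x. Psum F x < r \<Longrightarrow> x \<in> U"
proof -
  obtain F r where F: "finite F" "F \<subseteq> P" "r > 0" "\<And>y. (\<forall>p\<in>F. p (y - 0) < r) \<Longrightarrow> y \<in> U"
    using openin_seminorm_topologyD[OF P_seminorm assms] by meson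
  have "x \<in> U" if "Psum F x < r" for x
    using F(4)[of x] le_Psum[OF _ F(1,2), of _ x] that by fastforce
  then show thesis using that F(1-3) by blast
qed

end

lemma nuclear_imp_family:
  assumes "nuclear T"
  obtains P where "nuclear_family P" "T = seminorm_topology P"
proof -
  obtain P where P: "\<And>p. p \<in> P \<Longrightarrow> hilbertian p" "T = seminorm_topology P"
    "\<And>p. p \<in> P \<Longrightarrow> \<exists>q\<in>P. (\<forall>x. p x \<le> q x) \<and> hilbert_schmidt q p (canonical_map p)"
    using assms unfolding nuclear_def by blast
  have "nuclear_family P"
  proof
    show "\<exists>q\<in>P. (\<forall>x. p x \<le> q x) \<and> hs_bounded q p" if "p \<in> P" for p
      using P(3)[OF that] P(1) that hilbert_schmidt_imp_hs_bounded by meson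
  qed (rule P(1))
  then show thesis using that P(2) by blast
qed

section \<open>Maximal inequalities for independent increments\<close>

abbreviation seq_space :: "(nat \<Rightarrow> real) measure" where
  "seq_space \<equiv> PiM UNIV (\<lambda>_. borel)"

text \<open>For the walk with steps \<open>z k\<close>, this is the distance between its positions
  at \<open>i\<close> and \<open>j\<close>, seen in the coordinates \<open>J\<close>. The state
  space of all real sequences accommodates every choice of \<open>J\<close>.\<close>

definition incr_norm :: "nat set \<Rightarrow> nat \<Rightarrow> nat \<Rightarrow> (nat \<Rightarrow> nat \<Rightarrow> real) \<Rightarrow> real" where
  "incr_norm J i j z = L2_set (\<lambda>l. \<Sum>k\<in>{i..<j}. z k l) J"

lemma incr_norm_cong: "(\<And>k. i \<le> k \<Longrightarrow> k < j \<Longrightarrow> z k = z' k) \<Longrightarrow> incr_norm J i j z = incr_norm J i j z'"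
  unfolding incr_norm_def by (intro arg_cong2[where f = L2_set] ext sum.cong) auto

lemma incr_norm_measurable [measurable]:
  assumes "{i..<j} \<subseteq> I"
  shows "incr_norm J i j \<in> borel_measurable (PiM I (\<lambda>_. seq_space))"
proof -
  have [measurable]: "(\<lambda>z. z k l) \<in> borel_measurable (PiM I (\<lambda>_. seq_space))" if "k \<in> {i..<j}" for k l
    using assms that by (intro measurable_compose[OF measurable_component_singleton[of k I] measurable_component_singleton]) auto
  show ?thesis unfolding incr_norm_def L2_set_def by measurable
qed

lemma incr_norm_triangle:
  assumes "i \<le> j" "j \<le> k"
  shows "incr_norm J i k z \<le> incr_norm J i j z + incr_norm J j k z"
    and "incr_norm J i j z \<le> incr_norm J i k z + incr_norm J j k z"
    and "incr_norm J j k z \<le> incr_norm J i j z + incr_norm J i k z"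
proof -
  have split: "(\<Sum>m\<in>{i..<k}. z m l) = (\<Sum>m\<in>{i..<j}. z m l) + (\<Sum>m\<in>{j..<k}. z m l)" for l
    using assms by (simp add: sum.atLeastLessThan_concat)
  have neg: "L2_set (\<lambda>l. - f l) J = L2_set f J" for f by (simp add: L2_set_def)
  show "incr_norm J i k z \<le> incr_norm J i j z + incr_norm J j k z"
    unfolding incr_norm_def split by (rule L2_set_triangle_ineq)
  show "incr_norm J i j z \<le> incr_norm J i k z + incr_norm J j k z"
    using L2_set_triangle_ineq[of "\<lambda>l. \<Sum>m\<in>{i..<k}. z m l" "\<lambda>l. - (\<Sum>m\<in>{j..<k}. z m l)" J]
    unfolding neg by (simp add: incr_norm_def split)
  show "incr_norm J j k z \<le> incr_norm J i j z + incr_norm J i k z"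
    using L2_set_triangle_ineq[of "\<lambda>l. - (\<Sum>m\<in>{i..<j}. z m l)" "\<lambda>l. \<Sum>m\<in>{i..<k}. z m l" J]
    unfolding neg by (simp add: incr_norm_def split)
qed

definition first_hit :: "(nat \<Rightarrow> 'z \<Rightarrow> bool) \<Rightarrow> nat \<Rightarrow> nat \<Rightarrow> 'z \<Rightarrow> bool" where
  "first_hit H a j z \<longleftrightarrow> H j z \<and> (\<forall>i\<in>{a..<j}. \<not> H i z)"

lemma first_hit_exists:
  assumes "H j z" "a \<le> j"
  obtains i where "a \<le> i" "i \<le> j" "first_hit H a i z"
proof -
  define i where "i = (LEAST i. a \<le> i \<and> H i z)"
  have "a \<le> i \<and> H i z" "i \<le> j"
    unfolding i_def using LeastI[of "\<lambda>i. a \<le> i \<and> H i z" j] Least_le[of "\<lambda>i. a \<le> i \<and> H i z" j] assms by auto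
  moreover have "\<not> H k z" if "k \<in> {a..<i}" for k
    using not_less_Least[of k "\<lambda>i. a \<le> i \<and> H i z"] that unfolding i_def by auto
  ultimately show thesis using that by (auto simp: first_hit_def)
qed

lemma first_hit_unique: "first_hit H a i z \<Longrightarrow> first_hit H a j z \<Longrightarrow> a \<le> i \<Longrightarrow> a \<le> j \<Longrightarrow> i = j"
  unfolding first_hit_def by (metis atLeastLessThan_iff linorder_neqE_nat)

section \<open>First-passage arguments for independent steps\<close>

locale indep_increments = prob_space +
  fixes Z :: "nat \<Rightarrow> 'a \<Rightarrow> nat \<Rightarrow> real" and n :: nat
  assumes indep: "indep_vars (\<lambda>_. seq_space) Z {..<n}"
begin

abbreviation path :: "'a \<Rightarrow> nat \<Rightarrow> nat \<Rightarrow> real" where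
  "path \<omega> \<equiv> \<lambda>k. Z k \<omega>"

lemma path_event:
  assumes "j \<le> n" "\<And>z z'. (\<And>k. i \<le> k \<Longrightarrow> k < j \<Longrightarrow> z k = z' k) \<Longrightarrow> P z = P z'"
    and "Measurable.pred (PiM {i..<j} (\<lambda>_. seq_space)) P"
  shows "{\<omega> \<in> space M. P (path \<omega>)} \<in> events"
proof -
  have "Z k \<in> M \<rightarrow>\<^sub>M seq_space" if "k < n" for k using indep that by (auto simp: indep_vars_def)
  then have [measurable]: "(\<lambda>\<omega>. \<lambda>k\<in>{i..<j}. Z k \<omega>) \<in> M \<rightarrow>\<^sub>M PiM {i..<j} (\<lambda>_. seq_space)"
    using assms(1) by (intro measurable_restrict) auto
  note [measurable] = assms(3)
  have "P (path \<omega>) = P (\<lambda>k\<in>{i..<j}. Z k \<omega>)" for \<omega> by (rule assms(2)) auto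
  then show ?thesis by simp
qed

lemma past_future_indep:
  assumes le: "a \<le> j" "j \<le> n"
    and P: "\<And>z z'. (\<And>k. a \<le> k \<Longrightarrow> k < j \<Longrightarrow> z k = z' k) \<Longrightarrow> P z = P z'"
      "Measurable.pred (PiM {a..<j} (\<lambda>_. seq_space)) P"
    and F: "\<And>z z'. (\<And>k. j \<le> k \<Longrightarrow> k < n \<Longrightarrow> z k = z' k) \<Longrightarrow> F z = F z'"
      "Measurable.pred (PiM {j..<n} (\<lambda>_. seq_space)) F"
  shows "prob {\<omega> \<in> space M. P (path \<omega>) \<and> F (path \<omega>)}
       = prob {\<omega> \<in> space M. P (path \<omega>)} * prob {\<omega> \<in> space M. F (path \<omega>)}"
proof -
  let ?S = "\<lambda>I. PiM I (\<lambda>_::nat. seq_space)"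
  have *: "indep_var (?S {a..<j}) (\<lambda>\<omega>. \<lambda>k\<in>{a..<j}. Z k \<omega>) (?S {j..<n}) (\<lambda>\<omega>. \<lambda>k\<in>{j..<n}. Z k \<omega>)"
    using le by (intro indep_var_restrict[OF indep]) auto
  let ?A = "{z \<in> space (?S {a..<j}). P z}" and ?B = "{z \<in> space (?S {j..<n}). F z}"
  have eq: "P (path \<omega>) = P (\<lambda>k\<in>{a..<j}. Z k \<omega>)" "F (path \<omega>) = F (\<lambda>k\<in>{j..<n}. Z k \<omega>)" for \<omega>
    by (rule P(1), simp) (rule F(1), simp)
  have sp: "(\<lambda>k\<in>I. Z k \<omega>) \<in> space (?S I)" for I \<omega>
    by (simp add: space_PiM)
  have "?A \<in> sets (?S {a..<j})" "?B \<in> sets (?S {j..<n})"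
    using P(2) F(2) by (simp_all add: pred_def)
  from indep_varD[OF * this] show ?thesis
    unfolding eq by (simp add: vimage_def Int_def sp conj_commute)
qed

text \<open>An event of the steps with index from \<open>a\<close> up to, but excluding,
  \<open>j\<close>. Measurability is asked on all larger index sets, so that events of shorter
  stretches can be combined; \<open>past j n\<close> describes the future after
  \<open>j\<close>.\<close>

definition past :: "nat \<Rightarrow> nat \<Rightarrow> ((nat \<Rightarrow> nat \<Rightarrow> real) \<Rightarrow> bool) \<Rightarrow> bool" where
  "past a j P \<longleftrightarrow> (\<forall>z z'. (\<forall>k. a \<le> k \<and> k < j \<longrightarrow> z k = z' k) \<longrightarrow> P z = P z') \<and>
     (\<forall>I. {a..<j} \<subseteq> I \<longrightarrow> Measurable.pred (PiM I (\<lambda>_. seq_space)) P)"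

lemma pastI:
  assumes "\<And>z z'. (\<And>k. a \<le> k \<Longrightarrow> k < j \<Longrightarrow> z k = z' k) \<Longrightarrow> P z = P z'"
    and "\<And>I. {a..<j} \<subseteq> I \<Longrightarrow> Measurable.pred (PiM I (\<lambda>_. seq_space)) P"
  shows "past a j P"
  unfolding past_def using assms by blast

lemma pastD:
  assumes "past a j P"
  shows "(\<And>k. a \<le> k \<Longrightarrow> k < j \<Longrightarrow> z k = z' k) \<Longrightarrow> P z = P z'"
    and "{a..<j} \<subseteq> I \<Longrightarrow> Measurable.pred (PiM I (\<lambda>_. seq_space)) P"
  using assms unfolding past_def by blast+

lemma past_event:
  assumes "past a j P" "j \<le> n"
  shows "{\<omega> \<in> space M. P (path \<omega>)} \<in> events"
  by (rule path_event[OF assms(2) pastD(1)[OF assms(1)] pastD(2)[OF assms(1) order_refl]])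

lemma past_future_prob:
  assumes "a \<le> j" "j \<le> n" "past a j P" "past j n F"
  shows "prob {\<omega> \<in> space M. P (path \<omega>) \<and> F (path \<omega>)}
       = prob {\<omega> \<in> space M. P (path \<omega>)} * prob {\<omega> \<in> space M. F (path \<omega>)}"
  by (rule past_future_indep[OF assms(1,2) pastD(1)[OF assms(3)] pastD(2)[OF assms(3) order_refl]
        pastD(1)[OF assms(4)] pastD(2)[OF assms(4) order_refl]])

lemma past_mono:
  assumes "past a j P" "i \<le> a" "j \<le> k"
  shows "past i k P"
proof (rule pastI)
  show "P z = P z'" if "\<And>l. i \<le> l \<Longrightarrow> l < k \<Longrightarrow> z l = z' l" for z z'
    using assms(2,3) by (intro pastD(1)[OF assms(1)] that) auto
  show "Measurable.pred (PiM I (\<lambda>_. seq_space)) P" if "{i..<k} \<subseteq> I" for I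
    using assms(2,3) that by (intro pastD(2)[OF assms(1)]) auto
qed

lemma past_True: "past a j (\<lambda>_. True)"
  by (rule pastI) auto

lemma past_conj:
  assumes "past a j P" "past a j Q"
  shows "past a j (\<lambda>z. P z \<and> Q z)"
proof (rule pastI)
  show "(P z \<and> Q z) = (P z' \<and> Q z')" if "\<And>l. a \<le> l \<Longrightarrow> l < j \<Longrightarrow> z l = z' l" for z z'
    using pastD(1)[OF assms(1) that] pastD(1)[OF assms(2) that] by simp
  show "Measurable.pred (PiM I (\<lambda>_. seq_space)) (\<lambda>z. P z \<and> Q z)" if "{a..<j} \<subseteq> I" for I
    by (intro pred_intros_logic pastD(2)[OF assms(1) that] pastD(2)[OF assms(2) that])
qed

lemma past_not:
  assumes "past a j P"
  shows "past a j (\<lambda>z. \<not> P z)"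
proof (rule pastI)
  show "(\<not> P z) = (\<not> P z')" if "\<And>l. a \<le> l \<Longrightarrow> l < j \<Longrightarrow> z l = z' l" for z z'
    using pastD(1)[OF assms that] by simp
  show "Measurable.pred (PiM I (\<lambda>_. seq_space)) (\<lambda>z. \<not> P z)" if "{a..<j} \<subseteq> I" for I
    by (intro pred_intros_logic pastD(2)[OF assms that])
qed

lemma past_Ball: "finite I \<Longrightarrow> (\<And>i. i \<in> I \<Longrightarrow> past a j (P i)) \<Longrightarrow> past a j (\<lambda>z. \<forall>i\<in>I. P i z)"
  by (induction I rule: finite_induct) (auto simp: past_True intro!: past_conj)

lemma past_Bex:
  assumes "finite I" "\<And>i. i \<in> I \<Longrightarrow> past a j (P i)"
  shows "past a j (\<lambda>z. \<exists>i\<in>I. P i z)"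
proof -
  have "past a j (\<lambda>z. \<not> (\<forall>i\<in>I. \<not> P i z))" using assms by (intro past_not past_Ball)
  then show ?thesis by simp
qed

lemma past_incr_norm:
  assumes "a \<le> i" "j \<le> b"
  shows "past a b (\<lambda>z. c \<le> incr_norm J i j z)"
proof (rule pastI)
  show "(c \<le> incr_norm J i j z) = (c \<le> incr_norm J i j z')"
    if "\<And>k. a \<le> k \<Longrightarrow> k < b \<Longrightarrow> z k = z' k" for z z'
    using that assms incr_norm_cong[of i j z z' J] by auto
  show "Measurable.pred (PiM I (\<lambda>_. seq_space)) (\<lambda>z. c \<le> incr_norm J i j z)" if "{a..<b} \<subseteq> I" for I
    unfolding pred_def using that assms by (intro borel_measurable_le incr_norm_measurable) auto
qed

lemma past_first_hit:
  assumes "\<And>i. a \<le> i \<Longrightarrow> i \<le> j \<Longrightarrow> past a i (H i)" "a \<le> j"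
  shows "past a j (first_hit H a j)"
  unfolding first_hit_def using assms
  by (intro past_conj past_Ball past_not) (auto intro: past_mono[OF assms(1) order_refl])

text \<open>First passages at different times are disjoint. A first passage at \<open>j\<close>
  depends on the steps before \<open>j\<close> and \<open>F j\<close> on the later ones, so each
  probability factorizes.\<close>

lemma first_hit_prob:
  assumes H: "\<And>i. a \<le> i \<Longrightarrow> i \<le> n \<Longrightarrow> past a i (H i)"
    and F: "\<And>i. a \<le> i \<Longrightarrow> i \<le> n \<Longrightarrow> past i n (F i)"
  shows "prob {\<omega> \<in> space M. \<exists>j\<in>{a..n}. first_hit H a j (path \<omega>) \<and> F j (path \<omega>)}
    = (\<Sum>j\<in>{a..n}. prob {\<omega> \<in> space M. first_hit H a j (path \<omega>)} * prob {\<omega> \<in> space M. F j (path \<omega>)})"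
proof -
  have fh: "past a j (first_hit H a j)" if "a \<le> j" "j \<le> n" for j
    using H that by (intro past_first_hit) auto
  define E where "E j = {\<omega> \<in> space M. first_hit H a j (path \<omega>) \<and> F j (path \<omega>)}" for j
  have ev: "E j \<in> events" if "j \<in> {a..n}" for j
    unfolding E_def using that fh past_mono[OF F[of j], of a n]
    by (intro past_event[of a n] past_conj) (auto intro: past_mono[of a j _ a n])
  have "{\<omega> \<in> space M. \<exists>j\<in>{a..n}. first_hit H a j (path \<omega>) \<and> F j (path \<omega>)} = (\<Union>j\<in>{a..n}. E j)"
    by (auto simp: E_def)
  also have "prob \<dots> = (\<Sum>j\<in>{a..n}. prob (E j))"
    using ev by (intro finite_measure_finite_Union)
      (auto simp: disjoint_family_on_def E_def dest: first_hit_unique)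
  also have "\<dots> = (\<Sum>j\<in>{a..n}. prob {\<omega> \<in> space M. first_hit H a j (path \<omega>)} * prob {\<omega> \<in> space M. F j (path \<omega>)})"
    unfolding E_def using fh F by (intro sum.cong refl past_future_prob) auto
  finally show ?thesis .
qed

lemma hit_prob:
  assumes H: "\<And>i. a \<le> i \<Longrightarrow> i \<le> n \<Longrightarrow> past a i (H i)"
  shows "prob {\<omega> \<in> space M. \<exists>j\<in>{a..n}. H j (path \<omega>)}
    = (\<Sum>j\<in>{a..n}. prob {\<omega> \<in> space M. first_hit H a j (path \<omega>)})"
proof -
  have "(\<exists>j\<in>{a..n}. H j z) \<longleftrightarrow> (\<exists>j\<in>{a..n}. first_hit H a j z)" for z
    by (smt (verit) atLeastAtMost_iff first_hit_def first_hit_exists order_trans)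
  then show ?thesis
    using first_hit_prob[OF H, where F = "\<lambda>_ _. True"] past_True by (simp add: prob_space)
qed

text \<open>After the first passage of \<open>2 * c\<close>, the rest of the walk moves by less than
  \<open>c\<close> with probability at least \<open>1 - \<alpha>\<close>, and then the total
  increment is still at least \<open>c\<close>. For the passage probability \<open>h\<close> this
  gives \<open>(1 - \<alpha>) * h \<le> \<alpha>\<close>.\<close>

lemma ottaviani:
  assumes small: "\<And>i j. a \<le> i \<Longrightarrow> i \<le> j \<Longrightarrow> j \<le> n \<Longrightarrow> prob {\<omega> \<in> space M. c \<le> incr_norm J i j (path \<omega>)} \<le> \<alpha>"
    and \<alpha>: "\<alpha> \<le> 1 / 2" and an: "a \<le> n"
  shows "prob {\<omega> \<in> space M. \<exists>j\<in>{a..n}. 2 * c \<le> incr_norm J a j (path \<omega>)} \<le> 2 * \<alpha>"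
proof -
  define H where "H j z \<longleftrightarrow> 2 * c \<le> incr_norm J a j z" for j z
  define F where "F j z \<longleftrightarrow> \<not> c \<le> incr_norm J j n z" for j z
  have H: "past a i (H i)" if "a \<le> i" for i unfolding H_def by (rule past_incr_norm) auto
  have F: "past i n (F i)" for i unfolding F_def by (intro past_not past_incr_norm) auto
  define h where "h = prob {\<omega> \<in> space M. \<exists>j\<in>{a..n}. H j (path \<omega>)}"
  have "1 - \<alpha> \<le> prob {\<omega> \<in> space M. F j (path \<omega>)}" if "j \<in> {a..n}" for j
  proof -
    have "{\<omega> \<in> space M. F j (path \<omega>)} = space M - {\<omega> \<in> space M. c \<le> incr_norm J j n (path \<omega>)}"
      by (auto simp: F_def)
    moreover have "{\<omega> \<in> space M. c \<le> incr_norm J j n (path \<omega>)} \<in> events"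
      by (intro past_event[of j n] past_incr_norm) auto
    ultimately show ?thesis using small[of j n] that by (simp add: prob_compl)
  qed
  moreover have "h = (\<Sum>j\<in>{a..n}. prob {\<omega> \<in> space M. first_hit H a j (path \<omega>)})"
    unfolding h_def using H by (intro hit_prob) auto
  ultimately have "(1 - \<alpha>) * h \<le> (\<Sum>j\<in>{a..n}. prob {\<omega> \<in> space M. first_hit H a j (path \<omega>)} * prob {\<omega> \<in> space M. F j (path \<omega>)})"
    by (simp only: sum_distrib_left) (intro sum_mono, subst mult.commute, intro mult_left_mono, auto)
  also have "\<dots> = prob {\<omega> \<in> space M. \<exists>j\<in>{a..n}. first_hit H a j (path \<omega>) \<and> F j (path \<omega>)}"
    using H F by (intro first_hit_prob[symmetric]) auto
  also have "\<dots> \<le> prob {\<omega> \<in> space M. c \<le> incr_norm J a n (path \<omega>)}"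
  proof (rule finite_measure_mono)
    show "{\<omega> \<in> space M. c \<le> incr_norm J a n (path \<omega>)} \<in> events"
      by (intro past_event[of a n] past_incr_norm) auto
    show "{\<omega> \<in> space M. \<exists>j\<in>{a..n}. first_hit H a j (path \<omega>) \<and> F j (path \<omega>)}
        \<subseteq> {\<omega> \<in> space M. c \<le> incr_norm J a n (path \<omega>)}"
    proof clarsimp
      fix \<omega> j assume "first_hit H a j (path \<omega>)" "F j (path \<omega>)" "a \<le> j" "j \<le> n"
      then show "c \<le> incr_norm J a n (path \<omega>)"
        using incr_norm_triangle(2)[of a j n J "path \<omega>"] by (simp add: first_hit_def H_def F_def)
    qed
  qed
  also have "\<dots> \<le> \<alpha>" using an by (intro small) auto
  finally have "(1 - \<alpha>) * h \<le> \<alpha>" .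
  moreover have "1 / 2 * h \<le> (1 - \<alpha>) * h" using \<alpha> by (intro mult_right_mono) (auto simp: h_def)
  ultimately show ?thesis by (simp add: h_def H_def)
qed

end

text \<open>Oscillations are counted over consecutive intervals, so that the first-passage
  decomposition splits them off one at a time.\<close>

fun oscillates :: "nat set \<Rightarrow> real \<Rightarrow> nat \<Rightarrow> nat \<Rightarrow> nat \<Rightarrow> (nat \<Rightarrow> nat \<Rightarrow> real) \<Rightarrow> bool" where
  "oscillates J c 0 a n z = True"
| "oscillates J c (Suc k) a n z = (\<exists>j\<in>{a..n}. (\<exists>i\<in>{a..j}. c \<le> incr_norm J i j z) \<and> oscillates J c k j n z)"

lemma oscillates_antimono:
  "oscillates J c k b n z \<Longrightarrow> a \<le> b \<Longrightarrow> oscillates J c k a n z"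
  by (cases k) (fastforce)+

context indep_increments begin

lemma past_oscillates: "a \<le> n \<Longrightarrow> past a n (oscillates J c k a n)"
proof (induction k arbitrary: a)
  case 0
  then show ?case by (simp add: past_True)
next
  case (Suc k)
  have "past a n (\<lambda>z. \<exists>j\<in>{a..n}. (\<exists>i\<in>{a..j}. c \<le> incr_norm J i j z) \<and> oscillates J c k j n z)"
    using Suc by (intro past_Bex past_conj past_incr_norm) (auto intro: past_mono)
  then show ?case by simp
qed

text \<open>An increment of size \<open>4 * c\<close> between \<open>i\<close> and \<open>j\<close>
  forces distance at least \<open>2 * c\<close> from the start at \<open>i\<close> or at
  \<open>j\<close>, which by Ottaviani's inequality has probability at most
  \<open>2 * \<alpha>\<close>. When the first such oscillation is completed, the walk starts afresh.
  Replacing a later completion by the first one loses none of the remaining oscillations, by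
  \<open>oscillates_antimono\<close>.\<close>

lemma oscillation_bound:
  assumes small: "\<And>i j. a \<le> i \<Longrightarrow> i \<le> j \<Longrightarrow> j \<le> n \<Longrightarrow> prob {\<omega> \<in> space M. c \<le> incr_norm J i j (path \<omega>)} \<le> \<alpha>"
    and \<alpha>: "0 \<le> \<alpha>" "\<alpha> \<le> 1 / 2" and an: "a \<le> n"
  shows "prob {\<omega> \<in> space M. oscillates J (4 * c) k a n (path \<omega>)} \<le> (2 * \<alpha>) ^ k"
  using small an
proof (induction k arbitrary: a)
  case 0
  then show ?case by simp
next
  case (Suc k)
  define H where "H j z \<longleftrightarrow> (\<exists>i\<in>{a..j}. 4 * c \<le> incr_norm J i j z)" for j z
  define F where "F j z \<longleftrightarrow> oscillates J (4 * c) k j n z" for j z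
  have H: "past a i (H i)" if "a \<le> i" for i
    unfolding H_def by (intro past_Bex past_incr_norm) auto
  have F: "past i n (F i)" if "i \<le> n" for i unfolding F_def using that by (rule past_oscillates)
  have "{\<omega> \<in> space M. oscillates J (4 * c) (Suc k) a n (path \<omega>)}
     = {\<omega> \<in> space M. \<exists>j\<in>{a..n}. first_hit H a j (path \<omega>) \<and> F j (path \<omega>)}"
  proof -
    have "oscillates J (4 * c) (Suc k) a n z \<longleftrightarrow> (\<exists>j\<in>{a..n}. first_hit H a j z \<and> F j z)" for z
    proof
      assume "oscillates J (4 * c) (Suc k) a n z"
      then have "\<exists>j\<in>{a..n}. H j z \<and> F j z" by (simp add: H_def F_def)
      then obtain j where j: "a \<le> j" "j \<le> n" "H j z" "F j z" by auto
      obtain i where "a \<le> i" "i \<le> j" "first_hit H a i z" using first_hit_exists[of H j z a] j by blast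
      then show "\<exists>j\<in>{a..n}. first_hit H a j z \<and> F j z"
        using j oscillates_antimono unfolding F_def by (intro bexI[of _ i]) auto
    qed (auto simp: first_hit_def H_def F_def)
    then show ?thesis by simp
  qed
  also have "prob \<dots> = (\<Sum>j\<in>{a..n}. prob {\<omega> \<in> space M. first_hit H a j (path \<omega>)} * prob {\<omega> \<in> space M. F j (path \<omega>)})"
    using H F by (intro first_hit_prob) auto
  also have "\<dots> \<le> (\<Sum>j\<in>{a..n}. prob {\<omega> \<in> space M. first_hit H a j (path \<omega>)} * (2 * \<alpha>) ^ k)"
    unfolding F_def using Suc.prems by (intro sum_mono mult_left_mono Suc.IH) auto
  also have "\<dots> = prob {\<omega> \<in> space M. \<exists>j\<in>{a..n}. H j (path \<omega>)} * (2 * \<alpha>) ^ k"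
    using H by (subst hit_prob) (auto simp: sum_distrib_right)
  also have "prob {\<omega> \<in> space M. \<exists>j\<in>{a..n}. H j (path \<omega>)} \<le> prob {\<omega> \<in> space M. \<exists>j\<in>{a..n}. 2 * c \<le> incr_norm J a j (path \<omega>)}"
  proof (rule finite_measure_mono)
    show "{\<omega> \<in> space M. \<exists>j\<in>{a..n}. 2 * c \<le> incr_norm J a j (path \<omega>)} \<in> events"
      by (intro past_event[of a n] past_Bex past_incr_norm) auto
    show "{\<omega> \<in> space M. \<exists>j\<in>{a..n}. H j (path \<omega>)} \<subseteq> {\<omega> \<in> space M. \<exists>j\<in>{a..n}. 2 * c \<le> incr_norm J a j (path \<omega>)}"
    proof clarsimp
      fix \<omega> j assume "H j (path \<omega>)" and j: "a \<le> j" "j \<le> n"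
      then obtain i where i: "a \<le> i" "i \<le> j" "4 * c \<le> incr_norm J i j (path \<omega>)" by (auto simp: H_def)
      then have "2 * c \<le> incr_norm J a i (path \<omega>) \<or> 2 * c \<le> incr_norm J a j (path \<omega>)"
        using incr_norm_triangle(3)[of a i j J "path \<omega>"] by linarith
      then show "\<exists>j\<in>{a..n}. 2 * c \<le> incr_norm J a j (path \<omega>)" using i j by auto
    qed
  qed
  also have "\<dots> \<le> 2 * \<alpha>" using Suc.prems \<alpha> by (intro ottaviani) auto
  finally show ?case using \<alpha> by (simp add: mult_right_mono)
qed

end

section \<open>Levy processes in the dual\<close>

lemma space_borel_of [simp]: "space (borel_of S) = topspace S"
  unfolding borel_of_def by (rule space_measure_of) (auto dest: openin_subset)

lemma sets_borel_of: "sets (borel_of S) = sigma_sets (topspace S) {U. openin S U}"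
  unfolding borel_of_def by (rule sets_measure_of) (auto dest: openin_subset)

lemma borel_of_open: "openin S U \<Longrightarrow> U \<in> sets (borel_of S)"
  by (simp add: sets_borel_of sigma_sets.Basic)

lemma continuous_map_borel_of:
  assumes "continuous_map S euclideanreal f"
  shows "f \<in> borel_measurable (borel_of S)"
proof (rule borel_measurableI)
  fix U :: "real set" assume "open U"
  then have "openin S {x \<in> topspace S. f x \<in> U}" using assms by (simp add: continuous_map_def)
  moreover have "f -` U \<inter> space (borel_of S) = {x \<in> topspace S. f x \<in> U}" by auto
  ultimately show "f -` U \<inter> space (borel_of S) \<in> sets (borel_of S)" by (simp add: borel_of_open)
qed

text \<open>A compact subset of nearly full measure is covered by finitely many of the open sets.
  This takes the place of countable additivity for uncountable unions.\<close>

lemma radon_finite_subcover: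
  assumes \<mu>: "\<mu> \<in> radon_prob S" and V: "\<And>i. i \<in> I \<Longrightarrow> openin S (V i)" and \<epsilon>: "\<epsilon> > 0"
  shows "\<exists>J. finite J \<and> J \<subseteq> I \<and> measure \<mu> ((\<Union>i\<in>I. V i) - (\<Union>i\<in>J. V i)) < \<epsilon>"
proof -
  let ?U = "\<Union>i\<in>I. V i"
  have sets: "sets \<mu> = sets (borel_of S)" and "prob_space \<mu>" using \<mu> by (auto simp: radon_prob_def)
  interpret \<mu>: prob_space \<mu> by fact
  have U: "?U \<in> sets \<mu>" unfolding sets using V by (intro borel_of_open openin_Union) auto
  then obtain K where K: "K \<in> sets \<mu>" "K \<subseteq> ?U" "compactin S K" "measure \<mu> (?U - K) < \<epsilon>"
    using \<mu> \<epsilon> unfolding radon_prob_def by blast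
  obtain \<F> where "finite \<F>" "\<F> \<subseteq> V ` I" "K \<subseteq> \<Union>\<F>"
    using K(2,3) V unfolding compactin_def by (metis (no_types, lifting) image_iff)
  then obtain J where J: "finite J" "J \<subseteq> I" "K \<subseteq> (\<Union>i\<in>J. V i)"
    by (metis finite_subset_image)
  have "(\<Union>i\<in>J. V i) \<in> sets \<mu>" unfolding sets using V J(2) by (intro borel_of_open openin_Union) auto
  then have "measure \<mu> (?U - (\<Union>i\<in>J. V i)) \<le> measure \<mu> (?U - K)"
    using J(3) U K(1) by (intro \<mu>.finite_measure_mono) auto
  then show ?thesis using J K(4) by (intro exI[of _ J]) auto
qed

text \<open>The count of \<open>oscillates\<close> for a real path observed at the times in
  \<open>A\<close>; with the set of times as a parameter, grids can be refined while the path stays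
  the same.\<close>

fun oscs :: "real set \<Rightarrow> (real \<Rightarrow> real) \<Rightarrow> real \<Rightarrow> nat \<Rightarrow> real \<Rightarrow> bool" where
  "oscs A x c 0 a = True"
| "oscs A x c (Suc k) a = (\<exists>t\<in>A. (\<exists>s\<in>A. a \<le> s \<and> s \<le> t \<and> c \<le> \<bar>x t - x s\<bar>) \<and> oscs A x c k t)"

lemma oscs_SucI:
  "s \<in> A \<Longrightarrow> t \<in> A \<Longrightarrow> a \<le> s \<Longrightarrow> s \<le> t \<Longrightarrow> c \<le> \<bar>x t - x s\<bar> \<Longrightarrow> oscs A x c k t \<Longrightarrow> oscs A x c (Suc k) a"
  by (simp, rule bexI[of _ t], rule conjI, rule bexI[of _ s]) auto

lemma oscs_antimono:
  assumes "oscs A x c k b" "a \<le> b"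
  shows "oscs A x c k a"
proof (cases k)
  case (Suc m)
  then obtain s t where st: "s \<in> A" "t \<in> A" "b \<le> s" "s \<le> t" "c \<le> \<bar>x t - x s\<bar>" "oscs A x c m t"
    using assms(1) by auto
  show ?thesis unfolding Suc using st assms(2) by (intro oscs_SucI[OF st(1,2) _ st(4-6)]) auto
qed simp

lemma oscs_mono: "oscs A x c k a \<Longrightarrow> A \<subseteq> B \<Longrightarrow> oscs B x c k a"
  by (induction k arbitrary: a) (simp, fastforce)

text \<open>A given number of oscillations involves finitely many times, and these lie in one member
  of the increasing sequence.\<close>

lemma oscs_Union:
  fixes A :: "nat \<Rightarrow> real set"
  assumes "incseq A"
  shows "oscs (\<Union>l. A l) x c k a \<Longrightarrow> \<exists>l. oscs (A l) x c k a"
proof (induction k arbitrary: a)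
  case 0
  then show ?case by simp
next
  case (Suc k)
  then obtain s t l1 l2 where st: "s \<in> A l1" "t \<in> A l2" "a \<le> s" "s \<le> t" "c \<le> \<bar>x t - x s\<bar>" "oscs (\<Union>l. A l) x c k t"
    by auto
  obtain l3 where l3: "oscs (A l3) x c k t" using Suc.IH[OF st(6)] by blast
  let ?l = "max l1 (max l2 l3)"
  have "A l1 \<subseteq> A ?l" "A l2 \<subseteq> A ?l" "A l3 \<subseteq> A ?l" by (simp_all add: incseqD[OF assms])
  then have "oscs (A ?l) x c (Suc k) a" using st(1-5) oscs_mono[OF l3] by (intro oscs_SucI[of s _ t]) auto
  then show ?case by blast
qed

text \<open>Where the Cauchy condition to the right of \<open>t\<close> fails, pairs with an
  increment of size \<open>c\<close> exist arbitrarily close to \<open>t\<close>. They are stacked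
  backwards in time: each new pair is placed between \<open>t\<close> and the oscillations already
  found.\<close>

lemma oscs_right:
  assumes bad: "\<And>\<delta>. \<delta> > 0 \<Longrightarrow> \<exists>s\<in>A. \<exists>u\<in>A. t < s \<and> s \<le> u \<and> u < t + \<delta> \<and> c \<le> \<bar>x u - x s\<bar>"
    and b: "t < b" and a: "a \<le> t"
  shows "oscs (A \<inter> {..b}) x c k a"
proof -
  have "\<exists>s. t < s \<and> s < t + \<delta> \<and> oscs (A \<inter> {..b}) x c k s" if "\<delta> > 0" for \<delta>
    using that
  proof (induction k arbitrary: \<delta>)
    case 0
    then show ?case by (intro exI[of _ "t + \<delta> / 2"]) auto
  next
    case (Suc k)
    obtain v where v: "t < v" "v < t + min \<delta> (b - t)" "oscs (A \<inter> {..b}) x c k v"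
      using Suc.IH[of "min \<delta> (b - t)"] Suc.prems b by auto
    obtain s u where su: "s \<in> A" "u \<in> A" "t < s" "s \<le> u" "u < t + (v - t)" "c \<le> \<bar>x u - x s\<bar>"
      using bad[of "v - t"] v(1) by auto
    have "oscs (A \<inter> {..b}) x c k u" using v(3) su(5) by (intro oscs_antimono[OF v(3)]) auto
    then have "oscs (A \<inter> {..b}) x c (Suc k) s" using su v(2) by (intro oscs_SucI[of s _ u]) auto
    then show ?case using su v by (intro exI[of _ s]) auto
  qed
  from this[of 1] show ?thesis using a oscs_antimono by fastforce
qed

text \<open>The pairs now approach \<open>t\<close> forwards in time: the remaining oscillations are
  placed between the first pair and \<open>t\<close>.\<close>

lemma oscs_left:
  assumes bad: "\<And>\<delta>. \<delta> > 0 \<Longrightarrow> \<exists>s\<in>A. \<exists>u\<in>A. t - \<delta> < s \<and> s \<le> u \<and> u < t \<and> c \<le> \<bar>x u - x s\<bar>"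
    and b: "t \<le> b" and a: "a < t"
  shows "oscs (A \<inter> {..b}) x c k a"
proof -
  have "\<exists>s. t - \<delta> < s \<and> s < t \<and> oscs (A \<inter> {..b}) x c k s" if "\<delta> > 0" for \<delta>
    using that
  proof (induction k arbitrary: \<delta>)
    case 0
    then show ?case by (intro exI[of _ "t - \<delta> / 2"]) auto
  next
    case (Suc k)
    obtain s u where su: "s \<in> A" "u \<in> A" "t - \<delta> < s" "s \<le> u" "u < t" "c \<le> \<bar>x u - x s\<bar>"
      using bad[of \<delta>] Suc.prems by auto
    obtain v where v: "t - (t - u) < v" "v < t" "oscs (A \<inter> {..b}) x c k v"
      using Suc.IH[of "t - u"] su(5) by auto
    have "oscs (A \<inter> {..b}) x c k u" using v(1) by (intro oscs_antimono[OF v(3)]) auto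
    then have "oscs (A \<inter> {..b}) x c (Suc k) s" using su b by (intro oscs_SucI[of s _ u]) auto
    then show ?case using su by (intro exI[of _ s]) auto
  qed
  from this[of "t - a"] show ?thesis using a oscs_antimono by fastforce
qed

section \<open>Estimates for the process at single times\<close>

locale nuclear_levy = nuclear_family P + prob_space M
  for P :: "('a::real_vector \<Rightarrow> real) set" and M :: "'w measure" +
  fixes L :: "real \<Rightarrow> 'w \<Rightarrow> 'a \<Rightarrow> real"
  assumes complete: "complete_measure M"
    and levy: "levy_process M (seminorm_topology P) L"
    and equi: "\<And>u::real. u > 0 \<Longrightarrow>
           equicontinuous_L0 (seminorm_topology P) M {(\<lambda>\<phi>. L0_class M (\<lambda>\<omega>. L t \<omega> \<phi>)) | t. t \<in> {0..u}}"
begin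

abbreviation S :: "('a \<Rightarrow> real) topology" where "S \<equiv> strong_dual (tvs_of T)"

abbreviation incr :: "real \<Rightarrow> real \<Rightarrow> 'w \<Rightarrow> 'a \<Rightarrow> real" where
  "incr s t \<equiv> \<lambda>\<omega> \<phi>. L t \<omega> \<phi> - L s \<omega> \<phi>"

lemma L_measurable: "0 \<le> s \<Longrightarrow> L s \<in> M \<rightarrow>\<^sub>M borel_of S"
  and L_0: "AE \<omega> in M. L 0 \<omega> = (\<lambda>\<phi>. 0)"
  and L_indep: "0 \<le> t 0 \<Longrightarrow> (\<And>i. i < n \<Longrightarrow> t i < t (Suc i)) \<Longrightarrow>
      indep_vars (\<lambda>i. borel_of S) (\<lambda>i. incr (t i) (t (Suc i))) {..<n}"
  and L_stationary: "0 \<le> s \<Longrightarrow> s \<le> u \<Longrightarrow> distr M (borel_of S) (incr s u) = distr M (borel_of S) (L (u - s))"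
  and L_radon: "0 \<le> s \<Longrightarrow> distr M (borel_of S) (L s) \<in> radon_prob S"
  and L_continuous: "topcontinuous_at (top_of_set {0..}) (weak_topology S) (\<lambda>t. distr M (borel_of S) (L t)) 0"
  using levy unfolding levy_process_def is_process_def Let_def by auto

lemma L_dual: "0 \<le> t \<Longrightarrow> \<omega> \<in> space M \<Longrightarrow> L t \<omega> \<in> dual (tvs_of T)"
  using measurable_space[OF L_measurable] by simp

lemma L_linear: "0 \<le> t \<Longrightarrow> \<omega> \<in> space M \<Longrightarrow> linear (L t \<omega>)"
  using L_dual by (simp add: dual_tvs_of)

lemma evaluation_continuous: "continuous_map S euclideanreal (\<lambda>f. f \<phi>)"
  by (rule continuous_map_evaluation) (rule P_seminorm)

lemma evaluation_measurable [measurable]: "(\<lambda>f. f \<phi>) \<in> borel_measurable (borel_of S)"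
  by (intro continuous_map_borel_of evaluation_continuous)

lemma L_eval_measurable [measurable]: "0 \<le> t \<Longrightarrow> (\<lambda>\<omega>. L t \<omega> \<phi>) \<in> borel_measurable M"
  using measurable_compose[OF L_measurable evaluation_measurable] .

text \<open>Subtraction need not be measurable for the product of two Borel sigma-algebras on the
  strong dual. Measurability is therefore read off the independence of increments for the grid
  \<open>s < t\<close>; for \<open>s = t\<close> the increment is 0.\<close>

lemma incr_measurable: "0 \<le> s \<Longrightarrow> s \<le> t \<Longrightarrow> incr s t \<in> M \<rightarrow>\<^sub>M borel_of S"
proof (cases "s = t")
  case True
  have "(\<lambda>_. 0) \<in> dual (tvs_of T)" by (simp add: dual_tvs_of linear_iff)
  then show ?thesis using True by simp
next
  case False
  assume st: "0 \<le> s" "s \<le> t"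
  have "indep_vars (\<lambda>i. borel_of S) (\<lambda>i::nat. incr ((\<lambda>i. if i = 0 then s else t) i) ((\<lambda>i. if i = 0 then s else t) (Suc i))) {..<1}"
    using st False by (intro L_indep) auto
  then show ?thesis by (simp add: indep_vars_def)
qed

lemma incr_prob:
  assumes st: "0 \<le> s" "s \<le> t" and Q: "Measurable.pred (borel_of S) Q"
  shows "prob {\<omega> \<in> space M. Q (incr s t \<omega>)} = prob {\<omega> \<in> space M. Q (L (t - s) \<omega>)}"
proof -
  let ?A = "{f \<in> space (borel_of S). Q f}"
  have A: "?A \<in> sets (borel_of S)" using Q by (simp add: pred_def)
  have "prob {\<omega> \<in> space M. Q (incr s t \<omega>)} = measure (distr M (borel_of S) (incr s t)) ?A"
    using measurable_space[OF incr_measurable[OF st]]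
    by (subst measure_distr[OF incr_measurable[OF st] A]) (auto intro!: arg_cong[of _ _ prob])
  also have "\<dots> = measure (distr M (borel_of S) (L (t - s))) ?A"
    by (simp add: L_stationary[OF st])
  also have "\<dots> = prob {\<omega> \<in> space M. Q (L (t - s) \<omega>)}"
    using measurable_space[OF L_measurable[of "t - s"]] st
    by (subst measure_distr[OF L_measurable A]) (auto intro!: arg_cong[of _ _ prob])
  finally show ?thesis .
qed

lemma incr_L2_prob:
  assumes st: "0 \<le> s" "s \<le> t"
  shows "prob {\<omega> \<in> space M. c \<le> L2_set (\<lambda>j. incr s t \<omega> (x j)) J} = prob {\<omega> \<in> space M. c \<le> L2_set (\<lambda>j. L (t - s) \<omega> (x j)) J}"
  using incr_prob[OF st, of "\<lambda>f. c \<le> L2_set (\<lambda>j. f (x j)) J"] by (simp add: L2_set_def)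

lemma grid_increments:
  assumes t: "0 \<le> t 0" "\<And>i. i < n \<Longrightarrow> t i < t (Suc i)"
  shows "indep_increments M (\<lambda>i \<omega> j. incr (t i) (t (Suc i)) \<omega> (x j)) n"
proof
  have "(\<lambda>f j. f (x j)) \<in> borel_of S \<rightarrow>\<^sub>M seq_space"
    by (intro measurable_PiM_single') auto
  from indep_vars_compose2[OF L_indep[of t n, OF t] this]
  show "indep_vars (\<lambda>_. seq_space) (\<lambda>i \<omega> j. incr (t i) (t (Suc i)) \<omega> (x j)) {..<n}" .
qed

lemma grid_incr_norm:
  assumes "i \<le> j"
  shows "incr_norm J i j (\<lambda>i l. incr (t i) (t (Suc i)) \<omega> (x l)) = L2_set (\<lambda>l. incr (t i) (t j) \<omega> (x l)) J"
  unfolding incr_norm_def using assms by (intro L2_set_cong refl) (use sum_Suc_diff'[of i j "\<lambda>k. L (t k) \<omega> (x l)" for l] in simp)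

text \<open>Weak continuity speaks of bounded continuous test functions; the truncated absolute
  value of an evaluation is one, and its expectation measures convergence in probability.\<close>

lemma small_time:
  assumes \<delta>: "\<delta> > 0"
  obtains h where "h > 0" "\<And>s. 0 \<le> s \<Longrightarrow> s \<le> h \<Longrightarrow> expectation (\<lambda>\<omega>. min 1 \<bar>L s \<omega> \<phi>\<bar>) < \<delta>"
proof -
  let ?f = "\<lambda>f::'a \<Rightarrow> real. min 1 \<bar>f \<phi>\<bar>"
  have cont: "continuous_map S euclideanreal ?f"
    by (intro continuous_map_real_min continuous_map_real_abs evaluation_continuous) auto
  have bdd: "bounded (?f ` topspace S)" by (intro boundedI[of _ 1]) auto
  let ?V = "{\<mu> \<in> radon_prob S. (\<integral>x. ?f x \<partial>\<mu>) \<in> {..<\<delta>}}"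
  have int: "(\<integral>x. ?f x \<partial>(distr M (borel_of S) (L s))) = expectation (\<lambda>\<omega>. min 1 \<bar>L s \<omega> \<phi>\<bar>)" if "0 \<le> s" for s
    using that by (intro integral_distr L_measurable) auto
  have "openin (weak_topology S) ?V"
    unfolding weak_topology_def using cont bdd
    by (intro topology_generated_by_Basis insertI2 CollectI exI[of _ ?f] exI[of _ "{..<\<delta>}"]) auto
  moreover have "distr M (borel_of S) (L 0) \<in> ?V"
  proof -
    have "expectation (\<lambda>\<omega>. min 1 \<bar>L 0 \<omega> \<phi>\<bar>) = expectation (\<lambda>\<omega>. 0)"
      using L_0 by (intro integral_cong_AE) auto
    then show ?thesis using \<delta> L_radon[of 0] int[of 0] by simp
  qed
  ultimately have "\<exists>U. openin (top_of_set {0..}) U \<and> 0 \<in> U \<and> (\<forall>y\<in>U. distr M (borel_of S) (L y) \<in> ?V)"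
    using L_continuous unfolding topcontinuous_at_def by meson
  then obtain U where U: "openin (top_of_set {0..}) U" "0 \<in> U" "\<And>y. y \<in> U \<Longrightarrow> distr M (borel_of S) (L y) \<in> ?V"
    by meson
  then obtain W where W: "open W" "U = W \<inter> {0..}" by (auto simp: openin_open)
  then obtain h where h: "h > 0" "\<And>s. \<bar>s\<bar> < h \<Longrightarrow> s \<in> W"
    using U(2) unfolding open_dist by (auto simp: dist_real_def)
  show thesis
  proof (rule that[of "h / 2"])
    show "expectation (\<lambda>\<omega>. min 1 \<bar>L s \<omega> \<phi>\<bar>) < \<delta>" if "0 \<le> s" "s \<le> h / 2" for s
    proof -
      have "s \<in> U" using that h W by auto
      then show ?thesis using U(3)[of s] int[OF that(1)] by simp
    qed
  qed (use h in simp)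
qed

lemma small_time_prob:
  assumes \<epsilon>: "\<epsilon> > 0" and \<delta>: "\<delta> > 0"
  obtains h where "h > 0" "\<And>s. 0 \<le> s \<Longrightarrow> s \<le> h \<Longrightarrow> prob {\<omega> \<in> space M. \<epsilon> \<le> \<bar>L s \<omega> \<phi>\<bar>} \<le> \<delta>"
proof -
  obtain h where h: "h > 0" "\<And>s. 0 \<le> s \<Longrightarrow> s \<le> h \<Longrightarrow> expectation (\<lambda>\<omega>. min 1 \<bar>L s \<omega> \<phi>\<bar>) < \<delta> * min 1 \<epsilon>"
    using small_time[of "\<delta> * min 1 \<epsilon>" \<phi>] assms by auto
  have "prob {\<omega> \<in> space M. \<epsilon> \<le> \<bar>L s \<omega> \<phi>\<bar>} \<le> \<delta>" if s: "0 \<le> s" "s \<le> h" for s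
  proof -
    have int: "integrable M (\<lambda>\<omega>. min 1 \<bar>L s \<omega> \<phi>\<bar>)"
      using s by (intro integrable_const_bound[where B = 1]) auto
    have "prob {\<omega> \<in> space M. \<epsilon> \<le> \<bar>L s \<omega> \<phi>\<bar>} \<le> prob {\<omega> \<in> space M. min 1 \<epsilon> \<le> min 1 \<bar>L s \<omega> \<phi>\<bar>}"
      using s by (intro finite_measure_mono) (auto simp: min_def)
    also have "\<dots> \<le> expectation (\<lambda>\<omega>. min 1 \<bar>L s \<omega> \<phi>\<bar>) / min 1 \<epsilon>"
      using \<epsilon> by (intro integral_Markov_inequality_measure[OF int, where A = "space M"]) auto
    also have "\<dots> \<le> \<delta>" using h(2)[OF s] \<epsilon> by (simp add: field_simps)
    finally show ?thesis .
  qed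
  then show thesis using that h(1) by blast
qed

text \<open>The single threshold 1 is enough because linearity rescales it, as is done in
  \<open>random_functional_tail\<close>.\<close>

lemma equicontinuity:
  assumes u: "u > 0" and \<epsilon>: "\<epsilon> > 0"
  obtains F r where "finite F" "F \<subseteq> P" "r > 0"
    "\<And>t \<phi>. 0 \<le> t \<Longrightarrow> t \<le> u \<Longrightarrow> Psum F \<phi> < r \<Longrightarrow> prob {\<omega> \<in> space M. 1 \<le> \<bar>L t \<omega> \<phi>\<bar>} \<le> \<epsilon>"
proof -
  let ?V = "{L0_class M Y | Y. Y \<in> borel_measurable M \<and> prob {\<omega> \<in> space M. \<bar>Y \<omega> - 0\<bar> \<ge> 1} < \<epsilon>}"
  have V: "openin (L0_topology M) ?V"
    unfolding L0_topology_def
    by (rule topology_generated_by_Basis, rule insertI2, rule CollectI, rule exI[of _ "\<lambda>_. 0"],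
        rule exI[of _ 1], rule exI[of _ \<epsilon>]) (simp add: \<epsilon>)
  have V0: "L0_class M (\<lambda>_. 0) \<in> ?V"
    by (rule CollectI, rule exI[of _ "\<lambda>_. 0"]) (simp add: \<epsilon>)
  obtain U where U: "openin T U" "0 \<in> U"
    "\<forall>A\<in>{(\<lambda>\<phi>. L0_class M (\<lambda>\<omega>. L t \<omega> \<phi>)) | t. t \<in> {0..u}}. A ` U \<subseteq> ?V"
  proof -
    from equi[OF u] have "\<exists>U. openin T U \<and> 0 \<in> U \<and>
        (\<forall>A\<in>{(\<lambda>\<phi>. L0_class M (\<lambda>\<omega>. L t \<omega> \<phi>)) | t. t \<in> {0..u}}. A ` U \<subseteq> ?V)"
      unfolding equicontinuous_L0_def using V V0 by presburger
    then show thesis using that by (elim exE conjE)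
  qed
  obtain F r where F: "finite F" "F \<subseteq> P" "r > 0" "\<And>x. Psum F x < r \<Longrightarrow> x \<in> U"
    using T_nbhd[OF U(1,2)] by metis
  have "prob {\<omega> \<in> space M. 1 \<le> \<bar>L t \<omega> \<phi>\<bar>} \<le> \<epsilon>" if t: "0 \<le> t" "t \<le> u" and \<phi>: "Psum F \<phi> < r" for t \<phi>
  proof -
    have "(\<lambda>\<phi>. L0_class M (\<lambda>\<omega>. L t \<omega> \<phi>)) ` U \<subseteq> ?V"
      by (rule bspec[OF U(3)], rule CollectI, rule exI[of _ t]) (simp add: t)
    then have "L0_class M (\<lambda>\<omega>. L t \<omega> \<phi>) \<in> ?V"
      by (rule subsetD) (rule image_eqI[OF refl F(4)[OF \<phi>]])
    then obtain Y where Y: "L0_class M (\<lambda>\<omega>. L t \<omega> \<phi>) = L0_class M Y" "Y \<in> borel_measurable M"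
      "prob {\<omega> \<in> space M. \<bar>Y \<omega>\<bar> \<ge> 1} < \<epsilon>" by auto
    have "(Y, Y) \<in> L0_rel M" using Y(2) by (simp add: L0_rel_def)
    then have "Y \<in> L0_class M (\<lambda>\<omega>. L t \<omega> \<phi>)" unfolding Y(1) by (simp add: L0_class_def)
    then have "AE \<omega> in M. L t \<omega> \<phi> = Y \<omega>" by (simp add: L0_class_def L0_rel_def)
    then have "prob {\<omega> \<in> space M. 1 \<le> \<bar>L t \<omega> \<phi>\<bar>} = prob {\<omega> \<in> space M. \<bar>Y \<omega>\<bar> \<ge> 1}"
      using t Y(2) by (intro finite_measure_eq_AE) auto
    then show ?thesis using Y(3) by simp
  qed
  then show thesis using that F(1-3) by blast
qed

lemma uniform_tail:
  assumes u: "u > 0" and \<alpha>: "\<alpha> > 0"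
  obtains G C where "finite G" "G \<subseteq> P" "C > 0"
    "\<And>t m x. 0 \<le> t \<Longrightarrow> t \<le> u \<Longrightarrow> contractive (Psum G) m x \<Longrightarrow>
      prob {\<omega> \<in> space M. C \<le> L2_set (\<lambda>j. L t \<omega> (x j)) {..<m}} \<le> \<alpha>"
proof -
  \<comment> \<open>The factor 3/32 is chosen so that
    \<open>16 / 3 * (\<epsilon> + \<epsilon>) = \<alpha>\<close>. Below, \<open>C\<close> makes the
    second term of the tail bound equal to \<open>\<epsilon>\<close>, and \<open>K\<close> is made
    positive so that \<open>C\<close> is.\<close>
  define \<epsilon> where "\<epsilon> = \<alpha> * 3 / 32"
  have \<epsilon>: "\<epsilon> > 0" using \<alpha> by (simp add: \<epsilon>_def)
  obtain F r where F: "finite F" "F \<subseteq> P" "r > 0"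
    "\<And>t \<phi>. 0 \<le> t \<Longrightarrow> t \<le> u \<Longrightarrow> Psum F \<phi> < r \<Longrightarrow> prob {\<omega> \<in> space M. 1 \<le> \<bar>L t \<omega> \<phi>\<bar>} \<le> \<epsilon>"
    using equicontinuity[OF u \<epsilon>] by metis
  obtain G where G: "finite G" "F \<subseteq> G" "G \<subseteq> P" "hs_bounded (Psum G) (Psum F)"
    using exists_hs_Psum[OF F(1,2)] by metis
  then obtain K0 where K0: "\<And>m x. contractive (Psum G) m x \<Longrightarrow> (\<Sum>j<m. (Psum F (x j))\<^sup>2) \<le> K0"
    by (auto simp: hs_bounded_def)
  define K where "K = max K0 1"
  define C where "C = sqrt (4 * K / (r\<^sup>2 * \<epsilon>))"
  have K: "K > 0" by (simp add: K_def)
  have C: "C > 0" "C\<^sup>2 = 4 * K / (r\<^sup>2 * \<epsilon>)" using K F(3) \<epsilon> by (auto simp: C_def)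
  have "prob {\<omega> \<in> space M. C \<le> L2_set (\<lambda>j. L t \<omega> (x j)) {..<m}} \<le> \<alpha>"
    if t: "0 \<le> t" "t \<le> u" and x: "contractive (Psum G) m x" for t m x
  proof -
    have "prob {\<omega> \<in> space M. C \<le> L2_set (\<lambda>j. L t \<omega> (x j)) {..<m}} \<le> 16 / 3 * (\<epsilon> + 4 * K / (r\<^sup>2 * C\<^sup>2))"
      using t F C(1) \<epsilon> K0[OF x] L_linear
      by (intro random_functional_tail[where p = "Psum F" and r = r] Psum_hilbertian) (auto simp: K_def)
    also have "4 * K / (r\<^sup>2 * C\<^sup>2) = \<epsilon>" using K F(3) \<epsilon> by (simp add: C(2))
    also have "16 / 3 * (\<epsilon> + \<epsilon>) = \<alpha>" by (simp add: \<epsilon>_def)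
    finally show ?thesis .
  qed
  then show thesis using that[OF G(1,3) C(1)] by blast
qed

end

section \<open>Dyadic grids\<close>

definition dyadic_times :: "real set" where
  "dyadic_times = {real j / 2 ^ l | j l. True}"

lemma dyadic_grid_Suc: "{real j / 2 ^ m | j. j \<le> n} \<subseteq> {real j / 2 ^ Suc m | j. j \<le> 2 * n}"
proof
  fix t assume "t \<in> {real j / 2 ^ m | j. j \<le> n}"
  then obtain j where "t = real j / 2 ^ m" "j \<le> n" by blast
  then have "t = real (2 * j) / 2 ^ Suc m" "2 * j \<le> 2 * n" by auto
  then show "t \<in> {real j / 2 ^ Suc m | j. j \<le> 2 * n}" by blast
qed

text \<open>\<open>w\<close> fixes a coarse mesh and \<open>n\<close> the number of its cells,
  independently of the level \<open>l\<close> of refinement; all levels thus fill the same interval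
  and are nested.\<close>

definition dyadic_grid :: "nat \<Rightarrow> nat \<Rightarrow> nat \<Rightarrow> real set" where
  "dyadic_grid w n l = {real j / 2 ^ (w + l) | j. j \<le> n * 2 ^ l}"

lemma incseq_dyadic_grid: "incseq (dyadic_grid w n)"
proof (rule incseq_SucI)
  fix l
  have "{real j / 2 ^ (w + l) | j. j \<le> n * 2 ^ l} \<subseteq> {real j / 2 ^ Suc (w + l) | j. j \<le> 2 * (n * 2 ^ l)}"
    by (rule dyadic_grid_Suc)
  then show "dyadic_grid w n l \<subseteq> dyadic_grid w n (Suc l)"
    by (simp add: dyadic_grid_def mult.left_commute)
qed

lemma Union_dyadic_grid: "(\<Union>l. dyadic_grid w n l) = dyadic_times \<inter> {..real n / 2 ^ w}"
proof
  show "(\<Union>l. dyadic_grid w n l) \<subseteq> dyadic_times \<inter> {..real n / 2 ^ w}"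
  proof
    fix t assume "t \<in> (\<Union>l. dyadic_grid w n l)"
    then obtain l j where t: "t = real j / 2 ^ (w + l)" "j \<le> n * 2 ^ l" by (auto simp: dyadic_grid_def)
    have "real j \<le> real n * 2 ^ l" using t(2) by (metis of_nat_le_iff of_nat_mult of_nat_numeral of_nat_power)
    then have "t \<le> real n / 2 ^ w" by (simp add: t(1) power_add field_simps)
    then show "t \<in> dyadic_times \<inter> {..real n / 2 ^ w}" using t(1) by (auto simp: dyadic_times_def)
  qed
  show "dyadic_times \<inter> {..real n / 2 ^ w} \<subseteq> (\<Union>l. dyadic_grid w n l)"
  proof
    fix t assume t: "t \<in> dyadic_times \<inter> {..real n / 2 ^ w}"
    then obtain j l where j: "t = real j / 2 ^ l" by (auto simp: dyadic_times_def)
    have tj: "t = real (j * 2 ^ w) / 2 ^ (w + l)" by (simp add: j power_add)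
    have "real (j * 2 ^ w) \<le> real (n * 2 ^ l)" using t by (simp add: j field_simps)
    then have "j * 2 ^ w \<le> n * 2 ^ l" using of_nat_le_iff by blast
    then have "t \<in> dyadic_grid w n l" unfolding dyadic_grid_def using tj by blast
    then show "t \<in> (\<Union>l. dyadic_grid w n l)" by blast
  qed
qed

text \<open>On a grid, a real path is the walk of its increments in a single coordinate. This makes
  \<open>oscillation_bound\<close> applicable to it.\<close>

lemma oscs_grid:
  assumes "i \<le> n"
  shows "oscs {real j / 2 ^ m | j. j \<le> n} x c k (real i / 2 ^ m) \<longleftrightarrow>
    oscillates {l} c k i n (\<lambda>i _. x (real (Suc i) / 2 ^ m) - x (real i / 2 ^ m))"
  using assms
proof (induction k arbitrary: i)
  case 0
  then show ?case by simp
next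
  case (Suc k)
  let ?A = "{real j / 2 ^ m | j. j \<le> n}" and ?z = "\<lambda>i (_::nat). x (real (Suc i) / 2 ^ m) - x (real i / 2 ^ m)"
  have norm: "incr_norm {l} i j ?z = \<bar>x (real j / 2 ^ m) - x (real i / 2 ^ m)\<bar>" if "i \<le> j" for i j
    unfolding incr_norm_def using sum_Suc_diff'[OF that, of "\<lambda>i. x (real i / 2 ^ m)"] by (simp add: L2_set_def)
  show ?case
  proof
    assume "oscs ?A x c (Suc k) (real i / 2 ^ m)"
    then obtain s t where st: "s \<in> ?A" "t \<in> ?A" "real i / 2 ^ m \<le> s" "s \<le> t" "c \<le> \<bar>x t - x s\<bar>" "oscs ?A x c k t"
      by auto
    obtain i' j where ij: "s = real i' / 2 ^ m" "t = real j / 2 ^ m" "j \<le> n" using st(1,2) by blast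
    have le: "i \<le> i'" "i' \<le> j" using st(3,4) by (auto simp: ij divide_le_cancel)
    have "c \<le> incr_norm {l} i' j ?z" unfolding norm[OF le(2)] using st(5) by (simp add: ij)
    moreover have "oscillates {l} c k j n ?z" using Suc.IH[OF ij(3)] st(6) ij(2) by simp
    moreover have "i' \<in> {i..j}" "j \<in> {i..n}" using le ij(3) by auto
    ultimately show "oscillates {l} c (Suc k) i n ?z" unfolding oscillates.simps by blast
  next
    assume "oscillates {l} c (Suc k) i n ?z"
    then obtain i' j where ij: "i' \<in> {i..j}" "j \<in> {i..n}" "c \<le> incr_norm {l} i' j ?z" "oscillates {l} c k j n ?z"
      unfolding oscillates.simps by blast
    show "oscs ?A x c (Suc k) (real i / 2 ^ m)"
    proof (rule oscs_SucI)
      show "real i' / 2 ^ m \<in> ?A" "real j / 2 ^ m \<in> ?A" using ij(1,2) by auto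
      show "real i / 2 ^ m \<le> real i' / 2 ^ m" "real i' / 2 ^ m \<le> real j / 2 ^ m"
        using ij(1) by (auto simp: divide_le_cancel)
      show "c \<le> \<bar>x (real j / 2 ^ m) - x (real i' / 2 ^ m)\<bar>" 
      proof -
        have "i' \<le> j" using ij(1) by simp
        then show ?thesis using ij(3) unfolding norm[OF \<open>i' \<le> j\<close>] by simp
      qed
      show "oscs ?A x c k (real j / 2 ^ m)" using Suc.IH[of j] ij(2,4) by simp
    qed
  qed
qed

section \<open>Bounds for paths over dyadic times\<close>

context nuclear_levy begin

text \<open>For \<open>c > 0\<close> this is \<open>c\<close> times the polar of the unit ball of
  \<open>q\<close>.\<close>

definition dual_ball :: "('a \<Rightarrow> real) \<Rightarrow> real \<Rightarrow> ('a \<Rightarrow> real) set" where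
  "dual_ball q c = {f \<in> dual (tvs_of T). \<forall>\<phi>. \<bar>f \<phi>\<bar> \<le> c * q \<phi>}"

text \<open>The slack \<open>1 / Suc (snd i)\<close> matches the error \<open>\<eta>\<close> left in
  \<open>grid_max_finite\<close>, where Gram--Schmidt is only approximate. Indexing by vectors and
  slacks yields a union of open sets, to which the Radon property applies.\<close>

lemma dual_ball_complement:
  "dual (tvs_of T) - dual_ball q c = (\<Union>i. {f \<in> dual (tvs_of T). c * q (fst i) + 1 / Suc (snd i) < \<bar>f (fst i)\<bar>})"
proof -
  have "(\<exists>k. c * q \<phi> + 1 / Suc k < \<bar>f \<phi>\<bar>) \<longleftrightarrow> c * q \<phi> < \<bar>f \<phi>\<bar>" for f :: "'a \<Rightarrow> real" and \<phi>
  proof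
    assume "c * q \<phi> < \<bar>f \<phi>\<bar>"
    then obtain k where "1 / real (Suc k) < \<bar>f \<phi>\<bar> - c * q \<phi>" using nat_approx_posE by (metis diff_gt_0_iff_gt)
    then show "\<exists>k. c * q \<phi> + 1 / Suc k < \<bar>f \<phi>\<bar>" by (intro exI[of _ k]) linarith
  next
    assume "\<exists>k. c * q \<phi> + 1 / Suc k < \<bar>f \<phi>\<bar>"
    then obtain k where "c * q \<phi> + 1 / Suc k < \<bar>f \<phi>\<bar>" by blast
    moreover have "0 < 1 / real (Suc k)" by simp
    ultimately show "c * q \<phi> < \<bar>f \<phi>\<bar>" by linarith
  qed
  note eq = this
  show ?thesis
  proof (intro set_eqI iffI)
    fix f assume "f \<in> dual (tvs_of T) - dual_ball q c"
    then obtain \<phi> where f: "f \<in> dual (tvs_of T)" "c * q \<phi> < \<bar>f \<phi>\<bar>" by (auto simp: dual_ball_def not_le)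
    then obtain k where "c * q \<phi> + 1 / Suc k < \<bar>f \<phi>\<bar>" using eq[of \<phi> f] by blast
    then show "f \<in> (\<Union>i. {f \<in> dual (tvs_of T). c * q (fst i) + 1 / Suc (snd i) < \<bar>f (fst i)\<bar>})"
      using f(1) by (intro UN_I[of "(\<phi>, k)"]) auto
  next
    fix f assume "f \<in> (\<Union>i. {f \<in> dual (tvs_of T). c * q (fst i) + 1 / Suc (snd i) < \<bar>f (fst i)\<bar>})"
    then obtain i where i: "f \<in> dual (tvs_of T)" "c * q (fst i) + 1 / Suc (snd i) < \<bar>f (fst i)\<bar>" by blast
    have "c * q (fst i) < \<bar>f (fst i)\<bar>" using eq[of "fst i" f] i(2) by blast
    then show "f \<in> dual (tvs_of T) - dual_ball q c" using i(1) by (auto simp: dual_ball_def not_le)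
  qed
qed

lemma dual_ball_complement_open: "openin S {f \<in> dual (tvs_of T). a < \<bar>f \<phi>\<bar>}"
  using openin_continuous_map_preimage[OF continuous_map_real_abs[OF evaluation_continuous], of "{a<..}" \<phi>] by simp

lemma dual_ball_measurable: "dual_ball q c \<in> sets (borel_of S)"
proof -
  have "openin S (dual (tvs_of T) - dual_ball q c)"
    unfolding dual_ball_complement by (intro openin_Union) (auto intro: dual_ball_complement_open)
  then have "space (borel_of S) - (dual (tvs_of T) - dual_ball q c) \<in> sets (borel_of S)"
    by (intro sets.compl_sets borel_of_open)
  moreover have "space (borel_of S) - (dual (tvs_of T) - dual_ball q c) = dual_ball q c"
    by (auto simp: dual_ball_def)
  ultimately show ?thesis by simp
qed

lemma L_dual_ball_event: "0 \<le> t \<Longrightarrow> {\<omega> \<in> space M. L t \<omega> \<notin> dual_ball q c} \<in> events"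
proof -
  assume t: "0 \<le> t"
  have "L t -` (space (borel_of S) - dual_ball q c) \<inter> space M \<in> events"
    by (intro measurable_sets[OF L_measurable[OF t]] sets.compl_sets dual_ball_measurable)
  moreover have "L t -` (space (borel_of S) - dual_ball q c) \<inter> space M = {\<omega> \<in> space M. L t \<omega> \<notin> dual_ball q c}"
    using L_dual[OF t] by auto
  ultimately show ?thesis by simp
qed

lemma L2_event: "0 \<le> s \<Longrightarrow> {\<omega> \<in> space M. c \<le> L2_set (\<lambda>k. L s \<omega> (x k)) J} \<in> events"
  unfolding L2_set_def by measurable

lemma eval_event: "0 \<le> s \<Longrightarrow> {\<omega> \<in> space M. c < \<bar>L s \<omega> \<phi>\<bar>} \<in> events"
  by measurable

lemma grid_mono:
  fixes t :: "nat \<Rightarrow> real"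
  assumes "\<And>i. i < n \<Longrightarrow> t i < t (Suc i)" "i \<le> j" "j \<le> n"
  shows "t i \<le> t j"
  using assms(2,3)
proof (induction j rule: dec_induct)
  case (step k)
  then show ?case using assms(1)[of k] by simp
qed simp

context
  fixes G C u \<alpha>
  assumes G: "finite G" "G \<subseteq> P" and C: "C > 0" and \<alpha>: "\<alpha> \<le> 1 / 2"
    and tail: "\<And>t m x. 0 \<le> t \<Longrightarrow> t \<le> u \<Longrightarrow> contractive (Psum G) m x \<Longrightarrow>
      prob {\<omega> \<in> space M. C \<le> L2_set (\<lambda>j. L t \<omega> (x j)) {..<m}} \<le> \<alpha>"
  fixes t :: "nat \<Rightarrow> real" and n :: nat
  assumes t: "t 0 = 0" "\<And>i. i < n \<Longrightarrow> t i < t (Suc i)" "t n \<le> u"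
begin

lemma t_range: "i \<le> n \<Longrightarrow> 0 \<le> t i" "i \<le> n \<Longrightarrow> t i \<le> u"
  using grid_mono[of n t 0 i] grid_mono[of n t i n] t by auto

lemma grid_max_L2:
  assumes x: "contractive (Psum G) m x"
  shows "prob {\<omega> \<in> space M. \<exists>j\<in>{0..n}. 2 * C \<le> L2_set (\<lambda>k. L (t j) \<omega> (x k)) {..<m}} \<le> 2 * \<alpha>"
proof -
  interpret Z: indep_increments M "\<lambda>i \<omega> j. incr (t i) (t (Suc i)) \<omega> (x j)" n
    using t(1,2) by (intro grid_increments) auto
  have "prob {\<omega> \<in> space M. \<exists>j\<in>{0..n}. 2 * C \<le> incr_norm {..<m} 0 j (\<lambda>i l. incr (t i) (t (Suc i)) \<omega> (x l))} \<le> 2 * \<alpha>"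
  proof (rule Z.ottaviani[OF _ \<alpha>])
    fix i j assume ij: "0 \<le> i" "i \<le> j" "j \<le> n"
    have st: "0 \<le> t i" "t i \<le> t j" using t_range(1)[of i] grid_mono[of n t, OF t(2) ij(2,3)] ij by auto
    have "t j - t i \<le> u" using t_range(2)[of j] st(1) ij by simp
    then show "prob {\<omega> \<in> space M. C \<le> incr_norm {..<m} i j (\<lambda>i l. incr (t i) (t (Suc i)) \<omega> (x l))} \<le> \<alpha>"
      unfolding grid_incr_norm[OF ij(2)] incr_L2_prob[OF st] using st(2) by (intro tail x) auto
  qed simp
  \<comment> \<open>Since \<open>L 0 = 0\<close> almost surely, increments from the first grid point
    are the values of the process.\<close>
  also have "prob {\<omega> \<in> space M. \<exists>j\<in>{0..n}. 2 * C \<le> incr_norm {..<m} 0 j (\<lambda>i l. incr (t i) (t (Suc i)) \<omega> (x l))}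
    = prob {\<omega> \<in> space M. \<exists>j\<in>{0..n}. 2 * C \<le> L2_set (\<lambda>k. L (t j) \<omega> (x k)) {..<m}}"
  proof (rule finite_measure_eq_AE)
    show "AE \<omega> in M. (\<omega> \<in> {\<omega> \<in> space M. \<exists>j\<in>{0..n}. 2 * C \<le> incr_norm {..<m} 0 j (\<lambda>i l. incr (t i) (t (Suc i)) \<omega> (x l))})
      = (\<omega> \<in> {\<omega> \<in> space M. \<exists>j\<in>{0..n}. 2 * C \<le> L2_set (\<lambda>k. L (t j) \<omega> (x k)) {..<m}})"
      using L_0 by eventually_elim (simp add: grid_incr_norm t(1))
    show "{\<omega> \<in> space M. \<exists>j\<in>{0..n}. 2 * C \<le> incr_norm {..<m} 0 j (\<lambda>i l. incr (t i) (t (Suc i)) \<omega> (x l))} \<in> events"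
    proof (rule Z.past_event[of 0 n "\<lambda>z. \<exists>j\<in>{0..n}. 2 * C \<le> incr_norm {..<m} 0 j z"])
      show "Z.past 0 n (\<lambda>z. \<exists>j\<in>{0..n}. 2 * C \<le> incr_norm {..<m} 0 j z)"
        by (intro Z.past_Bex Z.past_incr_norm) auto
    qed simp
    show "{\<omega> \<in> space M. \<exists>j\<in>{0..n}. 2 * C \<le> L2_set (\<lambda>k. L (t j) \<omega> (x k)) {..<m}} \<in> events"
      using t_range(1) by (intro sets.sets_Collect_finite_Ex L2_event) auto
  qed
  finally show ?thesis .
qed

text \<open>All vectors of the finite set are expanded in one contractive family, with coefficients
  of norm at most \<open>Psum G \<phi> + \<eta> / (2 * C)\<close>. By Cauchy--Schwarz, a value above
  \<open>2 * C * Psum G \<phi> + \<eta>\<close> forces the Euclidean norm of the values on that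
  family to reach \<open>2 * C\<close>, so the size of the set does not enter the bound.\<close>

lemma grid_max_finite:
  assumes \<Phi>: "finite \<Phi>" and \<eta>: "\<eta> > 0"
  shows "prob {\<omega> \<in> space M. \<exists>j\<in>{0..n}. \<exists>\<phi>\<in>\<Phi>. 2 * C * Psum G \<phi> + \<eta> < \<bar>L (t j) \<omega> \<phi>\<bar>} \<le> 2 * \<alpha>"
proof -
  let ?\<eta> = "\<eta> / (2 * C)"
  have "?\<eta> > 0" using \<eta> C by simp
  from approximate_Gram_Schmidt[OF Psum_hilbertian[OF G(2)] \<Phi> this]
  obtain m x where x: "semi_orthonormal (Psum G) m x"
    and a: "\<And>\<phi>. \<phi> \<in> \<Phi> \<Longrightarrow> \<exists>a. \<phi> = (\<Sum>j<m. a j *\<^sub>R x j) \<and> L2_set a {..<m} \<le> Psum G \<phi> + ?\<eta>" by blast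
  have "prob {\<omega> \<in> space M. \<exists>j\<in>{0..n}. \<exists>\<phi>\<in>\<Phi>. 2 * C * Psum G \<phi> + \<eta> < \<bar>L (t j) \<omega> \<phi>\<bar>}
    \<le> prob {\<omega> \<in> space M. \<exists>j\<in>{0..n}. 2 * C \<le> L2_set (\<lambda>k. L (t j) \<omega> (x k)) {..<m}}"
  proof (rule finite_measure_mono)
    show "{\<omega> \<in> space M. \<exists>j\<in>{0..n}. 2 * C \<le> L2_set (\<lambda>k. L (t j) \<omega> (x k)) {..<m}} \<in> events"
      using t_range(1) by (intro sets.sets_Collect_finite_Ex L2_event) auto
    show "{\<omega> \<in> space M. \<exists>j\<in>{0..n}. \<exists>\<phi>\<in>\<Phi>. 2 * C * Psum G \<phi> + \<eta> < \<bar>L (t j) \<omega> \<phi>\<bar>}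
      \<subseteq> {\<omega> \<in> space M. \<exists>j\<in>{0..n}. 2 * C \<le> L2_set (\<lambda>k. L (t j) \<omega> (x k)) {..<m}}"
    proof clarify
      fix \<omega> j \<phi> assume \<omega>: "\<omega> \<in> space M" and j: "j \<in> {0..n}" and \<phi>: "\<phi> \<in> \<Phi>"
        and gt: "2 * C * Psum G \<phi> + \<eta> < \<bar>L (t j) \<omega> \<phi>\<bar>"
      obtain a where a: "\<phi> = (\<Sum>j<m. a j *\<^sub>R x j)" "L2_set a {..<m} \<le> Psum G \<phi> + ?\<eta>" using a[OF \<phi>] by blast
      have lin: "linear (L (t j) \<omega>)" using t_range(1)[of j] j \<omega> by (intro L_linear) auto
      let ?N = "L2_set (\<lambda>k. L (t j) \<omega> (x k)) {..<m}"
      have "\<bar>L (t j) \<omega> \<phi>\<bar> = \<bar>\<Sum>k<m. a k * L (t j) \<omega> (x k)\<bar>"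
        by (simp add: a(1) linear_sum[OF lin] linear_cmul[OF lin])
      also have "\<dots> \<le> L2_set a {..<m} * ?N"
        by (rule order_trans[OF sum_abs], simp only: abs_mult, rule L2_set_mult_ineq)
      also have "\<dots> \<le> (Psum G \<phi> + ?\<eta>) * ?N" using a(2) by (intro mult_right_mono) (auto simp: L2_set_nonneg)
      finally have "2 * C * (Psum G \<phi> + ?\<eta>) < (Psum G \<phi> + ?\<eta>) * ?N"
        using gt C by (simp add: algebra_simps)
      moreover have "0 < Psum G \<phi> + ?\<eta>" using \<open>?\<eta> > 0\<close> Psum_nonneg[of G \<phi>] by linarith
      ultimately have "2 * C \<le> ?N" by (simp add: mult.commute)
      then show "\<exists>j\<in>{0..n}. 2 * C \<le> L2_set (\<lambda>k. L (t j) \<omega> (x k)) {..<m}" using j by blast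
    qed
  qed
  also have "\<dots> \<le> 2 * \<alpha>" by (intro grid_max_L2 semi_orthonormal_contractive[OF Psum_hilbertian[OF G(2)] x])
  finally show ?thesis .
qed

text \<open>At each of the \<open>n + 1\<close> grid times, finitely many of the open sets that make
  up the complement of the ball suffice up to mass \<open>e / Suc n\<close>. Their vectors form one
  finite family for \<open>grid_max_finite\<close>, and \<open>\<eta>\<close> is not larger than any
  of their slacks.\<close>

lemma grid_dual_ball:
  "prob {\<omega> \<in> space M. \<exists>j\<in>{0..n}. L (t j) \<omega> \<notin> dual_ball (Psum G) (2 * C)} \<le> 2 * \<alpha>"
proof (rule field_le_epsilon)
  fix e :: real assume e: "e > 0"
  let ?D = "dual (tvs_of T)"
  define V where "V i = {f \<in> ?D. 2 * C * Psum G (fst i) + 1 / Suc (snd i) < \<bar>f (fst i)\<bar>}" for i :: "'a \<times> nat"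
  have V_open: "openin S (V i)" for i unfolding V_def by (rule dual_ball_complement_open)
  have UV: "?D - dual_ball (Psum G) (2 * C) = (\<Union>i. V i)" unfolding V_def by (rule dual_ball_complement)
  have "\<exists>J. finite J \<and> measure (distr M (borel_of S) (L (t j))) ((\<Union>i. V i) - (\<Union>i\<in>J. V i)) < e / Suc n"
    if "j \<in> {0..n}" for j
    using radon_finite_subcover[OF L_radon[OF t_range(1)[of j]], of UNIV V "e / Suc n"] V_open e that by auto
  then obtain J where J: "\<And>j. j \<in> {0..n} \<Longrightarrow> finite (J j)"
    "\<And>j. j \<in> {0..n} \<Longrightarrow> measure (distr M (borel_of S) (L (t j))) ((\<Union>i. V i) - (\<Union>i\<in>J j. V i)) < e / Suc n"
    by metis
  define W where "W j = (\<Union>i. V i) - (\<Union>i\<in>J j. V i)" for j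
  have W_meas: "W j \<in> sets (borel_of S)" if "j \<in> {0..n}" for j
    unfolding W_def using V_open J(1)[OF that]
    by (intro sets.Diff borel_of_open openin_Union) auto
  define I where "I = (\<Union>j\<in>{0..n}. J j)"
  have I: "finite I" unfolding I_def using J(1) by auto
  define \<eta> where "\<eta> = 1 / real (Suc (Max (insert 0 (snd ` I))))"
  have \<eta>: "\<eta> > 0" by (simp add: \<eta>_def)
  have \<eta>_le: "\<eta> \<le> 1 / Suc (snd i)" if "i \<in> I" for i
  proof -
    have "snd i \<le> Max (insert 0 (snd ` I))" using that I by (intro Max_ge) auto
    then show ?thesis unfolding \<eta>_def by (intro divide_left_mono) auto
  qed
  define A where "A = {\<omega> \<in> space M. \<exists>j\<in>{0..n}. \<exists>\<phi>\<in>fst ` I. 2 * C * Psum G \<phi> + \<eta> < \<bar>L (t j) \<omega> \<phi>\<bar>}"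
  define B where "B j = {\<omega> \<in> space M. L (t j) \<omega> \<in> W j}" for j
  have fin: "finite (fst ` I)" using I by simp
  have A_ev: "A \<in> events"
    unfolding A_def using t_range(1) fin by (intro sets.sets_Collect_finite_Ex eval_event) auto
  have B_ev: "B j \<in> events" if "j \<in> {0..n}" for j
  proof -
    have "L (t j) -` W j \<inter> space M \<in> events" using that t_range(1)[of j] by (intro measurable_sets[OF L_measurable W_meas]) auto
    moreover have "L (t j) -` W j \<inter> space M = B j" by (auto simp: B_def)
    ultimately show ?thesis by simp
  qed
  have B_prob: "prob (B j) \<le> e / Suc n" if j: "j \<in> {0..n}" for j
  proof -
    have "measure (distr M (borel_of S) (L (t j))) (W j) = prob (L (t j) -` W j \<inter> space M)"
      using j t_range(1)[of j] by (intro measure_distr L_measurable W_meas) auto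
    also have "L (t j) -` W j \<inter> space M = B j" by (auto simp: B_def)
    finally show ?thesis using J(2)[OF j] by (simp add: W_def)
  qed
  have "prob {\<omega> \<in> space M. \<exists>j\<in>{0..n}. L (t j) \<omega> \<notin> dual_ball (Psum G) (2 * C)} \<le> prob (A \<union> (\<Union>j\<in>{0..n}. B j))"
  proof (rule finite_measure_mono)
    show "{\<omega> \<in> space M. \<exists>j\<in>{0..n}. L (t j) \<omega> \<notin> dual_ball (Psum G) (2 * C)} \<subseteq> A \<union> (\<Union>j\<in>{0..n}. B j)"
    proof clarify
      fix \<omega> j assume \<omega>: "\<omega> \<in> space M" and j: "j \<in> {0..n}" and "L (t j) \<omega> \<notin> dual_ball (Psum G) (2 * C)"
        and nB: "\<omega> \<notin> (\<Union>j\<in>{0..n}. B j)"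
      moreover have "L (t j) \<omega> \<in> ?D" using \<omega> j t_range(1)[of j] by (intro L_dual) auto
      ultimately have "L (t j) \<omega> \<in> (\<Union>i. V i)" using UV by blast
      moreover have "L (t j) \<omega> \<notin> W j" using nB \<omega> j by (auto simp: B_def)
      ultimately obtain i where i: "i \<in> J j" "L (t j) \<omega> \<in> V i" by (auto simp: W_def)
      have iI: "i \<in> I" using i(1) j by (auto simp: I_def)
      have "2 * C * Psum G (fst i) + \<eta> < \<bar>L (t j) \<omega> (fst i)\<bar>"
        using i(2) \<eta>_le[OF iI] by (simp add: V_def)
      then show "\<omega> \<in> A" unfolding A_def using \<omega> j iI by blast
    qed
    show "A \<union> (\<Union>j\<in>{0..n}. B j) \<in> events" using A_ev B_ev by auto
  qed
  also have "\<dots> \<le> prob A + prob (\<Union>j\<in>{0..n}. B j)"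
    using A_ev B_ev by (intro measure_Un_le) auto
  also have "prob A \<le> 2 * \<alpha>" unfolding A_def by (intro grid_max_finite fin \<eta>)
  also have "prob (\<Union>j\<in>{0..n}. B j) \<le> (\<Sum>j\<in>{0..n}. prob (B j))"
    using B_ev by (intro measure_UNION_le) auto
  also have "\<dots> \<le> (\<Sum>j\<in>{0..n}. e / Suc n)" by (intro sum_mono B_prob)
  also have "\<dots> = e" by simp
  finally show "prob {\<omega> \<in> space M. \<exists>j\<in>{0..n}. L (t j) \<omega> \<notin> dual_ball (Psum G) (2 * C)} \<le> 2 * \<alpha> + e"
    by simp
qed

end

text \<open>The bound for a single arbitrary time is kept besides that for all dyadic times: it will
  place \<open>L t\<close> at a time that need not be dyadic into the same ball as the right limit
  of the path.\<close>

lemma path_dual_ball: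
  assumes \<delta>: "\<delta> > 0"
  obtains G c where "finite G" "G \<subseteq> P" "c > 0"
    "{\<omega> \<in> space M. \<exists>t\<in>dyadic_times \<inter> {..real N}. L t \<omega> \<notin> dual_ball (Psum G) c} \<in> events"
    "prob {\<omega> \<in> space M. \<exists>t\<in>dyadic_times \<inter> {..real N}. L t \<omega> \<notin> dual_ball (Psum G) c} \<le> \<delta>"
    "\<And>t. 0 \<le> t \<Longrightarrow> t \<le> real N \<Longrightarrow> prob {\<omega> \<in> space M. L t \<omega> \<notin> dual_ball (Psum G) c} \<le> \<delta>"
proof -
  define \<alpha> where "\<alpha> = min (1 / 2) (\<delta> / 2)"
  have \<alpha>: "\<alpha> > 0" "\<alpha> \<le> 1 / 2" "2 * \<alpha> \<le> \<delta>" using \<delta> by (auto simp: \<alpha>_def)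
  \<comment> \<open>The horizon \<open>Suc N\<close> is positive also for
    \<open>N = 0\<close>.\<close>
  obtain G C where G: "finite G" "G \<subseteq> P" "C > 0"
    "\<And>t m x. 0 \<le> t \<Longrightarrow> t \<le> real (Suc N) \<Longrightarrow> contractive (Psum G) m x \<Longrightarrow>
      prob {\<omega> \<in> space M. C \<le> L2_set (\<lambda>j. L t \<omega> (x j)) {..<m}} \<le> \<alpha>"
    using uniform_tail[of "real (Suc N)" \<alpha>] \<alpha>(1) by auto
  note grid = grid_dual_ball[OF G(1-3) \<alpha>(2) G(4)]
  let ?K = "dual_ball (Psum G) (2 * C)"
  define E where "E l = {\<omega> \<in> space M. \<exists>t\<in>dyadic_grid 0 N l. L t \<omega> \<notin> ?K}" for l
  have fin: "finite (dyadic_grid 0 N l)" for l by (simp add: dyadic_grid_def)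
  have nonneg: "t \<in> dyadic_grid 0 N l \<Longrightarrow> 0 \<le> t" for t l by (auto simp: dyadic_grid_def)
  have E_ev: "E l \<in> events" for l
  proof -
    have "E l = (\<Union>t\<in>dyadic_grid 0 N l. {\<omega> \<in> space M. L t \<omega> \<notin> ?K})" by (auto simp: E_def)
    then show ?thesis using fin[of l] nonneg L_dual_ball_event by auto
  qed
  have "E l = {\<omega> \<in> space M. \<exists>j\<in>{0..N * 2 ^ l}. L (real j / 2 ^ l) \<omega> \<notin> ?K}" for l
  proof -
    have "dyadic_grid 0 N l = (\<lambda>j. real j / 2 ^ l) ` {0..N * 2 ^ l}" by (auto simp: dyadic_grid_def)
    then show ?thesis by (simp add: E_def)
  qed
  moreover have "prob {\<omega> \<in> space M. \<exists>j\<in>{0..N * 2 ^ l}. L (real j / 2 ^ l) \<omega> \<notin> ?K} \<le> 2 * \<alpha>" for l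
    by (rule grid) (auto simp: divide_strict_right_mono)
  ultimately have E_prob: "prob (E l) \<le> 2 * \<alpha>" for l by simp
  have E_mono: "incseq E"
  proof (rule monoI)
    fix l l' :: nat assume "l \<le> l'"
    then have "dyadic_grid 0 N l \<subseteq> dyadic_grid 0 N l'" by (rule incseqD[OF incseq_dyadic_grid])
    then show "E l \<subseteq> E l'" by (auto simp: E_def)
  qed
  have E_Un: "(\<Union>l. E l) = {\<omega> \<in> space M. \<exists>t\<in>dyadic_times \<inter> {..real N}. L t \<omega> \<notin> ?K}"
  proof -
    have "dyadic_times \<inter> {..real N} = (\<Union>l. dyadic_grid 0 N l)" using Union_dyadic_grid[of 0 N] by simp
    then show ?thesis by (auto simp: E_def)
  qed
  have "(\<lambda>l. prob (E l)) \<longlonglongrightarrow> prob (\<Union>l. E l)"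
    using E_ev E_mono by (intro finite_Lim_measure_incseq) auto
  then have "prob (\<Union>l. E l) \<le> 2 * \<alpha>" using E_prob by (intro LIMSEQ_le_const2) auto
  then have 1: "prob {\<omega> \<in> space M. \<exists>t\<in>dyadic_times \<inter> {..real N}. L t \<omega> \<notin> ?K} \<le> \<delta>"
    using \<alpha>(3) unfolding E_Un by simp
  have 2: "prob {\<omega> \<in> space M. L t \<omega> \<notin> ?K} \<le> \<delta>" if s: "0 \<le> t" "t \<le> real N" for t
  proof -
    have ev: "{\<omega> \<in> space M. L t \<omega> \<notin> ?K} \<in> events" by (rule L_dual_ball_event[OF s(1)])
    \<comment> \<open>Grids increase strictly from 0, so the grid consists of 0 and
      \<open>t\<close>, or of 0 alone if \<open>t = 0\<close>.\<close>
    define \<tau> where "\<tau> i = (if i = 0 then 0 else if t = 0 then 1 else t)" for i :: nat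
    define n where "n = (if t = 0 then 0 else 1 :: nat)"
    have "prob {\<omega> \<in> space M. \<exists>j\<in>{0..n}. L (\<tau> j) \<omega> \<notin> ?K} \<le> 2 * \<alpha>"
      using s by (intro grid) (auto simp: \<tau>_def n_def split: if_splits)
    moreover have "prob {\<omega> \<in> space M. L t \<omega> \<notin> ?K} \<le> prob {\<omega> \<in> space M. \<exists>j\<in>{0..n}. L (\<tau> j) \<omega> \<notin> ?K}"
    proof (rule finite_measure_mono)
      have "\<tau> n = t" by (auto simp: \<tau>_def n_def)
      then show "{\<omega> \<in> space M. L t \<omega> \<notin> ?K} \<subseteq> {\<omega> \<in> space M. \<exists>j\<in>{0..n}. L (\<tau> j) \<omega> \<notin> ?K}"
        by (auto intro!: bexI[of _ n])
      have "{\<omega> \<in> space M. \<exists>j\<in>{0..n}. L (\<tau> j) \<omega> \<notin> ?K} = (\<Union>j\<in>{0..n}. {\<omega> \<in> space M. L (\<tau> j) \<omega> \<notin> ?K})" by auto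
      also have "\<dots> \<in> events"
        using s by (intro sets.finite_UN L_dual_ball_event) (auto simp: \<tau>_def)
      finally show "{\<omega> \<in> space M. \<exists>j\<in>{0..n}. L (\<tau> j) \<omega> \<notin> ?K} \<in> events" .
    qed
    ultimately show ?thesis using \<alpha>(3) by linarith
  qed
  have "{\<omega> \<in> space M. \<exists>t\<in>dyadic_times \<inter> {..real N}. L t \<omega> \<notin> ?K} \<in> events"
    unfolding E_Un[symmetric] using E_ev by auto
  then show thesis using that[of G "2 * C"] G(1-3) 1 2 by auto
qed

text \<open>Tail probabilities of at most 1/4 over one cell of the mesh give at most
  \<open>(1 / 2) ^ k\<close> for \<open>k\<close> oscillations on every refinement, hence also on
  the union of all refinements. A path with arbitrarily many oscillations lies in all these events.
  The threshold is \<open>c / 4\<close> because \<open>oscillation_bound\<close> loses a factor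
  4.\<close>

lemma oscillations_finite:
  assumes c: "c > 0" and w: "\<And>s. 0 \<le> s \<Longrightarrow> s \<le> 1 / 2 ^ w \<Longrightarrow> prob {\<omega> \<in> space M. c / 4 \<le> \<bar>L s \<omega> \<phi>\<bar>} \<le> 1 / 4"
  shows "AE \<omega> in M. \<exists>k. \<not> oscs (dyadic_times \<inter> {..real (Suc a) / 2 ^ w}) (\<lambda>t. L t \<omega> \<phi>) c k (real a / 2 ^ w)"
proof -
  define E where "E k l = {\<omega> \<in> space M. oscs (dyadic_grid w (Suc a) l) (\<lambda>t. L t \<omega> \<phi>) c k (real a / 2 ^ w)}" for k l
  have E: "E k l \<in> events \<and> prob (E k l) \<le> (1 / 2) ^ k" for k l
  proof -
    let ?t = "\<lambda>i::nat. real i / 2 ^ (w + l)" and ?n = "Suc a * 2 ^ l" and ?a = "a * 2 ^ l"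
    interpret Z: indep_increments M "\<lambda>i \<omega> _. incr (?t i) (?t (Suc i)) \<omega> \<phi>" ?n
      by (intro grid_increments[where x = "\<lambda>_. \<phi>"]) (auto simp: divide_strict_right_mono)
    have an: "?a \<le> ?n" by simp
    have ta: "real a / 2 ^ w = real ?a / 2 ^ (w + l)" by (simp add: power_add)
    have eq: "E k l = {\<omega> \<in> space M. oscillates {0} (4 * (c / 4)) k ?a ?n (\<lambda>i _. incr (?t i) (?t (Suc i)) \<omega> \<phi>)}"
      unfolding E_def dyadic_grid_def ta oscs_grid[OF an, where l = 0] by simp
    have "prob (E k l) \<le> (2 * (1 / 4)) ^ k"
      unfolding eq
    proof (rule Z.oscillation_bound[OF _ _ _ an])
      fix i j assume ij: "?a \<le> i" "i \<le> j" "j \<le> ?n"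
      have st: "0 \<le> ?t i" "?t i \<le> ?t j" using ij(2) by (auto simp: divide_right_mono)
      have d: "real j - real i \<le> 2 ^ l"
      proof -
        have "real j \<le> real ?n" "real ?a \<le> real i" using ij by (metis of_nat_le_iff)+
        then show ?thesis by (simp add: algebra_simps)
      qed
      have le: "?t j - ?t i \<le> 1 / 2 ^ w"
      proof -
        have "?t j - ?t i = (real j - real i) / 2 ^ (w + l)" by (simp add: diff_divide_distrib)
        also have "\<dots> \<le> 2 ^ l / 2 ^ (w + l)" using d by (intro divide_right_mono) auto
        finally show ?thesis by (simp add: power_add)
      qed
      have "prob {\<omega> \<in> space M. c / 4 \<le> L2_set (\<lambda>_. L (?t j - ?t i) \<omega> \<phi>) {0::nat}} \<le> 1 / 4"
        using w[of "?t j - ?t i"] st(2) le by (simp add: L2_set_def)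
      then show "prob {\<omega> \<in> space M. c / 4 \<le> incr_norm {0} i j (\<lambda>i _. incr (?t i) (?t (Suc i)) \<omega> \<phi>)} \<le> 1 / 4"
        unfolding grid_incr_norm[where x = "\<lambda>_. \<phi>" and t = ?t, OF ij(2)] incr_L2_prob[where x = "\<lambda>_. \<phi>", OF st] .
    qed auto
    moreover have "E k l \<in> events" unfolding eq by (rule Z.past_event[OF Z.past_oscillates[OF an]]) simp
    ultimately show ?thesis by simp
  qed
  have E_mono: "incseq (E k)" for k
  proof (rule monoI)
    fix l l' :: nat assume "l \<le> l'"
    then have "dyadic_grid w (Suc a) l \<subseteq> dyadic_grid w (Suc a) l'" by (rule incseqD[OF incseq_dyadic_grid])
    then show "E k l \<subseteq> E k l'" by (auto simp: E_def intro: oscs_mono)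
  qed
  have E_Un: "(\<Union>l. E k l) = {\<omega> \<in> space M. oscs (dyadic_times \<inter> {..real (Suc a) / 2 ^ w}) (\<lambda>t. L t \<omega> \<phi>) c k (real a / 2 ^ w)}" for k
    unfolding E_def Union_dyadic_grid[symmetric]
  proof (intro set_eqI iffI)
    fix \<omega> assume "\<omega> \<in> {\<omega> \<in> space M. oscs (\<Union>l. dyadic_grid w (Suc a) l) (\<lambda>t. L t \<omega> \<phi>) c k (real a / 2 ^ w)}"
    then show "\<omega> \<in> (\<Union>l. {\<omega> \<in> space M. oscs (dyadic_grid w (Suc a) l) (\<lambda>t. L t \<omega> \<phi>) c k (real a / 2 ^ w)})"
      using oscs_Union[OF incseq_dyadic_grid, of w "Suc a" "\<lambda>t. L t \<omega> \<phi>" c k "real a / 2 ^ w"] by simp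
  next
    fix \<omega> assume "\<omega> \<in> (\<Union>l. {\<omega> \<in> space M. oscs (dyadic_grid w (Suc a) l) (\<lambda>t. L t \<omega> \<phi>) c k (real a / 2 ^ w)})"
    then obtain l where l: "\<omega> \<in> space M" "oscs (dyadic_grid w (Suc a) l) (\<lambda>t. L t \<omega> \<phi>) c k (real a / 2 ^ w)" by blast
    then show "\<omega> \<in> {\<omega> \<in> space M. oscs (\<Union>l. dyadic_grid w (Suc a) l) (\<lambda>t. L t \<omega> \<phi>) c k (real a / 2 ^ w)}"
      by (auto intro: oscs_mono[OF l(2)])
  qed
  have Un: "(\<Union>l. E k l) \<in> events" "prob (\<Union>l. E k l) \<le> (1 / 2) ^ k" for k
  proof -
    show "(\<Union>l. E k l) \<in> events" using E by auto
    have "(\<lambda>l. prob (E k l)) \<longlonglongrightarrow> prob (\<Union>l. E k l)"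
      using E E_mono by (intro finite_Lim_measure_incseq) auto
    then show "prob (\<Union>l. E k l) \<le> (1 / 2) ^ k" using E by (intro LIMSEQ_le_const2) auto
  qed
  define B where "B = (\<Inter>k. \<Union>l. E k l)"
  have B: "B \<in> events" unfolding B_def using Un(1) by auto
  have "prob B \<le> (1 / 2) ^ k" for k
    using finite_measure_mono[of B "\<Union>l. E k l"] Un[of k] by (fastforce simp: B_def)
  then have "prob B \<le> 0" using LIMSEQ_realpow_zero[of "1 / 2 :: real"] by (intro LIMSEQ_le_const) auto
  then have "AE \<omega> in M. \<omega> \<notin> B" using B by (simp add: prob_eq_0 measure_le_0_iff)
  then show ?thesis
    using AE_space by eventually_elim (auto simp: B_def E_Un)
qed

lemma one_sided_limits:
  "AE \<omega> in M. \<forall>\<epsilon>>0. (\<forall>t\<ge>0. \<exists>\<delta>>0. \<forall>s\<in>dyadic_times. \<forall>u\<in>dyadic_times. t < s \<and> s \<le> u \<and> u < t + \<delta> \<longrightarrow> \<bar>L u \<omega> \<phi> - L s \<omega> \<phi>\<bar> < \<epsilon>)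
     \<and> (\<forall>t>0. \<exists>\<delta>>0. \<forall>s\<in>dyadic_times. \<forall>u\<in>dyadic_times. t - \<delta> < s \<and> s \<le> u \<and> u < t \<longrightarrow> \<bar>L u \<omega> \<phi> - L s \<omega> \<phi>\<bar> < \<epsilon>)"
proof -
  have "\<exists>w. \<forall>s. 0 \<le> s \<and> s \<le> 1 / 2 ^ w \<longrightarrow> prob {\<omega> \<in> space M. (1 / Suc n) / 4 \<le> \<bar>L s \<omega> \<phi>\<bar>} \<le> 1 / 4" for n
  proof -
    obtain h where h: "h > 0" "\<And>s. 0 \<le> s \<Longrightarrow> s \<le> h \<Longrightarrow> prob {\<omega> \<in> space M. (1 / Suc n) / 4 \<le> \<bar>L s \<omega> \<phi>\<bar>} \<le> 1 / 4"
      using small_time_prob[of "(1 / Suc n) / 4" "1 / 4" \<phi>] by auto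
    obtain w where "(1 / 2 :: real) ^ w < h" using real_arch_pow_inv[OF h(1), of "1 / 2"] by auto
    then have "1 / 2 ^ w \<le> h" by (simp add: power_divide)
    then show ?thesis using h(2) by (meson order_trans)
  qed
  then obtain w where w: "\<And>n s. 0 \<le> s \<Longrightarrow> s \<le> 1 / 2 ^ w n \<Longrightarrow> prob {\<omega> \<in> space M. (1 / Suc n) / 4 \<le> \<bar>L s \<omega> \<phi>\<bar>} \<le> 1 / 4"
    by metis
  have "AE \<omega> in M. \<forall>n a. \<exists>k. \<not> oscs (dyadic_times \<inter> {..real (Suc a) / 2 ^ w n}) (\<lambda>t. L t \<omega> \<phi>) (1 / Suc n) k (real a / 2 ^ w n)"
    unfolding AE_all_countable using w by (intro allI oscillations_finite) auto
  then show ?thesis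
  proof eventually_elim
    case (elim \<omega>)
    show ?case
    proof (intro allI impI conjI)
      fix \<epsilon> t :: real assume "\<epsilon> > 0" and t: "t \<ge> 0"
      obtain n where n: "1 / real (Suc n) < \<epsilon>" using nat_approx_posE[OF \<open>\<epsilon> > 0\<close>] by auto
      \<comment> \<open>The cell contains \<open>t\<close> and extends strictly beyond it, as a
        right limit requires.\<close>
      define a where "a = nat \<lfloor>t * 2 ^ w n\<rfloor>"
      have a: "real a \<le> t * 2 ^ w n" "t * 2 ^ w n < real (Suc a)"
        using t by (auto simp: a_def) linarith+
      have a': "real a / 2 ^ w n \<le> t" "t < real (Suc a) / 2 ^ w n" using a by (auto simp: field_simps)
      obtain k where k: "\<not> oscs (dyadic_times \<inter> {..real (Suc a) / 2 ^ w n}) (\<lambda>t. L t \<omega> \<phi>) (1 / Suc n) k (real a / 2 ^ w n)"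
        using elim by blast
      show "\<exists>\<delta>>0. \<forall>s\<in>dyadic_times. \<forall>u\<in>dyadic_times. t < s \<and> s \<le> u \<and> u < t + \<delta> \<longrightarrow> \<bar>L u \<omega> \<phi> - L s \<omega> \<phi>\<bar> < \<epsilon>"
      proof (rule ccontr)
        assume neg: "\<not> ?thesis"
        have "\<exists>s\<in>dyadic_times. \<exists>u\<in>dyadic_times. t < s \<and> s \<le> u \<and> u < t + \<delta> \<and> 1 / Suc n \<le> \<bar>L u \<omega> \<phi> - L s \<omega> \<phi>\<bar>" if "\<delta> > 0" for \<delta>
        proof -
          obtain s u where su: "s \<in> dyadic_times" "u \<in> dyadic_times" "t < s \<and> s \<le> u \<and> u < t + \<delta>" "\<not> \<bar>L u \<omega> \<phi> - L s \<omega> \<phi>\<bar> < \<epsilon>"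
            using neg \<open>\<delta> > 0\<close> by blast
          then show ?thesis using n by (intro bexI[of _ s] bexI[of _ u]) auto
        qed
        from oscs_right[OF this a'(2,1)] show False using k by blast
      qed
    next
      fix \<epsilon> t :: real assume "\<epsilon> > 0" and t: "t > 0"
      obtain n where n: "1 / real (Suc n) < \<epsilon>" using nat_approx_posE[OF \<open>\<epsilon> > 0\<close>] by auto
      \<comment> \<open>Ceiling minus one instead of the floor: for a left limit the cell must begin
        strictly before \<open>t\<close>, also when \<open>t\<close> is a grid point.\<close>
      define a where "a = nat (\<lceil>t * 2 ^ w n\<rceil> - 1)"
      have "0 < t * 2 ^ w n" using t by simp
      then have a: "real a < t * 2 ^ w n" "t * 2 ^ w n \<le> real (Suc a)"
        by (auto simp: a_def) linarith+
      have a': "real a / 2 ^ w n < t" "t \<le> real (Suc a) / 2 ^ w n" using a by (auto simp: field_simps)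
      obtain k where k: "\<not> oscs (dyadic_times \<inter> {..real (Suc a) / 2 ^ w n}) (\<lambda>t. L t \<omega> \<phi>) (1 / Suc n) k (real a / 2 ^ w n)"
        using elim by blast
      show "\<exists>\<delta>>0. \<forall>s\<in>dyadic_times. \<forall>u\<in>dyadic_times. t - \<delta> < s \<and> s \<le> u \<and> u < t \<longrightarrow> \<bar>L u \<omega> \<phi> - L s \<omega> \<phi>\<bar> < \<epsilon>"
      proof (rule ccontr)
        assume neg: "\<not> ?thesis"
        have "\<exists>s\<in>dyadic_times. \<exists>u\<in>dyadic_times. t - \<delta> < s \<and> s \<le> u \<and> u < t \<and> 1 / Suc n \<le> \<bar>L u \<omega> \<phi> - L s \<omega> \<phi>\<bar>" if "\<delta> > 0" for \<delta>
        proof -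
          obtain s u where su: "s \<in> dyadic_times" "u \<in> dyadic_times" "t - \<delta> < s \<and> s \<le> u \<and> u < t" "\<not> \<bar>L u \<omega> \<phi> - L s \<omega> \<phi>\<bar> < \<epsilon>"
            using neg \<open>\<delta> > 0\<close> by blast
          then show ?thesis using n by (intro bexI[of _ s] bexI[of _ u]) auto
        qed
        from oscs_left[OF this a'(2,1)] show False using k by blast
      qed
    qed
  qed
qed

end

section \<open>Regularization of paths\<close>

text \<open>Total boundedness of \<open>r\<close>-balls for \<open>q\<close> turns closeness at finitely many points into
  uniform closeness.\<close>

lemma bounded_functionals_close:
  assumes f: "linear f" "\<And>v. \<bar>f v\<bar> \<le> c * q v" and g: "linear g" "\<And>v. \<bar>g v\<bar> \<le> c * q v"
    and c: "c > 0" and r: "\<And>v. 0 \<le> r v"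
    and x: "\<And>v. \<exists>a. (\<forall>j<m. \<bar>a j\<bar> \<le> r v) \<and> q (v - (\<Sum>j<(m::nat). a j *\<^sub>R x j)) \<le> \<epsilon> * r v"
    and close: "\<And>j. j < m \<Longrightarrow> \<bar>f (x j) - g (x j)\<bar> \<le> \<eta>"
  shows "\<bar>f v - g v\<bar> \<le> (2 * c * \<epsilon> + real m * \<eta>) * r v"
proof -
  obtain a where a: "\<And>j. j < m \<Longrightarrow> \<bar>a j\<bar> \<le> r v" "q (v - (\<Sum>j<m. a j *\<^sub>R x j)) \<le> \<epsilon> * r v"
    using x[of v] by blast
  let ?w = "\<Sum>j<m. a j *\<^sub>R x j"
  have rest: "\<bar>h (v - ?w)\<bar> \<le> c * (\<epsilon> * r v)" if "\<And>v. \<bar>h v\<bar> \<le> c * q v" for h :: "'a \<Rightarrow> real"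
    by (rule order_trans[OF that mult_left_mono[OF a(2)]]) (use c in simp)
  have "f ?w - g ?w = (\<Sum>j<m. a j * (f (x j) - g (x j)))"
    by (simp add: linear_sum[OF f(1)] linear_cmul[OF f(1)] linear_sum[OF g(1)] linear_cmul[OF g(1)]
        sum_subtractf right_diff_distrib)
  also have "\<bar>\<dots>\<bar> \<le> (\<Sum>j<m. r v * \<eta>)"
    by (rule order_trans[OF sum_abs], rule sum_mono, simp only: abs_mult, rule mult_mono)
      (use a(1) close r in auto)
  finally have "\<bar>f ?w - g ?w\<bar> \<le> real m * \<eta> * r v" by (simp add: mult_ac)
  moreover have "f v - g v = f (v - ?w) - g (v - ?w) + (f ?w - g ?w)"
    by (simp add: linear_diff[OF f(1)] linear_diff[OF g(1)])
  ultimately have "\<bar>f v - g v\<bar> \<le> c * (\<epsilon> * r v) + c * (\<epsilon> * r v) + real m * \<eta> * r v"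
    using rest[OF f(2)] rest[OF g(2)] by linarith
  then show ?thesis by (simp add: algebra_simps)
qed

text \<open>The witnesses of \<open>hs_bounded_totally_bounded\<close> for the errors
  \<open>1 / Suc k\<close>, fixed once so that countably many vectors serve all errors.\<close>

definition approximating_points ::
    "('a::real_vector \<Rightarrow> real) \<Rightarrow> ('a \<Rightarrow> real) \<Rightarrow> (nat \<Rightarrow> nat) \<Rightarrow> (nat \<Rightarrow> nat \<Rightarrow> 'a) \<Rightarrow> bool" where
  "approximating_points r q len x \<longleftrightarrow>
    (\<forall>k v. \<exists>a. (\<forall>j<len k. \<bar>a j\<bar> \<le> r v) \<and> q (v - (\<Sum>j<len k. a j *\<^sub>R x k j)) \<le> 1 / Suc k * r v)"

text \<open>\<open>k\<close> makes the error of approximation and \<open>\<eta>\<close> the error at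
  the points at most \<open>\<epsilon> / 2\<close> each, and neither depends on the functionals.
  Thus on the dual ball of \<open>q\<close> the topology of pointwise convergence is finer than that
  of the dual norm of \<open>r\<close>.\<close>

lemma bounded_functionals_nbhd:
  assumes x: "approximating_points r q len x" and c: "c > 0" and r: "\<And>v. 0 \<le> r v" and \<epsilon>: "\<epsilon> > 0"
  shows "\<exists>k. \<exists>\<eta>>0. \<forall>f g. linear f \<and> (\<forall>v. \<bar>f v\<bar> \<le> c * q v) \<and> linear g \<and> (\<forall>v. \<bar>g v\<bar> \<le> c * q v) \<and>
      (\<forall>j<len k. \<bar>f (x k j) - g (x k j)\<bar> \<le> \<eta>) \<longrightarrow> (\<forall>v. \<bar>f v - g v\<bar> \<le> \<epsilon> * r v)"
proof -
  obtain k where k: "1 / real (Suc k) < \<epsilon> / (4 * c)" using nat_approx_posE[of "\<epsilon> / (4 * c)"] \<epsilon> c by auto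
  define \<eta> where "\<eta> = \<epsilon> / (2 * (real (len k) + 1))"
  have \<eta>: "\<eta> > 0" using \<epsilon> by (simp add: \<eta>_def)
  have xk: "\<exists>a. (\<forall>j<len k. \<bar>a j\<bar> \<le> r v) \<and> q (v - (\<Sum>j<len k. a j *\<^sub>R x k j)) \<le> 1 / real (Suc k) * r v" for v
    using x unfolding approximating_points_def by blast
  have "2 * c * (1 / real (Suc k)) \<le> \<epsilon> / 2" using k c by (simp add: field_simps)
  moreover have "real (len k) * \<eta> \<le> \<epsilon> / 2" using \<epsilon> by (simp add: \<eta>_def field_simps)
  ultimately have sum: "2 * c * (1 / real (Suc k)) + real (len k) * \<eta> \<le> \<epsilon>" by simp
  show ?thesis
  proof (intro exI conjI allI impI)
    show "\<eta> > 0" by (rule \<eta>)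
    fix f g :: "'a \<Rightarrow> real" and v
    assume fg: "linear f \<and> (\<forall>v. \<bar>f v\<bar> \<le> c * q v) \<and> linear g \<and> (\<forall>v. \<bar>g v\<bar> \<le> c * q v) \<and>
      (\<forall>j<len k. \<bar>f (x k j) - g (x k j)\<bar> \<le> \<eta>)"
    have "\<bar>f v - g v\<bar> \<le> (2 * c * (1 / real (Suc k)) + real (len k) * \<eta>) * r v"
      by (rule bounded_functionals_close[OF _ _ _ _ c r xk]) (use fg in auto)
    also have "\<dots> \<le> \<epsilon> * r v" using sum r by (rule mult_right_mono)
    finally show "\<bar>f v - g v\<bar> \<le> \<epsilon> * r v" .
  qed
qed

text \<open>Countably many vectors separate the functionals of one dual ball, although they need not
  separate those of the whole dual.\<close>

lemma bounded_functionals_eq: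
  assumes x: "approximating_points r q len x" and c: "c > 0" and r: "\<And>v. 0 \<le> r v"
    and f: "linear f" "\<And>v. \<bar>f v\<bar> \<le> c * q v" and g: "linear g" "\<And>v. \<bar>g v\<bar> \<le> c * q v"
    and eq: "\<And>k j. j < len k \<Longrightarrow> f (x k j) = g (x k j)"
  shows "f = g"
proof
  fix v
  have "\<bar>f v - g v\<bar> \<le> \<epsilon> * r v" if \<epsilon>: "\<epsilon> > 0" for \<epsilon>
  proof -
    show ?thesis
      using bounded_functionals_nbhd[OF x c r \<epsilon>] f g by (auto simp: eq)
  qed
  note * = this
  show "f v = g v"
  proof (rule ccontr)
    assume "f v \<noteq> g v"
    then have pos: "\<bar>f v - g v\<bar> > 0" by simp
    have "\<bar>f v - g v\<bar> \<le> \<bar>f v - g v\<bar> / (2 * (r v + 1)) * r v" using pos r[of v] by (intro *) (simp add: add_nonneg_pos)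
    also have "\<dots> \<le> \<bar>f v - g v\<bar> / 2"
    proof -
      have "\<bar>f v - g v\<bar> * r v \<le> \<bar>f v - g v\<bar> * (r v + 1)" by (intro mult_left_mono) auto
      then show ?thesis using r[of v] by (simp add: field_simps add_nonneg_pos)
    qed
    finally show False using pos by simp
  qed
qed

text \<open>\<open>N \<delta>\<close> stands for a one-sided \<open>\<delta>\<close>-neighbourhood of a point, \<open>\<sigma>\<close> for a sequence in \<open>A\<close>
  converging to this point from that side.\<close>

lemma one_sided_limit_functional:
  fixes X :: "real \<Rightarrow> 'a::real_vector \<Rightarrow> real" and N :: "real \<Rightarrow> real set"
  assumes x: "approximating_points r q len x" and c: "c > 0" and r: "\<And>v. 0 \<le> r v"
    and X0: "\<forall>s\<in>A. linear (X s) \<and> (\<forall>v. \<bar>X s v\<bar> \<le> c * q v)"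
    and N0: "mono N"
    and pt0: "\<forall>k. \<forall>j<len k. \<forall>\<eta>>0. \<exists>\<delta>>0. \<forall>s\<in>A \<inter> N \<delta>. \<forall>u\<in>A \<inter> N \<delta>. \<bar>X u (x k j) - X s (x k j)\<bar> \<le> \<eta>"
    and \<sigma>0: "\<forall>k. \<sigma> k \<in> A" "\<forall>\<delta>>0. eventually (\<lambda>k. \<sigma> k \<in> N \<delta>) sequentially"
  defines "f \<equiv> \<lambda>v. lim (\<lambda>k. X (\<sigma> k) v)"
  shows "linear f" and "\<And>v. \<bar>f v\<bar> \<le> c * q v" and "\<And>v. (\<lambda>k. X (\<sigma> k) v) \<longlonglongrightarrow> f v"
    and "\<epsilon> > 0 \<Longrightarrow> \<exists>\<delta>>0. \<forall>s\<in>A \<inter> N \<delta>. \<forall>v. \<bar>f v - X s v\<bar> \<le> \<epsilon> * r v"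
proof -
  have X: "linear (X s)" "\<bar>X s v\<bar> \<le> c * q v" if "s \<in> A" for s v using X0 that by auto
  have N: "N \<delta> \<subseteq> N \<delta>'" if "\<delta> \<le> \<delta>'" for \<delta> \<delta>' using N0 that by (rule monoD)
  have pt: "\<exists>\<delta>>0. \<forall>s\<in>A \<inter> N \<delta>. \<forall>u\<in>A \<inter> N \<delta>. \<bar>X u (x k j) - X s (x k j)\<bar> \<le> \<eta>"
    if "j < len k" "\<eta> > 0" for k j \<eta> using pt0 that by blast
  have \<sigma>: "\<sigma> k \<in> A" "\<delta> > 0 \<Longrightarrow> eventually (\<lambda>k. \<sigma> k \<in> N \<delta>) sequentially" for k \<delta> using \<sigma>0 by auto
  have Cauchy: "\<exists>\<delta>>0. \<forall>s\<in>A \<inter> N \<delta>. \<forall>u\<in>A \<inter> N \<delta>. \<forall>v. \<bar>X u v - X s v\<bar> \<le> \<epsilon> * r v" if \<epsilon>: "\<epsilon> > 0" for \<epsilon>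
  proof -
    obtain k \<eta> where \<eta>: "\<eta> > 0" and k:
      "\<forall>f g. linear f \<and> (\<forall>v. \<bar>f v\<bar> \<le> c * q v) \<and> linear g \<and> (\<forall>v. \<bar>g v\<bar> \<le> c * q v) \<and>
      (\<forall>j<len k. \<bar>f (x k j) - g (x k j)\<bar> \<le> \<eta>) \<longrightarrow> (\<forall>v. \<bar>f v - g v\<bar> \<le> \<epsilon> * r v)"
      using bounded_functionals_nbhd[OF x c r \<epsilon>] by blast
    have "\<forall>j\<in>{..<len k}. \<exists>\<delta>>0. \<forall>s\<in>A \<inter> N \<delta>. \<forall>u\<in>A \<inter> N \<delta>. \<bar>X u (x k j) - X s (x k j)\<bar> \<le> \<eta>"
      using pt \<eta> by blast
    then obtain d :: "nat \<Rightarrow> real" where d: "\<And>j. j < len k \<Longrightarrow> d j > 0"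
      "\<And>j s u. j < len k \<Longrightarrow> s \<in> A \<inter> N (d j) \<Longrightarrow> u \<in> A \<inter> N (d j) \<Longrightarrow> \<bar>X u (x k j) - X s (x k j)\<bar> \<le> \<eta>"
      by (metis lessThan_iff)
    \<comment> \<open>The element 1 keeps the set nonempty when \<open>len k = 0\<close>.\<close>
    define \<delta> where "\<delta> = Min (insert 1 (d ` {..<len k}))"
    have \<delta>: "\<delta> > 0" using d(1) by (auto simp: \<delta>_def)
    have sub: "N \<delta> \<subseteq> N (d j)" if "j < len k" for j
      using that by (intro N) (auto simp: \<delta>_def)
    have "\<bar>X u v - X s v\<bar> \<le> \<epsilon> * r v" if su: "s \<in> A \<inter> N \<delta>" "u \<in> A \<inter> N \<delta>" for s u v
    proof -
      have "\<bar>X u (x k j) - X s (x k j)\<bar> \<le> \<eta>" if j: "j < len k" for j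
        using su sub[OF j] by (intro d(2)[OF j]) auto
      then show ?thesis using k[THEN spec, THEN spec, of "X u" "X s"] su X by auto
    qed
    then show ?thesis using \<delta> by blast
  qed
  have conv: "(\<lambda>k. X (\<sigma> k) v) \<longlonglongrightarrow> f v" for v
  proof -
    have "Cauchy (\<lambda>k. X (\<sigma> k) v)"
      unfolding Cauchy_iff real_norm_def
    proof (intro allI impI)
      fix e :: real assume e: "e > 0"
      have rv: "0 < r v + 1" using r[of v] by simp
      define \<epsilon> where "\<epsilon> = e / (2 * (r v + 1))"
      have \<epsilon>: "\<epsilon> > 0" "\<epsilon> * r v < e"
      proof -
        show "\<epsilon> > 0" using e rv by (simp add: \<epsilon>_def)
        then have "\<epsilon> * r v \<le> \<epsilon> * (r v + 1)" by (intro mult_left_mono) auto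
        also have "\<dots> = e / 2" using rv by (simp add: \<epsilon>_def field_simps)
        finally show "\<epsilon> * r v < e" using e by simp
      qed
      obtain \<delta> where \<delta>: "\<delta> > 0" "\<And>s u v. s \<in> A \<inter> N \<delta> \<Longrightarrow> u \<in> A \<inter> N \<delta> \<Longrightarrow> \<bar>X u v - X s v\<bar> \<le> \<epsilon> * r v"
        using Cauchy[OF \<epsilon>(1)] by blast
      obtain K where K: "\<And>k. k \<ge> K \<Longrightarrow> \<sigma> k \<in> N \<delta>" using \<sigma>(2)[OF \<delta>(1)] by (auto simp: eventually_sequentially)
      have "\<bar>X (\<sigma> m) v - X (\<sigma> n) v\<bar> < e" if "m \<ge> K" "n \<ge> K" for m n
        using \<delta>(2)[of "\<sigma> n" "\<sigma> m" v] K \<sigma>(1) that \<epsilon>(2) by fastforce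
      then show "\<exists>K. \<forall>m\<ge>K. \<forall>n\<ge>K. \<bar>X (\<sigma> m) v - X (\<sigma> n) v\<bar> < e" by blast
    qed
    then show ?thesis unfolding f_def by (simp add: Cauchy_convergent_iff convergent_LIMSEQ_iff)
  qed
  show "(\<lambda>k. X (\<sigma> k) v) \<longlonglongrightarrow> f v" for v by (rule conv)
  show "linear f"
  proof (rule linearI)
    fix v w
    have "(\<lambda>k. X (\<sigma> k) (v + w)) \<longlonglongrightarrow> f v + f w"
      unfolding linear_add[OF X(1)[OF \<sigma>(1)]] by (intro tendsto_add conv)
    then show "f (v + w) = f v + f w" by (rule LIMSEQ_unique[OF conv])
  next
    fix a v
    have "(\<lambda>k. X (\<sigma> k) (a *\<^sub>R v)) \<longlonglongrightarrow> a * f v"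
      unfolding linear_cmul[OF X(1)[OF \<sigma>(1)]] real_scaleR_def by (intro tendsto_mult_left conv)
    then show "f (a *\<^sub>R v) = a *\<^sub>R f v" unfolding real_scaleR_def by (rule LIMSEQ_unique[OF conv])
  qed
  show "\<bar>f v\<bar> \<le> c * q v" for v
    using X(2)[OF \<sigma>(1)] by (intro LIMSEQ_le_const2[OF tendsto_rabs[OF conv]]) auto
  show "\<exists>\<delta>>0. \<forall>s\<in>A \<inter> N \<delta>. \<forall>v. \<bar>f v - X s v\<bar> \<le> \<epsilon> * r v" if \<epsilon>: "\<epsilon> > 0"
  proof -
    obtain \<delta> where \<delta>: "\<delta> > 0" "\<And>s u v. s \<in> A \<inter> N \<delta> \<Longrightarrow> u \<in> A \<inter> N \<delta> \<Longrightarrow> \<bar>X u v - X s v\<bar> \<le> \<epsilon> * r v"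
      using Cauchy[OF \<epsilon>] by blast
    have "\<bar>f v - X s v\<bar> \<le> \<epsilon> * r v" if s: "s \<in> A \<inter> N \<delta>" for s v
    proof (rule tendsto_upperbound)
      show "(\<lambda>k. \<bar>X (\<sigma> k) v - X s v\<bar>) \<longlonglongrightarrow> \<bar>f v - X s v\<bar>" by (intro tendsto_intros conv)
      show "eventually (\<lambda>k. \<bar>X (\<sigma> k) v - X s v\<bar> \<le> \<epsilon> * r v) sequentially"
        using \<sigma>(2)[OF \<delta>(1)] by eventually_elim (use \<sigma>(1) in \<open>auto intro!: \<delta>(2) s\<close>)
    qed simp
    then show ?thesis using \<delta>(1) by blast
  qed
qed

text \<open>Adding 1 after the floor puts the point strictly after \<open>t\<close>, even at a
  dyadic \<open>t\<close>: a right limit must not see the value at \<open>t\<close> itself.\<close>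

definition dyadic_above :: "nat \<Rightarrow> real \<Rightarrow> real" where
  "dyadic_above k t = real (nat \<lfloor>t * 2 ^ k\<rfloor> + 1) / 2 ^ k"

text \<open>For \<open>t > 0\<close> the ceiling is at least 1, so \<open>nat\<close> does not
  truncate, and the point is nonnegative and strictly before \<open>t\<close>.\<close>

definition dyadic_below :: "nat \<Rightarrow> real \<Rightarrow> real" where
  "dyadic_below k t = real (nat (\<lceil>t * 2 ^ k\<rceil> - 1)) / 2 ^ k"

lemma dyadic_above:
  assumes "t \<ge> 0"
  shows "dyadic_above k t \<in> dyadic_times" "t < dyadic_above k t" "dyadic_above k t \<le> t + 1 / 2 ^ k"
proof -
  have fl: "real (nat \<lfloor>t * 2 ^ k\<rfloor>) \<le> t * 2 ^ k" "t * 2 ^ k < real (nat \<lfloor>t * 2 ^ k\<rfloor>) + 1"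
    using assms by (auto simp: of_nat_nat)
  show "dyadic_above k t \<in> dyadic_times" unfolding dyadic_above_def dyadic_times_def by blast
  show "t < dyadic_above k t" using fl(2) by (simp add: dyadic_above_def field_simps)
  show "dyadic_above k t \<le> t + 1 / 2 ^ k" using fl(1) by (simp add: dyadic_above_def field_simps)
qed

lemma dyadic_below:
  assumes "t > 0"
  shows "dyadic_below k t \<in> dyadic_times" "dyadic_below k t < t" "t - 1 / 2 ^ k \<le> dyadic_below k t"
proof -
  have "0 < t * 2 ^ k" using assms by simp
  then have "1 \<le> \<lceil>t * 2 ^ k\<rceil>" by linarith
  then have eq: "real (nat (\<lceil>t * 2 ^ k\<rceil> - 1)) = real_of_int \<lceil>t * 2 ^ k\<rceil> - 1" by (simp add: of_nat_nat)
  have fl: "real (nat (\<lceil>t * 2 ^ k\<rceil> - 1)) < t * 2 ^ k" "t * 2 ^ k \<le> real (nat (\<lceil>t * 2 ^ k\<rceil> - 1)) + 1"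
    unfolding eq by linarith+
  show "dyadic_below k t \<in> dyadic_times" unfolding dyadic_below_def dyadic_times_def by blast
  show "dyadic_below k t < t" using fl(1) by (simp add: dyadic_below_def field_simps)
  have "t \<le> (real (nat (\<lceil>t * 2 ^ k\<rceil> - 1)) + 1) / 2 ^ k" using fl(2) by (simp add: pos_le_divide_eq)
  then show "t - 1 / 2 ^ k \<le> dyadic_below k t" by (simp add: dyadic_below_def add_divide_distrib)
qed

lemma eventually_power_half_less: "\<delta> > 0 \<Longrightarrow> eventually (\<lambda>k. 1 / 2 ^ k < (\<delta>::real)) sequentially"
  using order_tendstoD(2)[OF LIMSEQ_realpow_zero[of "1 / 2 :: real"], of \<delta>] by (simp add: power_divide)

lemma eventually_dyadic_above:
  assumes "t \<ge> 0" "\<delta> > 0"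
  shows "eventually (\<lambda>k. dyadic_above k t \<in> {t<..<t + \<delta>}) sequentially"
  using eventually_power_half_less[OF assms(2)]
proof eventually_elim
  case (elim k)
  then show ?case using dyadic_above(2,3)[OF assms(1), of k] by simp
qed

lemma eventually_dyadic_below:
  assumes "t > 0" "\<delta> > 0"
  shows "eventually (\<lambda>k. dyadic_below k t \<in> {t - \<delta><..<t}) sequentially"
  using eventually_power_half_less[OF assms(2)]
proof eventually_elim
  case (elim k)
  then show ?case using dyadic_below(2,3)[OF assms(1), of k] by simp
qed

section \<open>Almost sure modifications on a complete space\<close>

lemma (in complete_measure) complete_AE_event:
  assumes P: "{\<omega> \<in> space M. P \<omega>} \<in> sets M" and AE: "AE \<omega> in M. P \<omega> \<longleftrightarrow> Q \<omega>"
  shows "{\<omega> \<in> space M. Q \<omega>} \<in> sets M"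
proof -
  let ?N = "{\<omega> \<in> space M. \<not> (P \<omega> \<longleftrightarrow> Q \<omega>)}"
  have N: "?N \<in> null_sets M" using AE by (simp add: AE_iff_null_sets)
  have "?N \<inter> {\<omega> \<in> space M. Q \<omega>} \<in> null_sets M" by (rule complete2[OF _ N]) auto
  then have "({\<omega> \<in> space M. P \<omega>} - ?N) \<union> (?N \<inter> {\<omega> \<in> space M. Q \<omega>}) \<in> sets M"
    using P N by auto
  moreover have "({\<omega> \<in> space M. P \<omega>} - ?N) \<union> (?N \<inter> {\<omega> \<in> space M. Q \<omega>}) = {\<omega> \<in> space M. Q \<omega>}" by auto
  ultimately show ?thesis by simp
qed

text \<open>The preimages of a set under \<open>f\<close> and \<open>g\<close> differ inside a null
  set, all of whose subsets are measurable by completeness.\<close>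

lemma (in complete_measure) complete_AE_measurable:
  assumes f: "f \<in> M \<rightarrow>\<^sub>M N" and AE: "AE \<omega> in M. f \<omega> = g \<omega>" and g: "\<And>\<omega>. \<omega> \<in> space M \<Longrightarrow> g \<omega> \<in> space N"
  shows "g \<in> M \<rightarrow>\<^sub>M N"
proof (rule measurableI[OF g])
  fix A assume A: "A \<in> sets N"
  have "{\<omega> \<in> space M. f \<omega> \<in> A} \<in> sets M"
    using measurable_sets[OF f A] by (simp add: vimage_def Int_def conj_commute)
  moreover have "AE \<omega> in M. f \<omega> \<in> A \<longleftrightarrow> g \<omega> \<in> A" using AE by eventually_elim simp
  ultimately have "{\<omega> \<in> space M. g \<omega> \<in> A} \<in> sets M" by (rule complete_AE_event)
  then show "g -` A \<inter> space M \<in> sets M" by (simp add: vimage_def Int_def conj_commute)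
qed

text \<open>Independence of finitely many variables is a statement about their joint law and their
  single laws, which do not change when the variables change on null sets.\<close>

lemma (in prob_space) indep_vars_cong_AE:
  assumes X: "indep_vars N X I" and Y: "\<And>i. i \<in> I \<Longrightarrow> Y i \<in> M \<rightarrow>\<^sub>M N i"
    and AE: "\<And>i. i \<in> I \<Longrightarrow> AE \<omega> in M. X i \<omega> = Y i \<omega>" and I: "finite I"
  shows "indep_vars N Y I"
proof (cases "I = {}")
  case True
  then show ?thesis using X by (simp add: indep_vars_def indep_sets_def)
next
  case False
  have X': "X i \<in> M \<rightarrow>\<^sub>M N i" if "i \<in> I" for i using X that by (simp add: indep_vars_def)
  have "AE \<omega> in M. \<forall>i\<in>I. X i \<omega> = Y i \<omega>" using AE I by (simp add: AE_ball_countable countable_finite)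
  then have joint: "distr M (PiM I N) (\<lambda>\<omega>. \<lambda>i\<in>I. X i \<omega>) = distr M (PiM I N) (\<lambda>\<omega>. \<lambda>i\<in>I. Y i \<omega>)"
    using X' Y by (intro distr_cong_AE) (auto elim!: eventually_mono intro!: measurable_restrict)
  have single: "distr M (N i) (X i) = distr M (N i) (Y i)" if "i \<in> I" for i
    using that by (intro distr_cong_AE AE X' Y) auto
  have "distr M (PiM I N) (\<lambda>\<omega>. \<lambda>i\<in>I. X i \<omega>) = PiM I (\<lambda>i. distr M (N i) (X i))"
    using X indep_vars_iff_distr_eq_PiM'[OF False X'] by simp
  also have "\<dots> = PiM I (\<lambda>i. distr M (N i) (Y i))" using single by (intro PiM_cong) auto
  finally show ?thesis
    unfolding joint using indep_vars_iff_distr_eq_PiM'[OF False Y] by simp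
qed

text \<open>The choices made once before the version is built. For each \<open>n\<close> there is a
  ball that contains the values at dyadic times up to \<open>n\<close> with probability at least
  \<open>1 - (1 / 2) ^ n\<close>, together with vectors that test closeness of functionals of this
  ball in the dual norm of \<open>Psum (H n)\<close>.\<close>

locale regularization = nuclear_levy P M L
  for P :: "('a::real_vector \<Rightarrow> real) set" and M :: "'w measure" and L +
  fixes G H :: "nat \<Rightarrow> ('a \<Rightarrow> real) set" and c :: "nat \<Rightarrow> real"
    and len :: "nat \<Rightarrow> nat \<Rightarrow> nat" and x :: "nat \<Rightarrow> nat \<Rightarrow> nat \<Rightarrow> 'a"
  assumes H: "\<And>n. finite (H n)" "\<And>n. H n \<subseteq> P" and GH: "\<And>n. G n \<subseteq> H n" and c: "\<And>n. c n > 0"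
    and path_event: "\<And>n. {\<omega> \<in> space M. \<exists>t\<in>dyadic_times \<inter> {..real n}. L t \<omega> \<notin> dual_ball (Psum (G n)) (c n)} \<in> events"
    and path_prob: "\<And>n. prob {\<omega> \<in> space M. \<exists>t\<in>dyadic_times \<inter> {..real n}. L t \<omega> \<notin> dual_ball (Psum (G n)) (c n)} \<le> (1 / 2) ^ n"
    and time_prob: "\<And>n t. 0 \<le> t \<Longrightarrow> t \<le> real n \<Longrightarrow> prob {\<omega> \<in> space M. L t \<omega> \<notin> dual_ball (Psum (G n)) (c n)} \<le> (1 / 2) ^ n"
    and points: "\<And>n. approximating_points (Psum (H n)) (Psum (G n)) (len n) (x n)"
begin

text \<open>Unions of the \<open>H k\<close> make the sequence increasing. It generates the
  countably Hilbertian topology of the theorem.\<close>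

definition pp :: "nat \<Rightarrow> 'a \<Rightarrow> real" where
  "pp n = Psum (\<Union>k\<le>n. H k)"

definition dball :: "nat \<Rightarrow> ('a \<Rightarrow> real) set" where
  "dball n = dual_ball (Psum (G n)) (c n)"

text \<open>The Cauchy criterion for one-sided limits along the dyadic times.\<close>

definition steady :: "'w \<Rightarrow> 'a \<Rightarrow> bool" where
  "steady \<omega> \<phi> \<longleftrightarrow> (\<forall>\<epsilon>>0.
     (\<forall>t\<ge>0. \<exists>\<delta>>0. \<forall>s\<in>dyadic_times. \<forall>u\<in>dyadic_times. t < s \<and> s \<le> u \<and> u < t + \<delta> \<longrightarrow> \<bar>L u \<omega> \<phi> - L s \<omega> \<phi>\<bar> < \<epsilon>)
     \<and> (\<forall>t>0. \<exists>\<delta>>0. \<forall>s\<in>dyadic_times. \<forall>u\<in>dyadic_times. t - \<delta> < s \<and> s \<le> u \<and> u < t \<longrightarrow> \<bar>L u \<omega> \<phi> - L s \<omega> \<phi>\<bar> < \<epsilon>))"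

definition good :: "'w \<Rightarrow> nat \<Rightarrow> bool" where
  "good \<omega> N \<longleftrightarrow> \<omega> \<in> space M \<and> (\<forall>n\<ge>N. \<forall>t\<in>dyadic_times \<inter> {..real n}. L t \<omega> \<in> dball n) \<and>
     (\<forall>n k. \<forall>j<len n k. steady \<omega> (x n k j))"

definition raw :: "real \<Rightarrow> 'w \<Rightarrow> 'a \<Rightarrow> real" where
  "raw t \<omega> \<phi> = lim (\<lambda>k. L (dyadic_above k t) \<omega> \<phi>)"

text \<open>The value 0 off the good set makes every path cadlag and every value at a time
  \<open>t \<ge> 0\<close> bounded by a multiple of some \<open>pp n\<close>, not only almost
  surely.\<close>

definition L' :: "real \<Rightarrow> 'w \<Rightarrow> 'a \<Rightarrow> real" where
  "L' t \<omega> = (if \<exists>N. good \<omega> N then raw t \<omega> else (\<lambda>_. 0))"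

lemma pp_set: "finite (\<Union>k\<le>n. H k)" "(\<Union>k\<le>n. H k) \<subseteq> P"
  using H by auto

lemma pp_hilbertian: "hilbertian (pp n)"
  unfolding pp_def by (intro Psum_hilbertian pp_set)

lemma pp_seminorm: "is_seminorm (pp n)"
  by (intro hilbertian_seminorm pp_hilbertian)

lemma pp_nonneg: "0 \<le> pp n v"
  by (simp add: pp_def Psum_nonneg)

lemma pp_continuous: "continuous_map T euclideanreal (pp n)"
  unfolding pp_def by (intro Psum_continuous pp_set)

lemma pp_mono: "m \<le> n \<Longrightarrow> pp m v \<le> pp n v"
  unfolding pp_def by (intro Psum_mono pp_set UN_mono) auto

lemma H_le_pp: "Psum (H n) v \<le> pp n v"
  unfolding pp_def by (intro Psum_mono pp_set) auto

lemma G_le_pp: "Psum (G n) v \<le> pp n v"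
  using Psum_mono[OF GH[of n] H(1)[of n], of v] H_le_pp[of n v] by linarith

lemma good_AE: "AE \<omega> in M. \<exists>N. good \<omega> N"
proof -
  let ?A = "\<lambda>n. {\<omega> \<in> space M. \<exists>t\<in>dyadic_times \<inter> {..real n}. L t \<omega> \<notin> dual_ball (Psum (G n)) (c n)}"
  have "summable (\<lambda>n. (1 / 2 :: real) ^ n)" by (rule summable_geometric) simp
  then have "summable (\<lambda>n. prob (?A n))"
    by (rule summable_comparison_test'[where N = 0]) (simp add: path_prob)
  then have 1: "AE \<omega> in M. eventually (\<lambda>n. \<omega> \<in> space M - ?A n) sequentially"
    using path_event by (intro borel_cantelli_AE1) (auto simp: less_top[symmetric])
  have 2: "AE \<omega> in M. \<forall>n k j. steady \<omega> (x n k j)"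
    unfolding AE_all_countable steady_def using one_sided_limits by blast
  show ?thesis
    using 1 2 AE_space
  proof eventually_elim
    case (elim \<omega>)
    then obtain N where "\<And>n. n \<ge> N \<Longrightarrow> \<omega> \<in> space M - ?A n" by (auto simp: eventually_sequentially)
    then have "good \<omega> N" using elim unfolding good_def dball_def by blast
    then show ?case by blast
  qed
qed

lemma in_ballD: "f \<in> dball n \<Longrightarrow> linear f" "f \<in> dball n \<Longrightarrow> \<bar>f v\<bar> \<le> c n * Psum (G n) v"
  by (auto simp: dball_def dual_ball_def dual_tvs_of)

lemma in_ballI:
  assumes "linear f" "\<And>v. \<bar>f v\<bar> \<le> c n * Psum (G n) v"
  shows "f \<in> dball n"
proof -
  have G: "finite (G n)" "G n \<subseteq> P" using GH[of n] H[of n] finite_subset by auto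
  have "f \<in> dual (tvs_of T)"
    by (rule bounded_linear_in_dual[OF P_seminorm Psum_continuous[OF G(2,1)] Psum_seminorm[OF G(2)] assms])
  then show ?thesis using assms by (simp add: dball_def dual_ball_def)
qed

lemma steadyD:
  assumes "steady \<omega> \<phi>" "\<eta> > 0"
  shows "t \<ge> 0 \<Longrightarrow> \<exists>\<delta>>0. \<forall>s\<in>(dyadic_times \<inter> B) \<inter> {t<..<t + \<delta>}. \<forall>u\<in>(dyadic_times \<inter> B) \<inter> {t<..<t + \<delta>}. \<bar>L u \<omega> \<phi> - L s \<omega> \<phi>\<bar> \<le> \<eta>"
    and "t > 0 \<Longrightarrow> \<exists>\<delta>>0. \<forall>s\<in>(dyadic_times \<inter> B) \<inter> {t - \<delta><..<t}. \<forall>u\<in>(dyadic_times \<inter> B) \<inter> {t - \<delta><..<t}. \<bar>L u \<omega> \<phi> - L s \<omega> \<phi>\<bar> \<le> \<eta>"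
proof -
  note st = assms(1)[unfolded steady_def, THEN spec, THEN mp, OF assms(2)]
  {
    assume t: "t \<ge> 0"
    obtain \<delta> where \<delta>: "\<delta> > 0"
      and d0: "\<forall>s\<in>dyadic_times. \<forall>u\<in>dyadic_times. t < s \<and> s \<le> u \<and> u < t + \<delta> \<longrightarrow> \<bar>L u \<omega> \<phi> - L s \<omega> \<phi>\<bar> < \<eta>"
      using st[THEN conjunct1, THEN spec, THEN mp, OF t] by (elim exE conjE)
    have d: "\<bar>L u \<omega> \<phi> - L s \<omega> \<phi>\<bar> < \<eta>" if "s \<in> dyadic_times" "u \<in> dyadic_times" "t < s \<and> s \<le> u \<and> u < t + \<delta>" for s u
      using d0[THEN bspec, OF that(1), THEN bspec, OF that(2)] that(3) by (rule mp)
    have "\<bar>L u \<omega> \<phi> - L s \<omega> \<phi>\<bar> \<le> \<eta>" if "s \<in> (dyadic_times \<inter> B) \<inter> {t<..<t + \<delta>}" "u \<in> (dyadic_times \<inter> B) \<inter> {t<..<t + \<delta>}" for s u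
      using d[of s u] d[of u s] that by (cases "s \<le> u") auto
    then show "\<exists>\<delta>>0. \<forall>s\<in>(dyadic_times \<inter> B) \<inter> {t<..<t + \<delta>}. \<forall>u\<in>(dyadic_times \<inter> B) \<inter> {t<..<t + \<delta>}. \<bar>L u \<omega> \<phi> - L s \<omega> \<phi>\<bar> \<le> \<eta>"
      using \<delta> by blast
  }
  assume t: "t > 0"
  obtain \<delta> where \<delta>: "\<delta> > 0"
    and d0: "\<forall>s\<in>dyadic_times. \<forall>u\<in>dyadic_times. t - \<delta> < s \<and> s \<le> u \<and> u < t \<longrightarrow> \<bar>L u \<omega> \<phi> - L s \<omega> \<phi>\<bar> < \<eta>"
    using st[THEN conjunct2, THEN spec, THEN mp, OF t] by (elim exE conjE)
  have d: "\<bar>L u \<omega> \<phi> - L s \<omega> \<phi>\<bar> < \<eta>" if "s \<in> dyadic_times" "u \<in> dyadic_times" "t - \<delta> < s \<and> s \<le> u \<and> u < t" for s u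
    using d0[THEN bspec, OF that(1), THEN bspec, OF that(2)] that(3) by (rule mp)
  have "\<bar>L u \<omega> \<phi> - L s \<omega> \<phi>\<bar> \<le> \<eta>" if "s \<in> (dyadic_times \<inter> B) \<inter> {t - \<delta><..<t}" "u \<in> (dyadic_times \<inter> B) \<inter> {t - \<delta><..<t}" for s u
    using d[of s u] d[of u s] that by (cases "s \<le> u") auto
  then show "\<exists>\<delta>>0. \<forall>s\<in>(dyadic_times \<inter> B) \<inter> {t - \<delta><..<t}. \<forall>u\<in>(dyadic_times \<inter> B) \<inter> {t - \<delta><..<t}. \<bar>L u \<omega> \<phi> - L s \<omega> \<phi>\<bar> \<le> \<eta>"
    using \<delta> by blast
qed

context
  fixes \<omega> N assumes good: "good \<omega> N"
begin

lemma good_ball: "n \<ge> N \<Longrightarrow> s \<in> dyadic_times \<inter> {..real n} \<Longrightarrow> L s \<omega> \<in> dball n"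
  using good by (auto simp: good_def)

lemma dyadic_above_le: "0 \<le> t \<Longrightarrow> t + 1 \<le> b \<Longrightarrow> dyadic_above k t \<in> dyadic_times \<inter> {..b}"
proof -
  assume t: "0 \<le> t" "t + 1 \<le> b"
  have "1 / 2 ^ k \<le> (1 :: real)" by simp
  then have "dyadic_above k t \<le> b" using dyadic_above(3)[OF t(1), of k] t(2) by linarith
  then show ?thesis using dyadic_above(1)[OF t(1), of k] by simp
qed

context
  fixes n t assumes n: "n \<ge> N" and t: "0 \<le> t" "t + 1 \<le> real n"
begin

text \<open>The margin \<open>t + 1 \<le> real n\<close> keeps all approximating times
  \<open>dyadic_above k t\<close> inside the interval on which the n-th ball controls the
  path.\<close>

lemma raw_limit:
  shows "raw t \<omega> \<in> dball n" and "(\<lambda>k. L (dyadic_above k t) \<omega> v) \<longlonglongrightarrow> raw t \<omega> v"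
    and "\<epsilon> > 0 \<Longrightarrow> \<exists>\<delta>>0. \<forall>s\<in>dyadic_times \<inter> {..real n} \<inter> {t<..<t + \<delta>}. \<forall>v. \<bar>raw t \<omega> v - L s \<omega> v\<bar> \<le> \<epsilon> * Psum (H n) v"
proof -
  have raw: "raw t \<omega> = (\<lambda>v. lim (\<lambda>k. L (dyadic_above k t) \<omega> v))" by (auto simp: raw_def)
  have lin: "\<forall>s\<in>dyadic_times \<inter> {..real n}. linear (L s \<omega>) \<and> (\<forall>v. \<bar>L s \<omega> v\<bar> \<le> c n * Psum (G n) v)"
    using in_ballD good_ball[OF n] by blast
  have mono: "mono (\<lambda>\<delta>. {t<..<t + \<delta>})" by (rule monoI) auto
  have pt: "\<forall>k. \<forall>j<len n k. \<forall>\<eta>>0. \<exists>\<delta>>0. \<forall>s\<in>dyadic_times \<inter> {..real n} \<inter> {t<..<t + \<delta>}.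
      \<forall>u\<in>dyadic_times \<inter> {..real n} \<inter> {t<..<t + \<delta>}. \<bar>L u \<omega> (x n k j) - L s \<omega> (x n k j)\<bar> \<le> \<eta>"
    using good t(1) by (intro allI impI steadyD(1)) (auto simp: good_def)
  have \<sigma>: "\<forall>k. dyadic_above k t \<in> dyadic_times \<inter> {..real n}"
    "\<forall>\<delta>>0. eventually (\<lambda>k. dyadic_above k t \<in> {t<..<t + \<delta>}) sequentially"
    using dyadic_above_le[OF t] eventually_dyadic_above[OF t(1)] by blast+
  note lim = one_sided_limit_functional[where X = "\<lambda>s. L s \<omega>", OF points c Psum_nonneg lin mono pt \<sigma>, folded raw]
  have raw': "lim (\<lambda>k. L (dyadic_above k t) \<omega> v) = raw t \<omega> v" for v by (simp add: raw_def)
  note lim = lim[unfolded raw']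
  show "raw t \<omega> \<in> dball n" using lim(1,2) by (rule in_ballI)
  show "(\<lambda>k. L (dyadic_above k t) \<omega> v) \<longlonglongrightarrow> raw t \<omega> v" by (rule lim(3))
  show "\<exists>\<delta>>0. \<forall>s\<in>dyadic_times \<inter> {..real n} \<inter> {t<..<t + \<delta>}. \<forall>v. \<bar>raw t \<omega> v - L s \<omega> v\<bar> \<le> \<epsilon> * Psum (H n) v" if "\<epsilon> > 0"
    by (rule lim(4)[OF that])
qed

end

text \<open>For \<open>u\<close> slightly after \<open>t\<close>, \<open>raw u \<omega>\<close> is
  itself a limit of values at dyadic times between \<open>u\<close> and \<open>t + \<delta>\<close>,
  and the closed estimate passes to this limit. The margin is 2 because \<open>u\<close> may be
  almost \<open>t + 1\<close> and its approximating times may be later by 1.\<close>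

lemma raw_right_continuous:
  assumes n: "n \<ge> N" and t: "0 \<le> t" "t + 2 \<le> real n" and \<epsilon>: "\<epsilon> > 0"
  shows "eventually (\<lambda>u. \<forall>v. \<bar>raw u \<omega> v - raw t \<omega> v\<bar> \<le> \<epsilon> * Psum (H n) v) (at_right t)"
proof -
  obtain \<delta> where \<delta>: "\<delta> > 0" "\<And>s v. s \<in> dyadic_times \<inter> {..real n} \<inter> {t<..<t + \<delta>} \<Longrightarrow> \<bar>raw t \<omega> v - L s \<omega> v\<bar> \<le> \<epsilon> * Psum (H n) v"
    using raw_limit(3)[OF n t(1) _ \<epsilon>] t(2) by fastforce
  have "\<bar>raw u \<omega> v - raw t \<omega> v\<bar> \<le> \<epsilon> * Psum (H n) v" if u: "t < u" "u < t + min \<delta> 1" for u v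
  proof (rule tendsto_upperbound)
    have u': "0 \<le> u" "u + 1 \<le> real n" using u t by auto
    show "(\<lambda>k. \<bar>L (dyadic_above k u) \<omega> v - raw t \<omega> v\<bar>) \<longlonglongrightarrow> \<bar>raw u \<omega> v - raw t \<omega> v\<bar>"
      by (intro tendsto_intros raw_limit(2)[OF n u'])
    have "t + \<delta> - u > 0" using u by simp
    from eventually_dyadic_above[OF u'(1) this]
    show "eventually (\<lambda>k. \<bar>L (dyadic_above k u) \<omega> v - raw t \<omega> v\<bar> \<le> \<epsilon> * Psum (H n) v) sequentially"
    proof eventually_elim
      case (elim k)
      then show ?case
        using \<delta>(2)[of "dyadic_above k u" v] dyadic_above_le[OF u', of k] u(1) by (simp add: abs_minus_commute)
    qed
  qed simp
  then show ?thesis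
    unfolding eventually_at_right_field using \<delta>(1) by (intro exI[of _ "t + min \<delta> 1"]) auto
qed

text \<open>The limit is constructed along dyadic times before \<open>t\<close>. For
  \<open>u < t\<close> the functional \<open>raw u \<omega>\<close> is a limit of values at dyadic
  times between \<open>u\<close> and \<open>t\<close>, so the estimate at these times passes to
  it.\<close>

lemma raw_left_limit:
  assumes n: "n \<ge> N" and t: "0 < t" "t + 1 \<le> real n"
  shows "\<exists>f\<in>dball n. \<forall>\<epsilon>>0. eventually (\<lambda>u. \<forall>v. \<bar>raw u \<omega> v - f v\<bar> \<le> \<epsilon> * Psum (H n) v) (at_left t)"
proof -
  have lin: "\<forall>s\<in>dyadic_times \<inter> {..real n}. linear (L s \<omega>) \<and> (\<forall>v. \<bar>L s \<omega> v\<bar> \<le> c n * Psum (G n) v)"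
    using in_ballD good_ball[OF n] by blast
  have mono: "mono (\<lambda>\<delta>. {t - \<delta><..<t})" by (rule monoI) auto
  have pt: "\<forall>k. \<forall>j<len n k. \<forall>\<eta>>0. \<exists>\<delta>>0. \<forall>s\<in>dyadic_times \<inter> {..real n} \<inter> {t - \<delta><..<t}.
      \<forall>u\<in>dyadic_times \<inter> {..real n} \<inter> {t - \<delta><..<t}. \<bar>L u \<omega> (x n k j) - L s \<omega> (x n k j)\<bar> \<le> \<eta>"
    using good t(1) by (intro allI impI steadyD(2)) (auto simp: good_def)
  have \<sigma>: "\<forall>k. dyadic_below k t \<in> dyadic_times \<inter> {..real n}"
    "\<forall>\<delta>>0. eventually (\<lambda>k. dyadic_below k t \<in> {t - \<delta><..<t}) sequentially"
  proof -
    have "dyadic_below k t \<le> real n" for k using dyadic_below(2)[OF t(1), of k] t(2) by linarith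
    then show "\<forall>k. dyadic_below k t \<in> dyadic_times \<inter> {..real n}" using dyadic_below(1)[OF t(1)] by simp
    show "\<forall>\<delta>>0. eventually (\<lambda>k. dyadic_below k t \<in> {t - \<delta><..<t}) sequentially"
      using eventually_dyadic_below[OF t(1)] by blast
  qed
  note lim = one_sided_limit_functional[where X = "\<lambda>s. L s \<omega>", OF points c Psum_nonneg lin mono pt \<sigma>]
  define f where "f v = lim (\<lambda>k. L (dyadic_below k t) \<omega> v)" for v
  have f: "(\<lambda>v. lim (\<lambda>k. L (dyadic_below k t) \<omega> v)) = f" by (auto simp: f_def)
  note lim = lim[unfolded f, unfolded f_def[symmetric]]
  have "eventually (\<lambda>u. \<forall>v. \<bar>raw u \<omega> v - f v\<bar> \<le> \<epsilon> * Psum (H n) v) (at_left t)" if \<epsilon>: "\<epsilon> > 0" for \<epsilon>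
  proof -
    obtain \<delta> where \<delta>: "\<delta> > 0" "\<And>s v. s \<in> dyadic_times \<inter> {..real n} \<inter> {t - \<delta><..<t} \<Longrightarrow> \<bar>f v - L s \<omega> v\<bar> \<le> \<epsilon> * Psum (H n) v"
      using lim(4)[OF \<epsilon>] by auto
    have "\<bar>raw u \<omega> v - f v\<bar> \<le> \<epsilon> * Psum (H n) v" if u: "max 0 (t - \<delta>) < u" "u < t" for u v
    proof (rule tendsto_upperbound)
      have u': "0 \<le> u" "u + 1 \<le> real n" using u t by auto
      show "(\<lambda>k. \<bar>L (dyadic_above k u) \<omega> v - f v\<bar>) \<longlonglongrightarrow> \<bar>raw u \<omega> v - f v\<bar>"
        by (intro tendsto_intros raw_limit(2)[OF n u'])
      have "t - u > 0" using u by simp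
      from eventually_dyadic_above[OF u'(1) this]
      show "eventually (\<lambda>k. \<bar>L (dyadic_above k u) \<omega> v - f v\<bar> \<le> \<epsilon> * Psum (H n) v) sequentially"
      proof eventually_elim
        case (elim k)
        then show ?case
          using \<delta>(2)[of "dyadic_above k u" v] dyadic_above_le[OF u', of k] u(1) by (simp add: abs_minus_commute)
      qed
    qed simp
    then show ?thesis
      unfolding eventually_at_left_field using \<delta>(1) t(1) by (intro exI[of _ "max 0 (t - \<delta>)"]) auto
  qed
  moreover have "f \<in> dball n" using lim(1,2) by (rule in_ballI)
  ultimately show ?thesis by blast
qed

end

lemma L'_good: "good \<omega> N \<Longrightarrow> L' t \<omega> = raw t \<omega>"
  by (auto simp: L'_def)

lemma zero_in_ball: "(\<lambda>_. 0) \<in> dball n"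
  using c[of n] Psum_nonneg by (intro in_ballI) (auto intro!: mult_nonneg_nonneg simp: linear_iff less_imp_le)

lemma L'_ball: "0 \<le> t \<Longrightarrow> \<exists>n. L' t \<omega> \<in> dball n"
proof (cases "\<exists>N. good \<omega> N")
  case True
  assume t: "0 \<le> t"
  obtain N where N: "good \<omega> N" using True by blast
  define n where "n = max N (nat \<lceil>t + 1\<rceil>)"
  have "n \<ge> N" "t + 1 \<le> real n" unfolding n_def by linarith+
  then show ?thesis using raw_limit(1)[OF N _ t] L'_good[OF N] by auto
qed (auto simp: L'_def zero_in_ball)

text \<open>Continuity for the topology generated by the \<open>pp n\<close>, in quantitative form:
  since the sequence increases, a bound by one of its members is enough.\<close>

definition pbounded :: "('a \<Rightarrow> real) \<Rightarrow> bool" where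
  "pbounded f \<longleftrightarrow> linear f \<and> (\<exists>n C. \<forall>v. \<bar>f v\<bar> \<le> C * pp n v)"

lemma ball_pbounded: "f \<in> dball n \<Longrightarrow> pbounded f"
proof -
  assume f: "f \<in> dball n"
  have "\<bar>f v\<bar> \<le> c n * pp n v" for v
  proof -
    have "c n * Psum (G n) v \<le> c n * pp n v" by (intro mult_left_mono G_le_pp less_imp_le c)
    then show ?thesis using in_ballD(2)[OF f, of v] by linarith
  qed
  then show ?thesis using in_ballD(1)[OF f] unfolding pbounded_def by blast
qed

lemma L'_pbounded: "0 \<le> t \<Longrightarrow> pbounded (L' t \<omega>)"
  using L'_ball ball_pbounded by blast

text \<open>\<open>J\<close> is the identity for the dual of \<Phi>, and the extension of
  functionals for the dual of the completion; both cadlag statements are instances.\<close>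

lemma cadlag_path_L':
  assumes E: "tvs_base E" and \<rho>: "\<And>n. bounded_on_bounded E (\<rho> n)"
    and J: "\<And>f. pbounded f \<Longrightarrow> J f \<in> dual E"
    and J_le: "\<And>f g \<epsilon> n y. pbounded f \<Longrightarrow> pbounded g \<Longrightarrow> \<epsilon> > 0 \<Longrightarrow> (\<And>v. \<bar>f v - g v\<bar> \<le> \<epsilon> * pp n v) \<Longrightarrow>
      y \<in> vecs E \<Longrightarrow> \<bar>J f y - J g y\<bar> \<le> \<epsilon> * \<rho> n y"
  shows "cadlag_path (strong_dual E) (\<lambda>t. J (L' t \<omega>))"
proof (cases "\<exists>N. good \<omega> N")
  case False
  have zero: "pbounded (\<lambda>_. 0)" by (rule ball_pbounded[OF zero_in_ball])
  have "L' t \<omega> = (\<lambda>_. 0)" for t using False by (simp add: L'_def)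
  then show ?thesis
    unfolding cadlag_path_def using J[OF zero] by (auto simp: limitin_const_iff intro!: exI[of _ "J (\<lambda>_. 0)"])
next
  case True
  then obtain N where N: "good \<omega> N" by blast
  have weaken: "\<bar>a\<bar> \<le> \<epsilon> * pp n v" if "\<bar>a\<bar> \<le> \<epsilon> * Psum (H n) v" "\<epsilon> > 0" for a \<epsilon> :: real and n v
    using that mult_left_mono[OF H_le_pp[of n v], of \<epsilon>] by linarith
  have right: "limitin (strong_dual E) (\<lambda>t. J (L' t \<omega>)) (J (L' t \<omega>)) (at_right t)" if t: "0 \<le> t" for t
  proof -
    define n where "n = max N (nat \<lceil>t + 2\<rceil>)"
    have n: "n \<ge> N" "t + 2 \<le> real n" unfolding n_def by linarith+
    have nonneg: "eventually (\<lambda>u. 0 \<le> u) (at_right t)"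
      unfolding eventually_at_right_field using t by (intro exI[of _ "t + 1"]) auto
    show ?thesis
    proof (rule limitin_strong_dual[OF E \<rho>[of n]])
      show "J (L' t \<omega>) \<in> dual E" by (intro J L'_pbounded t)
      show "eventually (\<lambda>u. J (L' u \<omega>) \<in> dual E) (at_right t)"
        using nonneg by eventually_elim (intro J L'_pbounded)
      fix \<epsilon> :: real assume \<epsilon>: "\<epsilon> > 0"
      show "eventually (\<lambda>u. \<forall>y\<in>vecs E. \<bar>J (L' u \<omega>) y - J (L' t \<omega>) y\<bar> \<le> \<epsilon> * \<rho> n y) (at_right t)"
        using raw_right_continuous[OF N n(1) t n(2) \<epsilon>] nonneg
      proof eventually_elim
        case (elim u)
        then show ?case
          using t \<epsilon> L'_good[OF N] by (intro ballI J_le L'_pbounded) (auto intro!: weaken)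
      qed
    qed
  qed
  have left: "\<exists>l. limitin (strong_dual E) (\<lambda>t. J (L' t \<omega>)) l (at_left t)" if t: "0 < t" for t
  proof -
    define n where "n = max N (nat \<lceil>t + 1\<rceil>)"
    have n: "n \<ge> N" "t + 1 \<le> real n" unfolding n_def by linarith+
    obtain f where f: "f \<in> dball n"
      "\<forall>\<epsilon>>0. eventually (\<lambda>u. \<forall>v. \<bar>raw u \<omega> v - f v\<bar> \<le> \<epsilon> * Psum (H n) v) (at_left t)"
      using raw_left_limit[OF N n(1) t n(2)] by (elim bexE)
    have nonneg: "eventually (\<lambda>u. 0 \<le> u) (at_left t)"
      unfolding eventually_at_left_field using t by (intro exI[of _ 0]) auto
    have "limitin (strong_dual E) (\<lambda>t. J (L' t \<omega>)) (J f) (at_left t)"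
    proof (rule limitin_strong_dual[OF E \<rho>[of n]])
      show "J f \<in> dual E" by (intro J ball_pbounded[OF f(1)])
      show "eventually (\<lambda>u. J (L' u \<omega>) \<in> dual E) (at_left t)"
        using nonneg by eventually_elim (intro J L'_pbounded)
      fix \<epsilon> :: real assume \<epsilon>: "\<epsilon> > 0"
      show "eventually (\<lambda>u. \<forall>y\<in>vecs E. \<bar>J (L' u \<omega>) y - J f y\<bar> \<le> \<epsilon> * \<rho> n y) (at_left t)"
        using f(2)[THEN spec, THEN mp, OF \<epsilon>] nonneg
      proof eventually_elim
        case (elim u)
        then show ?case
          using \<epsilon> L'_good[OF N] ball_pbounded[OF f(1)] by (intro ballI J_le L'_pbounded) (auto intro!: weaken)
      qed
    qed
    then show ?thesis by blast
  qed
  show ?thesis unfolding cadlag_path_def using right left by blast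
qed

end

section \<open>The version and its laws\<close>

context regularization begin

abbreviation ctop :: "'a topology" where
  "ctop \<equiv> seminorm_topology (range pp)"

text \<open>The increment from \<open>t\<close> to \<open>dyadic_above k t\<close> tends to 0 in
  probability, by stationarity and continuity of the laws at 0, while at \<open>\<phi>\<close> it
  tends almost surely to the difference of \<open>raw t\<close> and \<open>L t\<close>. Dominated
  convergence for the truncated absolute value identifies the two limits.\<close>

lemma raw_eq_AE:
  assumes t: "0 \<le> t"
  shows "AE \<omega> in M. raw t \<omega> \<phi> = L t \<omega> \<phi>"
proof -
  let ?F = "\<lambda>f::'a \<Rightarrow> real. min 1 \<bar>f \<phi>\<bar>"
  let ?d = "\<lambda>k. dyadic_above k t"
  have d: "0 \<le> ?d k" "t \<le> ?d k" "?d k - t \<le> 1 / 2 ^ k" for k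
    using dyadic_above[OF t, of k] t by auto
  have F: "?F \<in> borel_measurable (borel_of S)" by measurable
  have raw_meas: "(\<lambda>\<omega>. raw t \<omega> \<phi>) \<in> borel_measurable M"
    unfolding raw_def using d(1) by (intro borel_measurable_lim_metric L_eval_measurable)
  have f_eq: "expectation (\<lambda>\<omega>. min 1 \<bar>L (?d k) \<omega> \<phi> - L t \<omega> \<phi>\<bar>) = expectation (\<lambda>\<omega>. min 1 \<bar>L (?d k - t) \<omega> \<phi>\<bar>)" for k
  proof -
    have "expectation (\<lambda>\<omega>. min 1 \<bar>L (?d k) \<omega> \<phi> - L t \<omega> \<phi>\<bar>) = (\<integral>f. ?F f \<partial>distr M (borel_of S) (incr t (?d k)))"
      by (rule integral_distr[OF incr_measurable[OF t d(2)] F, symmetric])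
    also have "\<dots> = (\<integral>f. ?F f \<partial>distr M (borel_of S) (L (?d k - t)))"
      by (simp add: L_stationary[OF t d(2)])
    also have "\<dots> = expectation (\<lambda>\<omega>. min 1 \<bar>L (?d k - t) \<omega> \<phi>\<bar>)"
      using d(2)[of k] by (intro integral_distr[OF L_measurable F]) simp
    finally show ?thesis .
  qed
  have "(\<lambda>k. expectation (\<lambda>\<omega>. min 1 \<bar>L (?d k) \<omega> \<phi> - L t \<omega> \<phi>\<bar>)) \<longlonglongrightarrow> 0"
  proof (rule LIMSEQ_I)
    fix r :: real assume r: "r > 0"
    obtain h where h: "h > 0" "\<And>s. 0 \<le> s \<Longrightarrow> s \<le> h \<Longrightarrow> expectation (\<lambda>\<omega>. min 1 \<bar>L s \<omega> \<phi>\<bar>) < r"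
      using small_time[OF r, where \<phi> = \<phi>] by blast
    obtain K where K: "\<And>k. k \<ge> K \<Longrightarrow> 1 / 2 ^ k < h"
      using eventually_power_half_less[OF h(1)] by (auto simp: eventually_sequentially)
    have "norm (expectation (\<lambda>\<omega>. min 1 \<bar>L (?d k) \<omega> \<phi> - L t \<omega> \<phi>\<bar>) - 0) < r" if "k \<ge> K" for k
    proof -
      have "0 \<le> expectation (\<lambda>\<omega>. min 1 \<bar>L (?d k) \<omega> \<phi> - L t \<omega> \<phi>\<bar>)" by (intro Bochner_Integration.integral_nonneg) auto
      moreover have "expectation (\<lambda>\<omega>. min 1 \<bar>L (?d k - t) \<omega> \<phi>\<bar>) < r"
        using d(2)[of k] d(3)[of k] K[OF that] by (intro h(2)) auto
      ultimately show ?thesis by (simp add: f_eq)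
    qed
    then show "\<exists>K. \<forall>k\<ge>K. norm (expectation (\<lambda>\<omega>. min 1 \<bar>L (?d k) \<omega> \<phi> - L t \<omega> \<phi>\<bar>) - 0) < r" by blast
  qed
  moreover have "(\<lambda>k. expectation (\<lambda>\<omega>. min 1 \<bar>L (?d k) \<omega> \<phi> - L t \<omega> \<phi>\<bar>)) \<longlonglongrightarrow> expectation (\<lambda>\<omega>. min 1 \<bar>raw t \<omega> \<phi> - L t \<omega> \<phi>\<bar>)"
  proof (rule integral_dominated_convergence[where w = "\<lambda>_. 1"])
    show "(\<lambda>\<omega>. min 1 \<bar>raw t \<omega> \<phi> - L t \<omega> \<phi>\<bar>) \<in> borel_measurable M"
      using raw_meas L_eval_measurable[OF t] by measurable
    show "(\<lambda>\<omega>. min 1 \<bar>L (?d k) \<omega> \<phi> - L t \<omega> \<phi>\<bar>) \<in> borel_measurable M" for k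
      using L_eval_measurable[OF d(1)] L_eval_measurable[OF t] by measurable
    show "AE \<omega> in M. (\<lambda>k. min 1 \<bar>L (?d k) \<omega> \<phi> - L t \<omega> \<phi>\<bar>) \<longlonglongrightarrow> min 1 \<bar>raw t \<omega> \<phi> - L t \<omega> \<phi>\<bar>"
      using good_AE
    proof eventually_elim
      case (elim \<omega>)
      then obtain N where N: "good \<omega> N" by blast
      define n where "n = max N (nat \<lceil>t + 1\<rceil>)"
      have n: "n \<ge> N" "t + 1 \<le> real n" unfolding n_def by linarith+
      show ?case by (intro tendsto_intros raw_limit(2)[OF N n(1) t n(2)])
    qed
  qed auto
  ultimately have zero: "expectation (\<lambda>\<omega>. min 1 \<bar>raw t \<omega> \<phi> - L t \<omega> \<phi>\<bar>) = 0"
    by (rule LIMSEQ_unique[THEN sym])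
  have "integrable M (\<lambda>\<omega>. min 1 \<bar>raw t \<omega> \<phi> - L t \<omega> \<phi>\<bar>)"
    using raw_meas L_eval_measurable[OF t] by (intro integrable_const_bound[where B = 1]) auto
  then have "AE \<omega> in M. min 1 \<bar>raw t \<omega> \<phi> - L t \<omega> \<phi>\<bar> = 0"
    using zero by (subst (asm) integral_nonneg_eq_0_iff_AE) auto
  then show ?thesis by eventually_elim (auto simp: min_def split: if_splits)
qed

text \<open>The null set of \<open>raw_eq_AE\<close> depends on the vector, so only the countably
  many vectors \<open>x n k j\<close> are used. For large \<open>n\<close> both functionals lie in
  the n-th ball, \<open>L t \<omega>\<close> by Borel--Cantelli with \<open>time_prob\<close>, and
  there these vectors determine them.\<close>

lemma L'_version:
  assumes t: "0 \<le> t"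
  shows "AE \<omega> in M. L' t \<omega> = L t \<omega>"
proof -
  \<comment> \<open>\<open>time_prob\<close> speaks only of indices with
    \<open>t \<le> real n\<close>; the finitely many others contribute the empty event, which leaves
    the tail of the sequence unchanged.\<close>
  let ?A = "\<lambda>n. if t \<le> real n then {\<omega> \<in> space M. L t \<omega> \<notin> dual_ball (Psum (G n)) (c n)} else {}"
  have ev: "?A n \<in> events" for n using L_dual_ball_event[OF t] by simp
  have "summable (\<lambda>n. (1 / 2 :: real) ^ n)" by (rule summable_geometric) simp
  then have "summable (\<lambda>n. prob (?A n))"
    by (rule summable_comparison_test'[where N = 0]) (use time_prob[OF t] in auto)
  then have 1: "AE \<omega> in M. eventually (\<lambda>n. \<omega> \<in> space M - ?A n) sequentially"
    using ev by (intro borel_cantelli_AE1) (auto simp: less_top[symmetric])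
  have 2: "AE \<omega> in M. \<forall>n k j. raw t \<omega> (x n k j) = L t \<omega> (x n k j)"
    unfolding AE_all_countable using raw_eq_AE[OF t] by blast
  show ?thesis
    using 1 2 good_AE AE_space
  proof eventually_elim
    case (elim \<omega>)
    obtain K where K: "\<And>n. n \<ge> K \<Longrightarrow> \<omega> \<in> space M - ?A n" using elim(1) by (auto simp: eventually_sequentially)
    obtain N where N: "good \<omega> N" using elim(3) by blast
    define n where "n = max K (max N (nat \<lceil>t + 1\<rceil>))"
    have n: "n \<ge> K" "n \<ge> N" "t + 1 \<le> real n" unfolding n_def by linarith+
    have L: "L t \<omega> \<in> dball n" using K[OF n(1)] n(3) by (simp add: dball_def)
    have R: "raw t \<omega> \<in> dball n" by (rule raw_limit(1)[OF N n(2) t n(3)])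
    have "raw t \<omega> = L t \<omega>"
      by (rule bounded_functionals_eq[OF points c Psum_nonneg in_ballD(1)[OF R] in_ballD(2)[OF R] in_ballD(1)[OF L] in_ballD(2)[OF L]])
        (use elim(2) in blast)
    then show ?case by (simp add: L'_good[OF N])
  qed
qed

lemma dball_dual: "f \<in> dball n \<Longrightarrow> f \<in> dual (tvs_of T)"
  by (simp add: dball_def dual_ball_def)

lemma L'_dual: "0 \<le> t \<Longrightarrow> L' t \<omega> \<in> dual (tvs_of T)"
  using L'_ball dball_dual by blast

lemma L'_measurable:
  assumes t: "0 \<le> t"
  shows "L' t \<in> M \<rightarrow>\<^sub>M borel_of S"
proof (rule complete_measure.complete_AE_measurable[OF complete L_measurable[OF t]])
  show "AE \<omega> in M. L t \<omega> = L' t \<omega>" using L'_version[OF t] by eventually_elim simp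
qed (simp add: L'_dual[OF t])

lemma dual_diff: "f \<in> dual (tvs_of T) \<Longrightarrow> g \<in> dual (tvs_of T) \<Longrightarrow> (\<lambda>\<phi>. f \<phi> - g \<phi>) \<in> dual (tvs_of T)"
  by (auto simp: dual_tvs_of intro: linear_compose_sub continuous_map_diff)

lemma L'_incr:
  assumes "0 \<le> s" "s \<le> t"
  shows "AE \<omega> in M. incr s t \<omega> = (\<lambda>\<phi>. L' t \<omega> \<phi> - L' s \<omega> \<phi>)"
    and "(\<lambda>\<omega> \<phi>. L' t \<omega> \<phi> - L' s \<omega> \<phi>) \<in> M \<rightarrow>\<^sub>M borel_of S"
proof -
  have t: "0 \<le> t" using assms by simp
  show AE: "AE \<omega> in M. incr s t \<omega> = (\<lambda>\<phi>. L' t \<omega> \<phi> - L' s \<omega> \<phi>)"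
    using L'_version[OF assms(1)] L'_version[OF t] by eventually_elim simp
  show "(\<lambda>\<omega> \<phi>. L' t \<omega> \<phi> - L' s \<omega> \<phi>) \<in> M \<rightarrow>\<^sub>M borel_of S"
    by (rule complete_measure.complete_AE_measurable[OF complete incr_measurable[OF assms] AE])
      (use L'_dual[OF assms(1)] L'_dual[OF t] in \<open>auto intro: dual_diff\<close>)
qed

lemma L'_law: "0 \<le> t \<Longrightarrow> distr M (borel_of S) (L' t) = distr M (borel_of S) (L t)"
  by (intro distr_cong_AE L'_version L'_measurable L_measurable) auto

text \<open>The clauses concern laws at single times, joint laws at finitely many times and almost
  sure statements, all of which pass to a modification. Only measurability of the values and
  increments is a separate matter, and it rests on completeness.\<close>

lemma L'_levy: "levy_process M T L'"
  unfolding levy_process_def Let_def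
proof (intro conjI allI impI)
  show "is_process M S L'" unfolding is_process_def using L'_measurable by blast
  show "AE \<omega> in M. L' 0 \<omega> = (\<lambda>\<phi>. 0)"
    using L_0 L'_version[of 0] by (auto elim: eventually_elim2)
next
  fix n and t :: "nat \<Rightarrow> real" assume t: "0 \<le> t 0 \<and> (\<forall>i<n. t i < t (Suc i))"
  have range: "0 \<le> t i" "t i \<le> t (Suc i)" if "i \<in> {..<n}" for i
  proof -
    have "t 0 \<le> t i" by (rule grid_mono[of n]) (use t that in auto)
    then show "0 \<le> t i" "t i \<le> t (Suc i)" using t that by (auto intro: less_imp_le)
  qed
  show "indep_vars (\<lambda>i. borel_of S) (\<lambda>i \<omega> \<phi>. L' (t (Suc i)) \<omega> \<phi> - L' (t i) \<omega> \<phi>) {..<n}"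
  proof (rule indep_vars_cong_AE)
    show "indep_vars (\<lambda>i. borel_of S) (\<lambda>i. incr (t i) (t (Suc i))) {..<n}"
      using t by (intro L_indep) blast+
    show "(\<lambda>\<omega> \<phi>. L' (t (Suc i)) \<omega> \<phi> - L' (t i) \<omega> \<phi>) \<in> M \<rightarrow>\<^sub>M borel_of S" if "i \<in> {..<n}" for i
      by (rule L'_incr(2)[OF range[OF that]])
    show "AE \<omega> in M. incr (t i) (t (Suc i)) \<omega> = (\<lambda>\<phi>. L' (t (Suc i)) \<omega> \<phi> - L' (t i) \<omega> \<phi>)" if "i \<in> {..<n}" for i
      by (rule L'_incr(1)[OF range[OF that]])
  qed simp
next
  fix s t :: real assume st: "0 \<le> s \<and> s \<le> t"
  have "distr M (borel_of S) (\<lambda>\<omega> \<phi>. L' t \<omega> \<phi> - L' s \<omega> \<phi>) = distr M (borel_of S) (incr s t)"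
  proof (rule distr_cong_AE)
    show "AE \<omega> in M. (\<lambda>\<phi>. L' t \<omega> \<phi> - L' s \<omega> \<phi>) = incr s t \<omega>"
      using L'_incr(1)[of s t] st by (auto elim!: eventually_mono)
  qed (use st L'_incr(2) incr_measurable in auto)
  also have "\<dots> = distr M (borel_of S) (L (t - s))" using st by (intro L_stationary) auto
  also have "\<dots> = distr M (borel_of S) (L' (t - s))" using st by (simp add: L'_law)
  finally show "distr M (borel_of S) (\<lambda>\<omega> \<phi>. L' t \<omega> \<phi> - L' s \<omega> \<phi>) = distr M (borel_of S) (L' (t - s))" .
next
  fix t :: real assume "0 \<le> t"
  then show "distr M (borel_of S) (L' t) \<in> radon_prob S" using L_radon by (simp add: L'_law)
next
  have sub: "U \<subseteq> {0..}" if "openin (top_of_set {0..}) U" for U :: "real set"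
    using openin_subset[OF that] by simp
  have eq: "(\<forall>y\<in>U. distr M (borel_of S) (L' y) \<in> V) \<longleftrightarrow> (\<forall>y\<in>U. distr M (borel_of S) (L y) \<in> V)"
    if "openin (top_of_set {0..}) U" for U V
    using sub[OF that] L'_law by (intro ball_cong) auto
  have map: "(\<lambda>t. distr M (borel_of S) (L' t)) \<in> {0..} \<rightarrow> A \<longleftrightarrow> (\<lambda>t. distr M (borel_of S) (L t)) \<in> {0..} \<rightarrow> A" for A
    using L'_law by (intro Pi_cong) auto
  show "topcontinuous_at (top_of_set {0..}) (weak_topology S) (\<lambda>t. distr M (borel_of S) (L' t)) 0"
    using L_continuous unfolding topcontinuous_at_def
    by (simp add: map L'_law eq cong: conj_cong)
qed

lemma countably_hilbertian_ctop: "countably_hilbertian T ctop"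
  unfolding countably_hilbertian_def
  using pp_hilbertian pp_continuous pp_mono by (intro exI[of _ pp]) auto

lemma ctop_seminorm: "p \<in> range pp \<Longrightarrow> is_seminorm p"
  using pp_seminorm by auto

lemma pbounded_dual: "pbounded f \<Longrightarrow> f \<in> dual (tvs_of T) \<and> f \<in> dual (tvs_of ctop)"
proof -
  assume "pbounded f"
  then obtain n C where f: "linear f" "\<And>v. \<bar>f v\<bar> \<le> C * pp n v" unfolding pbounded_def by blast
  have "continuous_map ctop euclideanreal (pp n)" by (intro continuous_map_seminorm pp_seminorm) simp
  then show ?thesis
    using bounded_linear_in_dual[OF P_seminorm pp_continuous pp_seminorm f]
      bounded_linear_in_dual[OF ctop_seminorm _ pp_seminorm f] by blast
qed

lemma L'_regular: "regular_process M T L'"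
  unfolding regular_process_def is_process_def
  using L'_measurable countably_hilbertian_ctop pbounded_dual[OF L'_pbounded] by blast

lemma L'_cadlag: "cadlag_process M S L'"
  unfolding cadlag_process_def is_process_def
proof (intro conjI allI impI AE_I2)
  fix \<omega>
  show "cadlag_path S (\<lambda>t. L' t \<omega>)"
  proof (rule cadlag_path_L'[where J = "\<lambda>f. f" and \<rho> = pp])
    show "tvs_base (tvs_of T)" by (rule tvs_base_tvs_of) simp
    show "bounded_on_bounded (tvs_of T) (pp n)" for n
      by (intro seminorm_bounded_on_bounded pp_continuous pp_seminorm) simp
  qed (use pbounded_dual in auto)
qed (rule L'_measurable)

section \<open>The process in the dual of the completion\<close>

interpretation \<Theta>: seminorm_family "range pp"
  by unfold_locales (rule ctop_seminorm)

definition Y :: "real \<Rightarrow> 'w \<Rightarrow> (nat \<Rightarrow> 'a) set \<Rightarrow> real" where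
  "Y t \<omega> = extended_functional ctop (L' t \<omega>)"

lemma pp_ctop: "continuous_map ctop euclideanreal (pp n)"
  by (intro continuous_map_seminorm pp_seminorm) simp

text \<open>\<open>extended_functional_diff_le\<close> refers both functionals to one semi-norm; the
  later of the two indices serves.\<close>

lemma pbounded_common:
  assumes "pbounded f" "pbounded g"
  shows "\<exists>n C. (\<forall>v. \<bar>f v\<bar> \<le> C * pp n v) \<and> (\<forall>v. \<bar>g v\<bar> \<le> C * pp n v)"
proof -
  obtain m n C D where f: "\<And>v. \<bar>f v\<bar> \<le> C * pp m v" and g: "\<And>v. \<bar>g v\<bar> \<le> D * pp n v"
    using assms unfolding pbounded_def by blast
  have weaken: "a * pp k v \<le> (\<bar>C\<bar> + \<bar>D\<bar>) * pp (max m n) v" if "k \<le> max m n" "\<bar>a\<bar> \<le> \<bar>C\<bar> + \<bar>D\<bar>" for a k v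
  proof -
    have "a * pp k v \<le> \<bar>a\<bar> * pp k v" by (intro mult_right_mono pp_nonneg) simp
    also have "\<dots> \<le> (\<bar>C\<bar> + \<bar>D\<bar>) * pp (max m n) v" using that by (intro mult_mono pp_mono pp_nonneg) auto
    finally show ?thesis .
  qed
  have "\<bar>f v\<bar> \<le> (\<bar>C\<bar> + \<bar>D\<bar>) * pp (max m n) v" for v
    by (rule order_trans[OF f weaken]) auto
  moreover have "\<bar>g v\<bar> \<le> (\<bar>C\<bar> + \<bar>D\<bar>) * pp (max m n) v" for v
    by (rule order_trans[OF g weaken]) auto
  ultimately show ?thesis by blast
qed

lemma extension_dual: "pbounded f \<Longrightarrow> extended_functional ctop f \<in> dual (tvs_completion ctop)"
  unfolding pbounded_def using \<Theta>.extended_functional_in_dual[OF pp_ctop pp_seminorm] by blast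

lemma extension_le:
  assumes f: "pbounded f" and g: "pbounded g" and le: "\<And>v. \<bar>f v - g v\<bar> \<le> \<epsilon> * pp n v"
    and y: "y \<in> vecs (tvs_completion ctop)"
  shows "\<bar>extended_functional ctop f y - extended_functional ctop g y\<bar> \<le> \<epsilon> * extended_seminorm (pp n) y"
proof -
  obtain m C where C: "\<And>v. \<bar>f v\<bar> \<le> C * pp m v" "\<And>v. \<bar>g v\<bar> \<le> C * pp m v" 
    using pbounded_common[OF f g] by blast
  have lin: "linear f" "linear g" using f g by (auto simp: pbounded_def)
  show ?thesis
    using \<Theta>.extended_functional_diff_le[OF pp_ctop pp_seminorm lin(2) C(2) lin(1) C(1) le pp_ctop pp_seminorm] y
    by (simp add: \<Theta>.vecs_E)
qed

text \<open>A strong neighbourhood in the dual of the completion contains a ball for the dual norm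
  of \<open>pp n\<close>. Within \<open>dball n\<close> this norm is controlled by finitely many
  evaluations, and conditions on these define \<open>W\<close>.\<close>

lemma extension_nbhd:
  assumes U: "openin (strong_dual (tvs_completion ctop)) U" and f: "f \<in> dball n" "extended_functional ctop f \<in> U"
  obtains W where "openin S W" "f \<in> W" "\<And>g. g \<in> W \<Longrightarrow> g \<in> dball n \<Longrightarrow> extended_functional ctop g \<in> U"
proof -
  obtain \<epsilon> where \<epsilon>: "\<epsilon> > 0" "\<And>h. h \<in> dual (tvs_completion ctop) \<Longrightarrow>
      (\<forall>y\<in>vecs (tvs_completion ctop). \<bar>h y - extended_functional ctop f y\<bar> \<le> \<epsilon> * extended_seminorm (pp n) y) \<Longrightarrow> h \<in> U"
    using strong_dual_nbhd[OF \<Theta>.tvs_base_E U f(2) \<Theta>.extended_seminorm_bounded[OF pp_ctop pp_seminorm]] by meson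
  obtain k \<eta> where \<eta>: "\<eta> > 0" and close:
    "\<forall>f g. linear f \<and> (\<forall>v. \<bar>f v\<bar> \<le> c n * Psum (G n) v) \<and> linear g \<and> (\<forall>v. \<bar>g v\<bar> \<le> c n * Psum (G n) v) \<and>
      (\<forall>j<len n k. \<bar>f (x n k j) - g (x n k j)\<bar> \<le> \<eta>) \<longrightarrow> (\<forall>v. \<bar>f v - g v\<bar> \<le> \<epsilon> * Psum (H n) v)"
    using bounded_functionals_nbhd[OF points c Psum_nonneg \<epsilon>(1)] by blast
  let ?V = "\<lambda>j. {g \<in> topspace S. g (x n k j) \<in> {f (x n k j) - \<eta><..<f (x n k j) + \<eta>}}"
  let ?W = "topspace S \<inter> (\<Inter>j<len n k. ?V j)"
  show thesis
  proof (rule that[of ?W])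
    have V: "openin S (?V j)" for j
      by (rule openin_continuous_map_preimage[OF evaluation_continuous]) simp
    show "openin S ?W"
    proof (cases "len n k = 0")
      case False
      then have "openin S (\<Inter>j<len n k. ?V j)" using V by (intro openin_INT2) auto
      then show ?thesis by blast
    qed (use openin_topspace[of S] in simp)
    show "f \<in> ?W" using dball_dual[OF f(1)] \<eta> by simp
    fix g assume g: "g \<in> ?W" "g \<in> dball n"
    have "\<bar>g (x n k j) - f (x n k j)\<bar> \<le> \<eta>" if "j < len n k" for j
    proof -
      have "g \<in> ?V j" using g(1) that by blast
      then show ?thesis by auto
    qed
    then have near: "\<forall>v. \<bar>g v - f v\<bar> \<le> \<epsilon> * Psum (H n) v"
      using in_ballD[OF f(1)] in_ballD[OF g(2)] by (intro close[THEN spec, THEN spec, THEN mp] conjI allI impI) auto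
    have le: "\<bar>g v - f v\<bar> \<le> \<epsilon> * pp n v" for v
      using near[THEN spec, of v] mult_left_mono[OF H_le_pp[of n v] less_imp_le[OF \<epsilon>(1)]] by linarith
    have gp: "pbounded g" by (rule ball_pbounded[OF g(2)])
    have fp: "pbounded f" by (rule ball_pbounded[OF f(1)])
    show "extended_functional ctop g \<in> U"
      using extension_le[OF gp fp le] by (intro \<epsilon>(2) extension_dual[OF gp]) blast
  qed
qed

text \<open>On each \<open>dball n\<close> the extension map is continuous from the topology of pointwise convergence,
  which makes \<open>Y t\<close> Borel measurable although the target need not be second countable.\<close>

lemma Y_measurable:
  assumes t: "0 \<le> t"
  shows "Y t \<in> M \<rightarrow>\<^sub>M borel_of (strong_dual (tvs_completion ctop))"
  unfolding borel_of_def
proof (rule measurable_measure_of)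
  let ?E = "tvs_completion ctop"
  show "{U. openin (strong_dual ?E) U} \<subseteq> Pow (topspace (strong_dual ?E))"
    using openin_subset[of "strong_dual ?E"] by blast
  show "Y t \<in> space M \<rightarrow> topspace (strong_dual ?E)"
    unfolding Y_def using extension_dual[OF L'_pbounded[OF t]] by simp
  fix U assume "U \<in> {U. openin (strong_dual ?E) U}"
  then have U: "openin (strong_dual ?E) U" by simp
  \<comment> \<open>The largest open set whose part in \<open>dball n\<close> is mapped into
    \<open>U\<close>; by \<open>extension_nbhd\<close> that part is the whole preimage of
    \<open>U\<close> in the ball.\<close>
  define O' where "O' n = \<Union>{W. openin S W \<and> (\<forall>g\<in>W \<inter> dball n. extended_functional ctop g \<in> U)}" for n
  have O'_open: "openin S (O' n)" for n unfolding O'_def by (rule openin_Union) blast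
  have O': "extended_functional ctop f \<in> U \<longleftrightarrow> f \<in> O' n" if f: "f \<in> dball n" for f n
  proof
    assume "extended_functional ctop f \<in> U"
    then obtain W where W: "openin S W" "f \<in> W" "\<And>g. g \<in> W \<Longrightarrow> g \<in> dball n \<Longrightarrow> extended_functional ctop g \<in> U"
      using extension_nbhd[OF U f] by blast
    then show "f \<in> O' n" unfolding O'_def by blast
  next
    assume "f \<in> O' n"
    then show "extended_functional ctop f \<in> U" unfolding O'_def using f by blast
  qed
  define A where "A = (\<Union>n. dball n \<inter> O' n)"
  have A: "A \<in> sets (borel_of S)"
    unfolding A_def dball_def using borel_of_open[OF O'_open] dual_ball_measurable by auto
  have iff: "L' t \<omega> \<in> A \<longleftrightarrow> Y t \<omega> \<in> U" for \<omega>
    using L'_ball[OF t, of \<omega>] O' unfolding A_def Y_def by blast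
  have "L' t -` A \<inter> space M \<in> sets M" by (rule measurable_sets[OF L'_measurable[OF t] A])
  moreover have "L' t -` A \<inter> space M = Y t -` U \<inter> space M" using iff by auto
  ultimately show "Y t -` U \<inter> space M \<in> sets M" by simp
qed

lemma Y_cadlag: "cadlag_process M (strong_dual (tvs_completion ctop)) Y"
  unfolding cadlag_process_def is_process_def
proof (intro conjI allI impI AE_I2)
  fix \<omega>
  show "cadlag_path (strong_dual (tvs_completion ctop)) (\<lambda>t. Y t \<omega>)"
    unfolding Y_def
    by (rule cadlag_path_L'[where J = "extended_functional ctop" and \<rho> = "\<lambda>n. extended_seminorm (pp n)",
          OF \<Theta>.tvs_base_E \<Theta>.extended_seminorm_bounded[OF pp_ctop pp_seminorm] extension_dual extension_le])
qed (rule Y_measurable)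

lemma restrict_Y: "0 \<le> t \<Longrightarrow> L' t \<omega> = restrict_functional ctop (Y t \<omega>)"
  using L'_pbounded[of t \<omega>] \<Theta>.restrict_extended_functional[OF pp_ctop pp_seminorm]
  unfolding pbounded_def Y_def by metis

lemma regularization:
  "\<exists>L'. is_version M L' L \<and> regular_process M T L' \<and> cadlag_process M S L' \<and> levy_process M T L' \<and>
    (\<exists>\<theta>. countably_hilbertian T \<theta> \<and>
      (\<exists>Y. cadlag_process M (strong_dual (tvs_completion \<theta>)) Y \<and>
        (\<forall>t\<ge>0. \<forall>\<omega>\<in>space M. L' t \<omega> = restrict_functional \<theta> (Y t \<omega>))))"
proof (intro exI conjI)
  show "is_version M L' L" unfolding is_version_def using L'_version by blast
  show "\<forall>t\<ge>0. \<forall>\<omega>\<in>space M. L' t \<omega> = restrict_functional ctop (Y t \<omega>)" using restrict_Y by blast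
qed (rule L'_regular L'_cadlag L'_levy countably_hilbertian_ctop Y_cadlag)+

end

lemma (in nuclear_levy) exists_regularization:
  obtains G H c len x where "regularization P M L G H c len x"
proof -
  \<comment> \<open>\<open>K\<close>, and \<open>Q\<close> below, bundle the requirements so that
    the choices for all indices can be made at once. The bounds \<open>(1 / 2) ^ n\<close> are
    summable, as Borel--Cantelli requires.\<close>
  define K where "K G c n \<longleftrightarrow> finite G \<and> G \<subseteq> P \<and> c > 0 \<and>
    {\<omega> \<in> space M. \<exists>t\<in>dyadic_times \<inter> {..real n}. L t \<omega> \<notin> dual_ball (Psum G) c} \<in> events \<and>
    prob {\<omega> \<in> space M. \<exists>t\<in>dyadic_times \<inter> {..real n}. L t \<omega> \<notin> dual_ball (Psum G) c} \<le> (1 / 2) ^ n \<and>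
    (\<forall>t. 0 \<le> t \<and> t \<le> real n \<longrightarrow> prob {\<omega> \<in> space M. L t \<omega> \<notin> dual_ball (Psum G) c} \<le> (1 / 2) ^ n)"
    for G and c :: real and n :: nat
  have "\<exists>G c. K G c n" for n
  proof -
    have pos: "(1 / 2 :: real) ^ n > 0" by simp
    show ?thesis
    proof (rule path_dual_ball[OF pos, of n])
      fix G c assume "finite G" "G \<subseteq> P" "c > 0"
        "{\<omega> \<in> space M. \<exists>t\<in>dyadic_times \<inter> {..real n}. L t \<omega> \<notin> dual_ball (Psum G) c} \<in> events"
        "prob {\<omega> \<in> space M. \<exists>t\<in>dyadic_times \<inter> {..real n}. L t \<omega> \<notin> dual_ball (Psum G) c} \<le> (1 / 2) ^ n"
        "\<And>t. 0 \<le> t \<Longrightarrow> t \<le> real n \<Longrightarrow> prob {\<omega> \<in> space M. L t \<omega> \<notin> dual_ball (Psum G) c} \<le> (1 / 2) ^ n"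
      then have "K G c n" unfolding K_def by (intro conjI allI impI) auto
      then show "\<exists>G c. K G c n" by blast
    qed
  qed
  then obtain G c where Gc: "\<And>n. K (G n) (c n) n" by metis
  have "\<exists>H. finite H \<and> G n \<subseteq> H \<and> H \<subseteq> P \<and> hs_bounded (Psum H) (Psum (G n))" for n
  proof -
    have "finite (G n)" "G n \<subseteq> P" using Gc[of n] by (auto simp: K_def)
    then show ?thesis by (rule exists_hs_Psum) blast
  qed
  then obtain H where H: "\<And>n. finite (H n)" "\<And>n. G n \<subseteq> H n" "\<And>n. H n \<subseteq> P" "\<And>n. hs_bounded (Psum (H n)) (Psum (G n))"
    by metis
  define Q where "Q n k m y \<longleftrightarrow> (\<forall>v. \<exists>a. (\<forall>j<m. \<bar>a j\<bar> \<le> Psum (H n) v) \<and>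
      Psum (G n) (v - (\<Sum>j<m. a j *\<^sub>R y j)) \<le> 1 / Suc k * Psum (H n) v)" for n k m :: nat and y
  have "\<exists>m y. Q n k m y" for n k
    unfolding Q_def using H Gc[of n]
    by (intro hs_bounded_totally_bounded Psum_hilbertian Psum_mono) (auto simp: K_def)
  then obtain len x where x: "\<And>n k. Q n k (len n k) (x n k)" by metis
  have "regularization P M L G H c len x"
  proof
    show "approximating_points (Psum (H n)) (Psum (G n)) (len n) (x n)" for n
      unfolding approximating_points_def using x[of n] unfolding Q_def by blast
  qed (use H Gc[unfolded K_def] in auto)
  then show thesis by (rule that)
qed

theorem theorem3p10:
  fixes T :: "'a::real_vector topology"
    and M :: "'w measure"
    and L :: "real \<Rightarrow> 'w \<Rightarrow> 'a \<Rightarrow> real"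
  assumes "nuclear T"
    and "prob_space M" and "complete_measure M"
    and "levy_process M T L"
    and "\<And>u::real. u > 0 \<Longrightarrow>
           equicontinuous_L0 T M {(\<lambda>\<phi>. L0_class M (\<lambda>\<omega>. L t \<omega> \<phi>)) | t. t \<in> {0..u}}"
  shows "\<exists>L'. is_version M L' L \<and>
              regular_process M T L' \<and>
              cadlag_process M (strong_dual (tvs_of T)) L' \<and>
              levy_process M T L' \<and>
              (\<exists>\<theta>. countably_hilbertian T \<theta> \<and>
                 (\<exists>Y. cadlag_process M (strong_dual (tvs_completion \<theta>)) Y \<and>
                      (\<forall>t\<ge>0. \<forall>\<omega>\<in>space M. L' t \<omega> = restrict_functional \<theta> (Y t \<omega>))))"
proof -
  obtain P where P: "nuclear_family P" "T = seminorm_topology P"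
    using nuclear_imp_family[OF assms(1)] by blast
  interpret nuclear_levy P M L
    using assms P unfolding nuclear_levy_def nuclear_levy_axioms_def by simp
  obtain G H c len x where "regularization P M L G H c len x" by (rule exists_regularization)
  then interpret regularization P M L G H c len x .
  show ?thesis unfolding P(2) by (rule regularization)
qed

end
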